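(* Let $\Omega\subset\mathbb{R}^N$ be a bounded Lipschitz domain with outward unit normal $n$, let $A:\bar\Omega\to\mathcal{M}_{N\times N}(\mathbb{R})$ be a smooth uniformly elliptic matrix field, $r\in C^{0,1}(\bar\Omega)$, $K\in C^{0,1}(\bar\Omega\times\bar\Omega)$, $p\ge1$, and set $\Psi(x,u)(t):=\int_\Omega K(x,y)|u(t,y)|^p\,dy$. Consider $$\frac{\partial u}{\partial t}=u\big(r(x)-\Psi(x,u)(t)\big)+\nabla\cdot(A(x)\nabla u)\ \text{ in }(0,\infty)\times\Omega,\qquad\frac{\partial u}{\partial n}=0\ \text{ on }(0,\infty)\times\partial\Omega.$$ Let $H$ be a $C^2$ function, let $u$ be a smooth solution and let $\bar u>0$ be a smooth stationary solution of this problem. Define $$\Gamma(t,x):=\Psi(x,\bar u)-\Psi(x,u)(t),\qquad \mathcal{H}(t):=\int_\Omega\bar u^2(x)H\Big(\frac{u(t,x)}{\bar u(x)}\Big)dx,$$ $$\mathcal{D}(u):=\int_\Omega\bar u^2(x)H''\Big(\frac{u}{\bar u}\Big)\Big(\nabla\frac{u}{\bar u}\Big)^tA(x)\nabla\frac{u}{\bar u}\,dx.$$ Then $$\frac{d\mathcal{H}(t)}{dt}=-\mathcal{D}(u)+\int_\Omega\bar u(x)H'\Big(\frac{u(t,x)}{\bar u(x)}\Big)\Gamma(t,x)u(t,x)\,dx.$$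
   Context: $(\vec a)^t$ denotes the transpose of a vector of $\mathbb{R}^N$.
   Formalization: The matrix field A is assumed symmetric, and the boundary condition ∂u/∂n = 0 (for u and for ū) is read as the conormal condition (A∇u)·n = 0 wherever the normal exists; for non-symmetric A, or with ∇u·n = 0 and anisotropic A, the identity fails in general. *)

theory Defs
  imports "HOL-Analysis.Analysis"
begin

fun Ck_on :: "nat \<Rightarrow> 'a::euclidean_space set \<Rightarrow> ('a \<Rightarrow> 'b::real_normed_vector) \<Rightarrow> bool" where
  "Ck_on 0 U f = continuous_on U f"
| "Ck_on (Suc k) U f =
     ((\<forall>x\<in>U. f differentiable (at x)) \<and>
      (\<forall>i\<in>Basis. Ck_on k U (\<lambda>x. frechet_derivative f (at x) i)))"

definition smooth_on_set :: "'a::euclidean_space set \<Rightarrow> ('a \<Rightarrow> 'b::real_normed_vector) \<Rightarrow> bool" where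
  "smooth_on_set S f \<longleftrightarrow> (\<exists>U. open U \<and> S \<subseteq> U \<and> (\<forall>k. Ck_on k U f))"

definition grad :: "(real^'n \<Rightarrow> real) \<Rightarrow> real^'n \<Rightarrow> real^'n" where
  "grad f x = (\<chi> i. frechet_derivative f (at x) (axis i 1))"

definition divergence :: "(real^'n \<Rightarrow> real^'n) \<Rightarrow> real^'n \<Rightarrow> real" where
  "divergence F x = (\<Sum>i\<in>UNIV. frechet_derivative F (at x) (axis i 1) $ i)"

text \<open>Bounded Lipschitz domain: open, bounded, connected, and locally near every boundary
  point the domain is the region below the graph of a Lipschitz function
  (in some orthonormal frame, given by a unit direction e).\<close>
definition lipschitz_domain :: "(real^'n) set \<Rightarrow> bool" where
  "lipschitz_domain \<Omega> \<longleftrightarrow> open \<Omega> \<and> bounded \<Omega> \<and> connected \<Omega> \<and> \<Omega> \<noteq> {} \<and>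
     (\<forall>x\<in>frontier \<Omega>. \<exists>e \<rho> L g. norm e = 1 \<and> \<rho> > 0 \<and> L-lipschitz_on UNIV g \<and>
        (\<forall>y. g y = g (y - (y \<bullet> e) *\<^sub>R e)) \<and>
        \<Omega> \<inter> ball x \<rho> = {y \<in> ball x \<rho>. y \<bullet> e < g (y - (y \<bullet> e) *\<^sub>R e)})"

text \<open>nu is the outward unit normal of Omega at the boundary point x (exists for almost every
  boundary point of a Lipschitz domain).\<close>
definition outward_normal :: "(real^'n) set \<Rightarrow> real^'n \<Rightarrow> real^'n \<Rightarrow> bool" where
  "outward_normal \<Omega> x \<nu> \<longleftrightarrow> x \<in> frontier \<Omega> \<and> norm \<nu> = 1 \<and>
     (\<forall>\<epsilon>>0. \<exists>\<delta>>0. \<forall>y\<in>ball x \<delta>.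
        ((y - x) \<bullet> \<nu> < - \<epsilon> * norm (y - x) \<longrightarrow> y \<in> \<Omega>) \<and>
        ((y - x) \<bullet> \<nu> > \<epsilon> * norm (y - x) \<longrightarrow> y \<notin> \<Omega>))"

definition unif_elliptic_field :: "(real^'n) set \<Rightarrow> (real^'n \<Rightarrow> real^'n^'n) \<Rightarrow> bool" where
  "unif_elliptic_field \<Omega> A \<longleftrightarrow> smooth_on_set (closure \<Omega>) A \<and>
     (\<forall>x\<in>closure \<Omega>. transpose (A x) = A x) \<and>
     (\<exists>\<alpha>>0. \<forall>x\<in>closure \<Omega>. \<forall>\<xi>. \<xi> \<bullet> (A x *v \<xi>) \<ge> \<alpha> * (norm \<xi>)\<^sup>2)"

definition Psi :: "(real^'n) set \<Rightarrow> (real^'n \<Rightarrow> real^'n \<Rightarrow> real) \<Rightarrow> real \<Rightarrow> real^'n \<Rightarrow> (real^'n \<Rightarrow> real) \<Rightarrow> real" where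
  "Psi \<Omega> K p x v = integral \<Omega> (\<lambda>y. K x y * \<bar>v y\<bar> powr p)"

end

theory Submission
  imports Defs "HOL-Real_Asymp.Real_Asymp"
begin

text \<open>
  With \<open>w = u / b\<close>, \<open>b\<close> the stationary solution, differentiate under the integral and insert the two equations.
  What remains to be shown is that the divergence of \<open>F = H'(w) (b A\<nabla>u - u A\<nabla>b) = H'(w) b\<^sup>2 A\<nabla>w\<close>
  has integral \<open>0\<close>. By the boundary conditions, \<open>F\<close> is orthogonal to the outward normal wherever
  that normal exists.

  A partition of unity reduces this to a field supported near a boundary point, where \<open>\<Omega>\<close> is \<open>h < 0\<close> with
  \<open>h(y) = y \<bullet> e - g(y)\<close> and \<open>g\<close> Lipschitz on the whole space and invariant along \<open>e\<close>. By Rademacher's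
  theorem \<open>h\<close> is differentiable almost everywhere, and by invariance along \<open>e\<close> it is then differentiable also
  at the projection of the point to the graph, where its gradient is normal. Hence \<open>Dh(F) = O(h)\<close>
  almost everywhere, and integrating \<open>div F\<close> by parts against the Lipschitz functions \<open>arctan (N h)\<close>
  gives the claim as \<open>N\<close> tends to infinity, without surface measure or traces.
\<close>

section \<open>Differentiability of Lipschitz functions of one variable\<close>

text \<open>The graph of \<open>g\<close> is itself a null set, so differentiability almost
  everywhere says nothing about its points directly. But each line along \<open>e\<close> meets it
  exactly once, and \<open>h\<close> is affine along such lines, so one good point on a line makes
  every point of that line good.

  The function arctan suits the layer at the boundary: the derivative of \<open>arctan (N h)\<close>
  carries the factor N / (1 + N^2 h^2). Times |h| this is at most 1 for every N, and it tends to 0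
  pointwise, so dominated convergence needs no rate. The limit of \<open>arctan (N h)\<close> is
  (pi/2) sgn h. As a compactly supported field has total divergence 0, testing with this limit
  yields -pi times the integral of the divergence over h < 0.

  Rademacher's theorem starts on lines: after adding L t a Lipschitz function is monotone, and
  Vitali covers compare its Stieltjes measure with Lebesgue measure. Fubini carries this to every
  fixed direction. Linearity in the direction is not visible pointwise and is obtained weakly,
  against Lipschitz test functions. A countable dense set of directions then gives the full
  derivative.\<close>

lemma emeasure_interval_measure_ball:
  fixes F :: "real \<Rightarrow> real"
  assumes F: "mono F" "continuous_on UNIV F" and "0 < \<rho>"
  shows "emeasure (interval_measure F) (ball c \<rho>) = ennreal (F (c + \<rho>) - F (c - \<rho>))"
proof -
  have mon: "F x \<le> F y" if "x \<le> y" for x y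
    using F(1) that by (auto dest: monoD)
  have cont': "continuous (at_right a) F" for a
    using F(2) by (simp add: continuous_on_eq_continuous_at continuous_at_imp_continuous_at_within)
  have pt: "emeasure (interval_measure F) {b} = 0" for b
    using emeasure_interval_measure_Icc[of b b F] mon F(2) by simp
  have "emeasure (interval_measure F) {c - \<rho><..c + \<rho>} = emeasure (interval_measure F) ({c - \<rho><..<c + \<rho>} \<union> {c + \<rho>})"
    using assms by (intro arg_cong[where f="emeasure _"]) auto
  also have "\<dots> = emeasure (interval_measure F) {c - \<rho><..<c + \<rho>}"
    by (intro emeasure_Un_null_set) (auto simp: null_sets_def pt)
  finally have "emeasure (interval_measure F) {c - \<rho><..<c + \<rho>} = emeasure (interval_measure F) {c - \<rho><..c + \<rho>}"
    by simp
  also have "\<dots> = ennreal (F (c + \<rho>) - F (c - \<rho>))"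
    using mon cont' assms by (intro emeasure_interval_measure_Ioc) auto
  finally show ?thesis
    by (simp add: ball_eq_greaterThanLessThan)
qed

lemma emeasure_ball_real: "0 < \<rho> \<Longrightarrow> emeasure lborel (ball c \<rho>) = ennreal (2 * \<rho>)" for c \<rho> :: real
  by (simp add: ball_eq_greaterThanLessThan)

text \<open>Restricting Vitali's theorem to balls inside \<open>U\<close> costs nothing, because the
  cover is fine: a ball through \<open>x\<close> of radius below \<open>e / 2\<close> has diameter
  below \<open>e\<close> and stays in \<open>ball x e\<close>. The balls need only contain
  \<open>x\<close>, not be centred there.\<close>

lemma Vitali_subcover_in_open:
  fixes B :: "real set"
  assumes U: "open U" "B \<subseteq> U"
    and fine: "\<And>x d. x \<in> B \<Longrightarrow> 0 < d \<Longrightarrow> \<exists>c \<rho>. x \<in> ball c \<rho> \<and> \<rho> < d \<and> P c \<rho>"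
  obtains C where "countable C" "\<And>i. i \<in> C \<Longrightarrow> 0 < snd i \<and> ball (fst i) (snd i) \<subseteq> U \<and> P (fst i) (snd i)"
    "disjoint_family_on (\<lambda>i. ball (fst i) (snd i)) C"
    "negligible (B - (\<Union>i \<in> C. ball (fst i) (snd i)))"
proof -
  define K where "K = {(c, \<rho>). 0 < \<rho> \<and> ball c \<rho> \<subseteq> U \<and> P c \<rho>}"
  have vit: "\<exists>i. i \<in> K \<and> x \<in> ball (fst i) (snd i) \<and> snd i < d" if "x \<in> B" "0 < d" for x d
  proof -
    obtain e where e: "0 < e" "ball x e \<subseteq> U"
      using U \<open>x \<in> B\<close> openE by blast
    have "0 < min d (e / 2)" using e that by simp
    from fine[OF \<open>x \<in> B\<close> this] obtain c \<rho> where c: "x \<in> ball c \<rho>" "\<rho> < min d (e / 2)" "P c \<rho>"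
      by blast
    have "0 < \<rho>" using c(1) by (metis mem_ball zero_le_dist le_less_trans)
    moreover have "ball c \<rho> \<subseteq> ball x e"
      using c by (auto simp: dist_real_def)
    ultimately show ?thesis using c e by (intro exI[of _ "(c,\<rho>)"]) (auto simp: K_def)
  qed
  obtain C where C: "countable C" "C \<subseteq> K"
    "pairwise (\<lambda>i j. disjnt (ball (fst i) (snd i)) (ball (fst j) (snd j))) C"
    "negligible (B - (\<Union>i \<in> C. ball (fst i) (snd i)))"
    using Vitali_covering_theorem_balls[of B K fst snd] vit by blast
  show thesis
    using C by (intro that[of C])
      (auto simp: K_def disjoint_family_on_def pairwise_def disjnt_def subset_iff)
qed

text \<open>Every ball of the Vitali subcover has Stieltjes mass at least \<open>q\<close> times its
  length. Disjointness lets both sides be summed, and what the balls miss of \<open>B\<close> is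
  Lebesgue null.\<close>

lemma measure_ge_of_slopes_above:
  fixes F :: "real \<Rightarrow> real"
  assumes F: "mono F" "continuous_on UNIV F" and U: "open U" "B \<subseteq> U" and B: "B \<in> sets borel"
    and q: "0 \<le> q"
    and slope: "\<And>x d. x \<in> B \<Longrightarrow> 0 < d \<Longrightarrow>
      \<exists>c \<rho>. x \<in> ball c \<rho> \<and> \<rho> < d \<and> q * (2 * \<rho>) < F (c + \<rho>) - F (c - \<rho>)"
  shows "ennreal q * emeasure lborel B \<le> emeasure (interval_measure F) U"
proof -
  let ?M = "interval_measure F"
  obtain C where C: "countable C"
    "\<And>i. i \<in> C \<Longrightarrow> 0 < snd i \<and> ball (fst i) (snd i) \<subseteq> U \<and>
      q * (2 * snd i) < F (fst i + snd i) - F (fst i - snd i)"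
    and disj: "disjoint_family_on (\<lambda>i. ball (fst i) (snd i)) C"
    and cover: "negligible (B - (\<Union>i \<in> C. ball (fst i) (snd i)))"
    using Vitali_subcover_in_open[OF U slope] by blast
  let ?W = "\<Union>i \<in> C. ball (fst i) (snd i)"
  have W: "?W \<in> sets borel" by (intro borel_open) auto
  have "B - ?W \<in> null_sets lborel"
    using cover W B by (metis negligible_iff_null_sets null_sets_completion_iff sets.Diff sets_lborel)
  then have "emeasure lborel B \<le> emeasure lborel (?W \<union> (B - ?W))"
    using W B by (intro emeasure_mono) auto
  also have "\<dots> = emeasure lborel ?W"
    using \<open>B - ?W \<in> null_sets lborel\<close> W by (intro emeasure_Un_null_set) auto
  also have "\<dots> = (\<integral>\<^sup>+i. emeasure lborel (ball (fst i) (snd i)) \<partial>count_space C)"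
    using C(1) disj by (intro emeasure_UN_countable) auto
  finally have "ennreal q * emeasure lborel B
      \<le> ennreal q * (\<integral>\<^sup>+i. emeasure lborel (ball (fst i) (snd i)) \<partial>count_space C)"
    by (intro mult_left_mono) auto
  also have "\<dots> = (\<integral>\<^sup>+i. ennreal q * emeasure lborel (ball (fst i) (snd i)) \<partial>count_space C)"
    by (rule nn_integral_cmult[symmetric]) auto
  also have "\<dots> \<le> (\<integral>\<^sup>+i. emeasure ?M (ball (fst i) (snd i)) \<partial>count_space C)"
  proof (intro nn_integral_mono)
    fix i assume "i \<in> space (count_space C)"
    then show "ennreal q * emeasure lborel (ball (fst i) (snd i)) \<le> emeasure ?M (ball (fst i) (snd i))"
      using q C(2)[of i] by (auto simp: emeasure_interval_measure_ball[OF F] emeasure_ball_real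
          simp flip: ennreal_mult intro!: ennreal_leI)
  qed
  also have "\<dots> = emeasure ?M ?W"
    using C(1) disj by (intro emeasure_UN_countable[symmetric]) auto
  also have "\<dots> \<le> emeasure ?M U"
    using C(2) U by (intro emeasure_mono) auto
  finally show ?thesis .
qed

text \<open>The bound is for an open set \<open>W\<close> rather than for \<open>B\<close>: the part
  of \<open>B\<close> outside \<open>W\<close> is Lebesgue null, but a monotone continuous
  \<open>F\<close> may give such a set positive Stieltjes mass. Openness of \<open>W\<close> allows
  the opposite estimate to be applied inside it.\<close>

lemma open_cover_of_slopes_below:
  fixes F :: "real \<Rightarrow> real"
  assumes F: "mono F" "continuous_on UNIV F" and U: "open U" "B \<subseteq> U" and p: "0 \<le> p"
    and slope: "\<And>x d. x \<in> B \<Longrightarrow> 0 < d \<Longrightarrow>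
      \<exists>c \<rho>. x \<in> ball c \<rho> \<and> \<rho> < d \<and> F (c + \<rho>) - F (c - \<rho>) < p * (2 * \<rho>)"
  obtains W where "open W" "negligible (B - W)"
    "emeasure (interval_measure F) W \<le> ennreal p * emeasure lborel U"
proof -
  let ?M = "interval_measure F"
  obtain C where C: "countable C"
    "\<And>i. i \<in> C \<Longrightarrow> 0 < snd i \<and> ball (fst i) (snd i) \<subseteq> U \<and>
      F (fst i + snd i) - F (fst i - snd i) < p * (2 * snd i)"
    and disj: "disjoint_family_on (\<lambda>i. ball (fst i) (snd i)) C"
    and cover: "negligible (B - (\<Union>i \<in> C. ball (fst i) (snd i)))"
    using Vitali_subcover_in_open[OF U slope] by blast
  let ?W = "\<Union>i \<in> C. ball (fst i) (snd i)"
  have "emeasure ?M ?W = (\<integral>\<^sup>+i. emeasure ?M (ball (fst i) (snd i)) \<partial>count_space C)"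
    using C(1) disj by (intro emeasure_UN_countable) auto
  also have "\<dots> \<le> (\<integral>\<^sup>+i. ennreal p * emeasure lborel (ball (fst i) (snd i)) \<partial>count_space C)"
  proof (intro nn_integral_mono)
    fix i assume "i \<in> space (count_space C)"
    then show "emeasure ?M (ball (fst i) (snd i)) \<le> ennreal p * emeasure lborel (ball (fst i) (snd i))"
      using p C(2)[of i] by (auto simp: emeasure_interval_measure_ball[OF F] emeasure_ball_real
          simp flip: ennreal_mult intro!: ennreal_leI)
  qed
  also have "\<dots> = ennreal p * (\<integral>\<^sup>+i. emeasure lborel (ball (fst i) (snd i)) \<partial>count_space C)"
    by (rule nn_integral_cmult) auto
  also have "\<dots> = ennreal p * emeasure lborel ?W"
    using C(1) disj by (subst emeasure_UN_countable) auto
  also have "\<dots> \<le> ennreal p * emeasure lborel U"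
    using C(2) U by (intro mult_left_mono emeasure_mono) auto
  finally show thesis using cover by (intro that[of ?W]) auto
qed

text \<open>Outer regularity upgrades two Vitali covers to \<open>q |B| \<le> \<mu>(W) \<le> p (|B| + e)\<close>.\<close>
lemma null_set_of_oscillating_slopes:
  fixes F :: "real \<Rightarrow> real"
  assumes F: "mono F" "continuous_on UNIV F" and B: "B \<in> sets borel" and pq: "0 \<le> p" "p < q"
    and above: "\<And>x d. x \<in> B \<Longrightarrow> 0 < d \<Longrightarrow>
      \<exists>c \<rho>. x \<in> ball c \<rho> \<and> \<rho> < d \<and> q * (2 * \<rho>) < F (c + \<rho>) - F (c - \<rho>)"
    and below: "\<And>x d. x \<in> B \<Longrightarrow> 0 < d \<Longrightarrow>
      \<exists>c \<rho>. x \<in> ball c \<rho> \<and> \<rho> < d \<and> F (c + \<rho>) - F (c - \<rho>) < p * (2 * \<rho>)"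
  shows "B \<in> null_sets lborel"
proof -
  \<comment> \<open>Pieces of finite measure come first, so that the two covering estimates can be
    compared as real numbers.\<close>
  have bdd: "emeasure lborel B' = 0" if B': "B' \<in> sets borel" "B' \<subseteq> B" "emeasure lborel B' < \<infinity>" for B'
  proof -
    obtain m where m: "0 \<le> m" "emeasure lborel B' = ennreal m"
      using B'(3) by (cases "emeasure lborel B'") auto
    have "q * m \<le> p * (m + e)" if "e > 0" for e
    proof -
      obtain U where U: "open U" "B' \<subseteq> U" "emeasure lborel (U - B') < ennreal e"
        using outer_regular_lborel[OF B'(1) \<open>e > 0\<close>] by blast
      have "emeasure lborel U \<le> emeasure lborel B' + emeasure lborel (U - B')"
        using emeasure_subadditive[of B' lborel "U - B'"] U B'
        by (simp add: Un_absorb1)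
      also have "\<dots> \<le> ennreal (m + e)"
        using U m \<open>e > 0\<close> by (auto simp: ennreal_plus intro!: add_left_mono)
      finally have Um: "emeasure lborel U \<le> ennreal (m + e)" .
      obtain W where W: "open W" "negligible (B' - W)"
        "emeasure (interval_measure F) W \<le> ennreal p * emeasure lborel U"
        using open_cover_of_slopes_below[OF F U(1,2) pq(1)] below B'(2) by (metis subsetD)
      have "B' - W \<in> null_sets lborel"
        using W B' by (metis borel_open negligible_iff_null_sets null_sets_completion_iff sets.Diff sets_lborel)
      then have "emeasure lborel B' = emeasure lborel (B' \<inter> W)"
        using B' W(1) by (metis Diff_Diff_Int emeasure_Diff_null_set sets_lborel)
      moreover have "ennreal q * emeasure lborel (B' \<inter> W) \<le> emeasure (interval_measure F) W"
      proof (rule measure_ge_of_slopes_above[OF F W(1)])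
        show "B' \<inter> W \<in> sets borel" using B' W(1) by auto
        show "\<exists>c \<rho>. x \<in> ball c \<rho> \<and> \<rho> < d \<and> q * (2 * \<rho>) < F (c + \<rho>) - F (c - \<rho>)"
          if "x \<in> B' \<inter> W" "0 < d" for x d
          using above[of x d] that B' by blast
      qed (use pq in auto)
      ultimately have "ennreal q * ennreal m \<le> emeasure (interval_measure F) W"
        using m by simp
      also have "\<dots> \<le> ennreal p * ennreal (m + e)"
        using W(3) Um mult_left_mono order_trans by (metis zero_le)
      finally have "ennreal (q * m) \<le> ennreal (p * (m + e))"
        using m pq \<open>e > 0\<close> by (simp add: ennreal_mult del: ennreal_plus)
      then show ?thesis using m pq \<open>e > 0\<close> by (simp add: ennreal_le_iff del: ennreal_plus)
    qed
    then have less: "(q - p) * m \<le> p * e" if "e > 0" for e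
      using that by (simp add: algebra_simps)
    have "(q - p) * m \<le> 0 + e" if "e > 0" for e
    proof -
      \<comment> \<open>Dividing by \<open>p + 1\<close> instead of \<open>p\<close> also covers
        \<open>p = 0\<close>.\<close>
      have "(q - p) * m \<le> p * (e / (p + 1))"
        using less[of "e / (p + 1)"] that pq by simp
      also have "\<dots> \<le> e" using that pq by (simp add: field_simps)
      finally show ?thesis by simp
    qed
    then have "(q - p) * m \<le> 0" by (rule field_le_epsilon)
    then show ?thesis using pq m by (simp add: mult_le_0_iff)
  qed
  have "B \<inter> ball 0 (real n) \<in> null_sets lborel" for n
    using B bdd[of "B \<inter> ball 0 (real n)"] emeasure_bounded_finite[of "B \<inter> ball 0 (real n)"]
    by (auto simp: null_sets_def bounded_Int)
  then have "(\<Union>n. B \<inter> ball 0 (real n)) \<in> null_sets lborel" by blast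
  moreover have "(\<Union>n. B \<inter> ball 0 (real n)) = B"
    using reals_Archimedean2 by (auto simp: dist_real_def)
  ultimately show ?thesis by simp
qed

text \<open>The intervals contain \<open>t\<close> but need not be centred at it; this makes the set a \<open>G\<^sub>\<delta>\<close>.\<close>
definition osc_slopes :: "(real \<Rightarrow> real) \<Rightarrow> real \<Rightarrow> real \<Rightarrow> real set" where
  "osc_slopes F p q = {t. \<forall>d>0.
     (\<exists>c \<rho>. t \<in> ball c \<rho> \<and> \<rho> < d \<and> q * (2 * \<rho>) < F (c + \<rho>) - F (c - \<rho>)) \<and>
     (\<exists>c \<rho>. t \<in> ball c \<rho> \<and> \<rho> < d \<and> F (c + \<rho>) - F (c - \<rho>) < p * (2 * \<rho>))}"

text \<open>For fixed \<open>c\<close> and \<open>\<rho>\<close> each slope condition is open in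
  \<open>x\<close>, so even the uncountable unions over \<open>c\<close> and \<open>\<rho>\<close>
  are open. Only \<open>d\<close> must run through a sequence, here
  \<open>inverse (real (Suc n))\<close>. Placing the base point in \<open>x\<close> gives the form
  that Fubini along lines requires.\<close>

lemma osc_slopes_line_borel:
  fixes f :: "'a::euclidean_space \<Rightarrow> real"
  assumes "continuous_on UNIV f"
  shows "{x. 0 \<in> osc_slopes (\<lambda>t. f (x + t *\<^sub>R v)) p q} \<in> sets borel"
proof -
  have cont: "continuous_on UNIV (\<lambda>x. f (x + s *\<^sub>R v))" for s
    by (rule continuous_on_compose2[OF assms]) (auto intro!: continuous_intros)
  define X where "X c \<rho> = {x. q * (2 * \<rho>) < f (x + (c + \<rho>) *\<^sub>R v) - f (x + (c - \<rho>) *\<^sub>R v)}" for c \<rho>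
  define Y where "Y c \<rho> = {x. f (x + (c + \<rho>) *\<^sub>R v) - f (x + (c - \<rho>) *\<^sub>R v) < p * (2 * \<rho>)}" for c \<rho>
  define I where "I n = {(c, \<rho>). (0::real) \<in> ball c \<rho> \<and> \<rho> < inverse (real (Suc n))}" for n
  have "open (X c \<rho>)" "open (Y c \<rho>)" for c \<rho>
    unfolding X_def Y_def by (intro open_Collect_less continuous_intros cont)+
  moreover have "{x. 0 \<in> osc_slopes (\<lambda>t. f (x + t *\<^sub>R v)) p q} =
      (\<Inter>n. (\<Union>(c,\<rho>)\<in>I n. X c \<rho>) \<inter> (\<Union>(c,\<rho>)\<in>I n. Y c \<rho>))" (is "?l = ?r")
  proof
    show "?l \<subseteq> ?r" unfolding osc_slopes_def X_def Y_def I_def by fastforce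
    show "?r \<subseteq> ?l"
    proof
      fix x assume x: "x \<in> ?r"
      have "(\<exists>c \<rho>. 0 \<in> ball c \<rho> \<and> \<rho> < d \<and> x \<in> X c \<rho>) \<and> (\<exists>c \<rho>. 0 \<in> ball c \<rho> \<and> \<rho> < d \<and> x \<in> Y c \<rho>)"
        if "d > 0" for d
      proof -
        obtain n where n: "inverse (real (Suc n)) < d" using reals_Archimedean \<open>d > 0\<close> by blast
        have "x \<in> (\<Union>(c,\<rho>)\<in>I n. X c \<rho>)" "x \<in> (\<Union>(c,\<rho>)\<in>I n. Y c \<rho>)" using x by blast+
        then show ?thesis using n unfolding I_def by force
      qed
      then show "x \<in> ?l" unfolding osc_slopes_def X_def Y_def by simp
    qed
  qed
  moreover have "(\<Union>(c,\<rho>)\<in>I n. X c \<rho>) \<inter> (\<Union>(c,\<rho>)\<in>I n. Y c \<rho>) \<in> sets borel" for n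
    using calculation(1,2) by (intro borel_open open_Int open_UN) auto
  ultimately show ?thesis by (simp only:) (intro sets.countable_INT'', auto)
qed

lemma osc_slopes_shift: "t \<in> osc_slopes F p q \<longleftrightarrow> 0 \<in> osc_slopes (\<lambda>s. F (t + s)) p q"
proof -
  have 1: "(\<exists>c \<rho>. t \<in> ball c \<rho> \<and> P \<rho> (c + \<rho>) (c - \<rho>)) \<longleftrightarrow>
      (\<exists>c \<rho>. 0 \<in> ball c \<rho> \<and> P \<rho> (t + (c + \<rho>)) (t + (c - \<rho>)))" (is "?L = ?R") for P
  proof
    assume ?L
    then obtain c \<rho> where "t \<in> ball c \<rho> \<and> P \<rho> (c + \<rho>) (c - \<rho>)" by blast
    then show ?R by (intro exI[of _ "c - t"] exI[of _ \<rho>]) (auto simp: dist_real_def)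
  next
    assume ?R
    then obtain c \<rho> where "0 \<in> ball c \<rho> \<and> P \<rho> (t + (c + \<rho>)) (t + (c - \<rho>))" by blast
    then show ?L by (intro exI[of _ "c + t"] exI[of _ \<rho>]) (auto simp: dist_real_def algebra_simps)
  qed
  show ?thesis
    unfolding osc_slopes_def mem_Collect_eq
    using 1[of "\<lambda>\<rho> a b. \<rho> < _ \<and> q * (2 * \<rho>) < F a - F b"]
      1[of "\<lambda>\<rho> a b. \<rho> < _ \<and> F a - F b < p * (2 * \<rho>)"] by simp
qed

lemma osc_slopes_borel:
  assumes "continuous_on UNIV F"
  shows "osc_slopes F p q \<in> sets borel"
  using osc_slopes_line_borel[OF assms, of 1 p q] by (simp add: osc_slopes_shift[symmetric])

text \<open>Adding \<open>L * t\<close> makes \<open>F\<close> monotone and raises every slope by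
  \<open>L\<close>, so the Vitali argument applies to \<open>p + L < q + L\<close>. If
  \<open>p + L\<close> is negative, no slope lies below \<open>p\<close>, since slopes of
  \<open>F\<close> are at least \<open>- L\<close>.\<close>

lemma osc_slopes_null:
  fixes F :: "real \<Rightarrow> real"
  assumes F: "L-lipschitz_on UNIV F" and "p < q"
  shows "osc_slopes F p q \<in> null_sets lborel"
proof (cases "0 \<le> p + L")
  case True
  define G where "G t = F t + L * t" for t
  have "mono G"
  proof (rule monoI)
    fix x y :: real assume "x \<le> y"
    then have "\<bar>F x - F y\<bar> \<le> L * (y - x)"
      using lipschitz_onD[OF F, of x y] by (simp add: dist_real_def)
    then show "G x \<le> G y" by (simp add: G_def algebra_simps)
  qed
  have cont: "continuous_on UNIV F"
    using F lipschitz_on_continuous_on by blast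
  then have "continuous_on UNIV G" unfolding G_def by (intro continuous_intros)
  have inc: "G (c + \<rho>) - G (c - \<rho>) = F (c + \<rho>) - F (c - \<rho>) + L * (2 * \<rho>)" for c \<rho>
    by (simp add: G_def algebra_simps)
  show ?thesis
  proof (rule null_set_of_oscillating_slopes[OF \<open>mono G\<close> \<open>continuous_on UNIV G\<close>])
    show "osc_slopes F p q \<in> sets borel" using cont by (rule osc_slopes_borel)
    show "0 \<le> p + L" "p + L < q + L" using True \<open>p < q\<close> by auto
    fix x d :: real assume "x \<in> osc_slopes F p q" "0 < d"
    then show "\<exists>c \<rho>. x \<in> ball c \<rho> \<and> \<rho> < d \<and> (q + L) * (2 * \<rho>) < G (c + \<rho>) - G (c - \<rho>)"
      "\<exists>c \<rho>. x \<in> ball c \<rho> \<and> \<rho> < d \<and> G (c + \<rho>) - G (c - \<rho>) < (p + L) * (2 * \<rho>)"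
      unfolding osc_slopes_def inc distrib_right by auto
  qed
next
  case False
  have "osc_slopes F p q = {}"
  proof (rule ccontr)
    assume "osc_slopes F p q \<noteq> {}"
    then obtain t c \<rho> where t: "t \<in> ball c \<rho>" "F (c + \<rho>) - F (c - \<rho>) < p * (2 * \<rho>)"
      unfolding osc_slopes_def by (auto dest: spec[of _ 1])
    then have "0 < \<rho>" by (metis mem_ball zero_le_dist le_less_trans)
    then have "- (L * (2 * \<rho>)) \<le> F (c + \<rho>) - F (c - \<rho>)"
      using lipschitz_onD[OF F, of "c + \<rho>" "c - \<rho>"] by (simp add: dist_real_def)
    moreover have "(p + L) * (2 * \<rho>) < 0"
      using False \<open>0 < \<rho>\<close> by (simp add: mult_less_0_iff)
    ultimately show False using t by (simp add: algebra_simps)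
  qed
  then show ?thesis by simp
qed

text \<open>A difference quotient at \<open>t\<close> has \<open>t\<close> as an endpoint of its
  interval, whereas \<open>osc_slopes\<close> asks for \<open>t\<close> in the open interval. A
  strict slope inequality survives a small enlargement by \<open>\<delta>\<close> at both ends, by
  continuity.\<close>

lemma slope_ball_around:
  fixes f :: "real \<Rightarrow> real"
  assumes f: "continuous_on UNIV f" and ab: "a < b" "a \<le> t" "t \<le> b" "b - a < d"
    and slope: "q * (b - a) < f b - f a"
  shows "\<exists>c \<rho>. t \<in> ball c \<rho> \<and> \<rho> < d \<and> q * (2 * \<rho>) < f (c + \<rho>) - f (c - \<rho>)"
proof -
  have cont: "isCont f x" for x
    using f by (simp add: continuous_on_eq_continuous_at)
  have "((\<lambda>\<delta>. f (b + \<delta>) - f (a - \<delta>) - q * (b - a + 2 * \<delta>)) \<longlongrightarrow> f (b + 0) - f (a - 0) - q * (b - a + 2 * 0)) (at_right 0)"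
    by (intro tendsto_intros isCont_tendsto_compose[OF cont] tendsto_eq_rhs[OF tendsto_ident_at])
  then have "\<forall>\<^sub>F \<delta> in at_right 0. 0 < f (b + \<delta>) - f (a - \<delta>) - q * (b - a + 2 * \<delta>)"
    using slope by (intro order_tendstoD(1)) auto
  moreover have "\<forall>\<^sub>F \<delta> in at_right 0. 0 < \<delta> \<and> \<delta> < d / 2"
    using ab by (intro eventually_conj eventually_at_right_less eventually_at_rightI[of 0 "d/2"]) auto
  ultimately have "\<forall>\<^sub>F \<delta> in at_right (0::real). 0 < f (b + \<delta>) - f (a - \<delta>) - q * (b - a + 2 * \<delta>) \<and> 0 < \<delta> \<and> \<delta> < d / 2"
    by eventually_elim auto
  then obtain \<delta> where \<delta>: "0 < f (b + \<delta>) - f (a - \<delta>) - q * (b - a + 2 * \<delta>)" "0 < \<delta>" "\<delta> < d / 2"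
    using eventually_happens trivial_limit_at_right_real by blast
  let ?c = "(a + b) / 2" and ?\<rho> = "(b - a) / 2 + \<delta>"
  have eq: "?c + ?\<rho> = b + \<delta>" "?c - ?\<rho> = a - \<delta>" "2 * ?\<rho> = b - a + 2 * \<delta>"
    by (auto simp: field_simps)
  have "t \<in> ball ?c ?\<rho>"
    unfolding mem_ball dist_real_def using \<delta> ab by (auto simp: abs_real_def field_simps)
  moreover have "?\<rho> < d" using \<delta> ab by argo
  moreover have "q * (2 * ?\<rho>) < f (?c + ?\<rho>) - f (?c - ?\<rho>)" unfolding eq using \<delta> by argo
  ultimately show ?thesis by blast
qed

text \<open>If the lower and upper limits of the difference quotient differed, two rationals would
  fit between them and the slopes would oscillate across both. The Lipschitz bound makes the common
  limit finite.\<close>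

lemma real_derivative_if_no_osc:
  fixes f :: "real \<Rightarrow> real"
  assumes f: "L-lipschitz_on UNIV f"
    and no: "\<And>p q. p \<in> \<rat> \<Longrightarrow> q \<in> \<rat> \<Longrightarrow> p < q \<Longrightarrow> t \<notin> osc_slopes f p q"
  shows "\<exists>D. (f has_real_derivative D) (at t)"
proof -
  define Q where "Q h = (f (t + h) - f t) / h" for h
  have cont: "continuous_on UNIV f"
    using f lipschitz_on_continuous_on by blast
  then have cont': "continuous_on UNIV (\<lambda>x. - f x)" by (intro continuous_intros)
  have Q_bound: "\<bar>Q h\<bar> \<le> L" if "h \<noteq> 0" for h
    using lipschitz_onD[OF f, of "t + h" t] that by (simp add: Q_def dist_real_def divide_simps abs_mult)
  have freq_above: "\<exists>c \<rho>. t \<in> ball c \<rho> \<and> \<rho> < d \<and> q * (2 * \<rho>) < g (c + \<rho>) - g (c - \<rho>)"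
    if "continuous_on UNIV g" "\<exists>\<^sub>F h in at 0. q < (g (t + h) - g t) / h" "d > 0" for q d and g :: "real \<Rightarrow> real"
  proof -
    have "\<forall>\<^sub>F h in at (0::real). h \<noteq> 0 \<and> \<bar>h\<bar> < d"
      using \<open>d > 0\<close> by (auto simp: eventually_at dist_real_def)
    with that(2) have "\<exists>\<^sub>F h in at 0. q < (g (t + h) - g t) / h \<and> (h \<noteq> 0 \<and> \<bar>h\<bar> < d)"
      by (rule frequently_eventually_frequently)
    then obtain h where h: "q < (g (t + h) - g t) / h" "h \<noteq> 0" "\<bar>h\<bar> < d"
      by (auto dest: frequently_ex)
    show ?thesis
    proof (cases "h > 0")
      case True
      then show ?thesis
        using h by (intro slope_ball_around[OF that(1), of t "t + h"]) (auto simp: field_simps)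
    next
      case False
      then show ?thesis
        using h by (intro slope_ball_around[OF that(1), of "t + h" t]) (auto simp: field_simps)
    qed
  qed
  have "Liminf (at 0) (\<lambda>h. ereal (Q h)) = Limsup (at 0) (\<lambda>h. ereal (Q h))"
  proof (rule ccontr)
    assume "\<not> ?thesis"
    then have "Liminf (at 0) (\<lambda>h. ereal (Q h)) < Limsup (at 0) (\<lambda>h. ereal (Q h))"
      using Liminf_le_Limsup[of "at (0::real)" "\<lambda>h. ereal (Q h)"] by (simp add: less_le)
    then obtain a b where ab: "Liminf (at 0) (\<lambda>h. ereal (Q h)) < ereal a" "a < b"
      "ereal b < Limsup (at 0) (\<lambda>h. ereal (Q h))"
      by (metis ereal_dense2 less_ereal.simps(1))
    obtain p where p: "p \<in> \<rat>" "a < p" "p < b" using Rats_dense_in_real ab(2) by blast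
    obtain q where q: "q \<in> \<rat>" "p < q" "q < b" using Rats_dense_in_real p(3) by blast
    have below: "\<exists>\<^sub>F h in at 0. Q h < p"
    proof (rule ccontr)
      assume "\<not> ?thesis"
      then have "\<forall>\<^sub>F h in at 0. ereal p \<le> ereal (Q h)" by (simp add: not_frequently not_less)
      then have "ereal p \<le> Liminf (at 0) (\<lambda>h. ereal (Q h))" by (rule Liminf_bounded)
      then show False using ab(1) p(2) by (metis ereal_less(2) ereal_less_eq(3) leD less_imp_le order_trans)
    qed
    have above: "\<exists>\<^sub>F h in at 0. q < Q h"
    proof (rule ccontr)
      assume "\<not> ?thesis"
      then have "\<forall>\<^sub>F h in at 0. ereal (Q h) \<le> ereal q" by (simp add: not_frequently not_less)
      then have "Limsup (at 0) (\<lambda>h. ereal (Q h)) \<le> ereal q" by (rule Limsup_bounded)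
      then show False using ab(3) q(3) by (metis ereal_less(2) ereal_less_eq(3) leD less_imp_le order_trans)
    qed
    have "t \<in> osc_slopes f p q"
      unfolding osc_slopes_def mem_Collect_eq
    proof (intro allI impI conjI)
      fix d :: real assume "d > 0"
      show "\<exists>c \<rho>. t \<in> ball c \<rho> \<and> \<rho> < d \<and> q * (2 * \<rho>) < f (c + \<rho>) - f (c - \<rho>)"
        using freq_above[OF cont _ \<open>d > 0\<close>] above by (simp add: Q_def)
      \<comment> \<open>A slope of \<open>f\<close> below \<open>p\<close> is a slope of
        \<open>- f\<close> above \<open>- p\<close>, so one lemma serves both sides.\<close>
      have "\<exists>c \<rho>. t \<in> ball c \<rho> \<and> \<rho> < d \<and> (- p) * (2 * \<rho>) < - f (c + \<rho>) - - f (c - \<rho>)"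
        using below by (intro freq_above[OF cont' _ \<open>d > 0\<close>])
          (auto simp: Q_def diff_divide_distrib elim!: frequently_mono[rotated])
      then show "\<exists>c \<rho>. t \<in> ball c \<rho> \<and> \<rho> < d \<and> f (c + \<rho>) - f (c - \<rho>) < p * (2 * \<rho>)"
        by (auto simp: algebra_simps)
    qed
    then show False using no p(1) q(1,2) by blast
  qed
  then have lim: "((\<lambda>h. ereal (Q h)) \<longlongrightarrow> Limsup (at 0) (\<lambda>h. ereal (Q h))) (at 0)"
    by (intro Liminf_eq_Limsup) auto
  have ev: "\<forall>\<^sub>F h in at 0. \<bar>Q h\<bar> \<le> L"
    using Q_bound by (auto simp: eventually_at intro!: exI[of _ 1])
  have "Limsup (at 0) (\<lambda>h. ereal (Q h)) \<le> ereal L"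
    using ev by (intro Limsup_bounded) (auto elim!: eventually_mono)
  moreover have "ereal (- L) \<le> Liminf (at 0) (\<lambda>h. ereal (Q h))"
    using ev by (intro Liminf_bounded) (auto elim!: eventually_mono)
  ultimately obtain D where "Limsup (at 0) (\<lambda>h. ereal (Q h)) = ereal D"
    using \<open>Liminf _ _ = _\<close> by (cases "Limsup (at 0) (\<lambda>h. ereal (Q h))") auto
  with lim have "(Q \<longlongrightarrow> D) (at 0)" by simp
  then show ?thesis
    unfolding Q_def DERIV_def by blast
qed

text \<open>Fubini on \<open>\<real>\<^sup>n \<times> [0, 1]\<close> combined with translation invariance; no choice of coordinates adapted
  to \<open>v\<close> is needed.\<close>
lemma null_set_if_null_on_lines:
  fixes N :: "'a::euclidean_space set"
  assumes N: "N \<in> sets borel" and line: "\<And>x. {t. x + t *\<^sub>R v \<in> N} \<in> null_sets lborel"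
  shows "N \<in> null_sets lborel"
proof -
  define g :: "'a \<times> real \<Rightarrow> ennreal" where "g = (\<lambda>(x, t). indicator N (x + t *\<^sub>R v) * indicator {0..1} t)"
  have N': "N \<in> sets lborel" using N by simp
  have meas: "g \<in> borel_measurable (lborel \<Otimes>\<^sub>M lborel)"
    unfolding g_def using N by measurable
  have "(\<integral>\<^sup>+t. \<integral>\<^sup>+x. g (x, t) \<partial>lborel \<partial>lborel) = (\<integral>\<^sup>+x. \<integral>\<^sup>+t. g (x, t) \<partial>lborel \<partial>lborel)"
    using meas by (rule lborel_pair.Fubini)
  also have "\<dots> = (\<integral>\<^sup>+x. 0 \<partial>(lborel :: 'a measure))"
  proof (intro nn_integral_cong)
    fix x
    have "AE t in lborel. t \<notin> {t. x + t *\<^sub>R v \<in> N}" by (rule AE_not_in[OF line])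
    then have "AE t in lborel. g (x, t) = 0"
      by (rule AE_mp) (auto simp: g_def indicator_def)
    then show "(\<integral>\<^sup>+t. g (x, t) \<partial>lborel) = 0"
      using nn_integral_cong_AE by fastforce
  qed
  finally have "(\<integral>\<^sup>+t. \<integral>\<^sup>+x. g (x, t) \<partial>lborel \<partial>lborel) = 0" by simp
  \<comment> \<open>In the other order of integration each slice at time \<open>t\<close> is a
    translate of \<open>N\<close>; the factor on \<open>t\<close> keeps the total equal to the
    measure of \<open>N\<close>.\<close>
  moreover have "(\<integral>\<^sup>+x. g (x, t) \<partial>lborel) = emeasure lborel N * indicator {0..1} t" for t
  proof -
    have "(\<integral>\<^sup>+x. indicator N (x + t *\<^sub>R v) \<partial>lborel) = (\<integral>\<^sup>+x. indicator N x \<partial>distr lborel borel ((+) (t *\<^sub>R v)))"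
      using N by (subst nn_integral_distr) (auto simp: add.commute)
    also have "\<dots> = emeasure lborel N"
      using N' by (simp add: lborel_distr_plus)
    finally show ?thesis
      unfolding g_def using N by (simp add: nn_integral_multc)
  qed
  ultimately have "emeasure lborel N * emeasure lborel {0..1::real} = 0"
    by (simp add: nn_integral_cmult)
  then show ?thesis using N' by (auto simp: null_sets_def)
qed

section \<open>From one variable to a fixed direction in several variables\<close>

lemma lipschitz_on_line:
  fixes f :: "'a::real_normed_vector \<Rightarrow> real"
  assumes "L-lipschitz_on UNIV f"
  shows "(L * norm v)-lipschitz_on UNIV (\<lambda>t. f (x + t *\<^sub>R v))"
proof (rule lipschitz_onI)
  fix s t :: real
  have "dist (f (x + s *\<^sub>R v)) (f (x + t *\<^sub>R v)) \<le> L * dist (x + s *\<^sub>R v) (x + t *\<^sub>R v)"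
    using lipschitz_onD[OF assms] by blast
  also have "dist (x + s *\<^sub>R v) (x + t *\<^sub>R v) = norm v * dist s t"
    by (simp add: dist_norm flip: scaleR_diff_left)
  finally show "dist (f (x + s *\<^sub>R v)) (f (x + t *\<^sub>R v)) \<le> L * norm v * dist s t" by simp
qed (use lipschitz_on_nonneg[OF assms] in auto)

text \<open>For each rational pair \<open>p < q\<close>, the bad set meets every line along
  \<open>v\<close> in an \<open>osc_slopes\<close> set of a Lipschitz function of one variable. Such
  sections are null, and there are only countably many pairs.\<close>

lemma AE_directional_derivative:
  fixes f :: "'a::euclidean_space \<Rightarrow> real"
  assumes f: "L-lipschitz_on UNIV f"
  shows "AE x in lborel. \<exists>D. ((\<lambda>t. f (x + t *\<^sub>R v)) has_real_derivative D) (at 0)"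
proof -
  have cont: "continuous_on UNIV f" using f lipschitz_on_continuous_on by blast
  define N where "N p q = {x. 0 \<in> osc_slopes (\<lambda>t. f (x + t *\<^sub>R v)) p q}" for p q
  have "N p q \<in> null_sets lborel" if "p < q" for p q
  proof (rule null_set_if_null_on_lines)
    show "N p q \<in> sets borel" unfolding N_def by (rule osc_slopes_line_borel[OF cont])
    fix x
    have "{t. x + t *\<^sub>R v \<in> N p q} = osc_slopes (\<lambda>t. f (x + t *\<^sub>R v)) p q"
      by (auto simp: N_def osc_slopes_shift[of _ "\<lambda>t. f (x + t *\<^sub>R v)"] scaleR_add_left add.assoc)
    then show "{t. x + t *\<^sub>R v \<in> N p q} \<in> null_sets lborel"
      using osc_slopes_null[OF lipschitz_on_line[OF f] that] by simp
  qed
  then have "(\<Union>p\<in>\<rat>. \<Union>q\<in>\<rat>. if p < q then N p q else {}) \<in> null_sets lborel"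
    by (intro null_sets_UN' countable_rat) auto
  then have "AE x in lborel. x \<notin> (\<Union>p\<in>\<rat>. \<Union>q\<in>\<rat>. if p < q then N p q else {})"
    by (rule AE_not_in)
  then show ?thesis
  proof (rule AE_mp, intro AE_I2 impI)
    fix x assume "x \<notin> (\<Union>p\<in>\<rat>. \<Union>q\<in>\<rat>. if p < q then N p q else {})"
    then show "\<exists>D. ((\<lambda>t. f (x + t *\<^sub>R v)) has_real_derivative D) (at 0)"
      by (intro real_derivative_if_no_osc[OF lipschitz_on_line[OF f]]) (auto simp: N_def split: if_splits)
  qed
qed

section \<open>Rademacher's theorem\<close>

lemma integrable_if_bounded_support:
  fixes g :: "'a::euclidean_space \<Rightarrow> real"
  assumes "g \<in> borel_measurable borel" "\<And>x. \<bar>g x\<bar> \<le> M * indicator (cball 0 R) x"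
  shows "integrable lborel g"
proof (rule Bochner_Integration.integrable_bound)
  have "emeasure lborel (cball (0::'a) R) < \<infinity>"
    by (intro emeasure_bounded_finite) auto
  then show "integrable lborel (\<lambda>x::'a. M * indicator (cball 0 R) x)"
    by (intro integrable_mult_right integrable_real_indicator) auto
  show "AE x in lborel. norm (g x) \<le> norm (M * indicator (cball 0 R) x)"
    unfolding real_norm_def by (intro AE_I2 order_trans[OF assms(2) abs_ge_self])
qed (use assms in auto)

text \<open>The indicator of a compact set is the pointwise limit of the Lipschitz cutoffs
  \<open>\<phi> k\<close>, all supported in one ball, so the vanishing integrals pass to the limit
  by dominated convergence.\<close>

lemma set_integral_zero_of_tests:
  fixes w :: "'a::euclidean_space \<Rightarrow> real"
  assumes w: "w \<in> borel_measurable borel" and bound: "AE x in lborel. \<bar>w x\<bar> \<le> M"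
    and test: "\<And>\<phi> L R. L-lipschitz_on UNIV \<phi> \<Longrightarrow> (\<And>x. 0 \<le> \<phi> x \<and> \<phi> x \<le> 1) \<Longrightarrow>
      (\<And>x. R < norm x \<Longrightarrow> \<phi> x = 0) \<Longrightarrow> (\<integral>x. w x * \<phi> x \<partial>lborel) = 0"
    and C: "compact C"
  shows "(\<integral>x. w x * indicator C x \<partial>lborel) = 0" "integrable lborel (\<lambda>x. w x * indicator C x)"
proof -
  obtain R where R: "\<And>x. x \<in> C \<Longrightarrow> norm x \<le> R"
    using C compact_imp_bounded bounded_iff by metis
  have Cb: "C \<in> sets borel" using C borel_compact by blast
  \<comment> \<open>\<open>infdist\<close> to the empty set is 0 by convention, which would turn the
    cutoff into the constant 1; hence the case split.\<close>
  define \<phi> where "\<phi> k x = (if C = {} then 0 else max 0 (1 - real (Suc k) * infdist x C))" for k and x :: 'a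
  have \<phi>01: "0 \<le> \<phi> k x \<and> \<phi> k x \<le> 1" for k x
    by (auto simp: \<phi>_def infdist_nonneg)
  have \<phi>0: "\<phi> k x = 0" if "R + 1 < norm x" for k x
  proof (cases "C = {}")
    case False
    then obtain c where c: "c \<in> C" "infdist x C = dist x c"
      using infdist_attains_inf[of C x] C compact_imp_closed by blast
    have "norm x \<le> norm c + dist x c" by (metis add.commute dist_norm norm_triangle_sub)
    then have "1 < dist x c" using R[OF c(1)] that by linarith
    then have "1 \<le> real (Suc k) * infdist x C" using c by (simp add: add_increasing mult_ge1_I)
    then show ?thesis by (simp add: \<phi>_def)
  qed (simp add: \<phi>_def)
  have lip: "(real (Suc k))-lipschitz_on UNIV (\<phi> k)" for k
  proof (rule lipschitz_onI)
    fix x y :: 'a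
    have "\<bar>infdist x C - infdist y C\<bar> \<le> dist x y"
      using infdist_triangle_abs by blast
    then have "real (Suc k) * \<bar>infdist x C - infdist y C\<bar> \<le> real (Suc k) * dist x y"
      by (intro mult_left_mono) auto
    then have "\<bar>real (Suc k) * infdist x C - real (Suc k) * infdist y C\<bar> \<le> real (Suc k) * dist x y"
      by (simp add: abs_mult flip: right_diff_distrib)
    then show "dist (\<phi> k x) (\<phi> k y) \<le> real (Suc k) * dist x y"
      by (auto simp: \<phi>_def dist_real_def)
  qed auto
  have meas: "\<phi> k \<in> borel_measurable borel" for k
    using lip lipschitz_on_continuous_on borel_measurable_continuous_onI by blast
  have ind: "\<phi> k x \<le> indicator (cball 0 (R + 1)) x" for k x
    using \<phi>0[of x k] \<phi>01[of k x] by (auto simp: indicator_def)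
  have lim: "(\<lambda>k. \<phi> k x) \<longlonglongrightarrow> indicator C x" for x
  proof (cases "x \<in> C")
    case True
    then have "\<phi> k x = 1" for k by (auto simp: \<phi>_def)
    then show ?thesis using True by simp
  next
    case False
    have "\<forall>\<^sub>F k in sequentially. \<phi> k x = 0"
    proof (cases "C = {}")
      case ne: False
      then have "0 < infdist x C"
        using False C compact_imp_closed in_closed_iff_infdist_zero infdist_nonneg
        by (metis less_le)
      then obtain n where n: "1 < real n * infdist x C" using reals_Archimedean3 by blast
      have "\<phi> k x = 0" if "k \<ge> n" for k
      proof -
        have "real n * infdist x C \<le> real (Suc k) * infdist x C"
          using that by (intro mult_right_mono) (auto simp: infdist_nonneg)
        then show ?thesis using n by (simp add: \<phi>_def)
      qed
      then show ?thesis by (auto simp: eventually_sequentially)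
    qed (simp add: \<phi>_def)
    then show ?thesis using False by (simp add: tendsto_eventually)
  qed
  have fin: "emeasure lborel (cball (0::'a) (R + 1)) < \<infinity>"
    by (intro emeasure_bounded_finite) auto
  have dom: "integrable lborel (\<lambda>x::'a. M * indicator (cball 0 (R + 1)) x)"
    using fin by (intro integrable_mult_right integrable_real_indicator) auto
  have AEb: "AE x in lborel. norm (w x * \<phi> k x) \<le> M * indicator (cball 0 (R + 1)) x" for k
    using bound
  proof (rule AE_mp, intro AE_I2 impI)
    fix x assume "\<bar>w x\<bar> \<le> M"
    then have "\<bar>w x\<bar> * \<phi> k x \<le> M * indicator (cball 0 (R + 1)) x"
      using ind \<phi>01 by (intro mult_mono) auto
    then show "norm (w x * \<phi> k x) \<le> M * indicator (cball 0 (R + 1)) x"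
      using \<phi>01[of k x] by (simp add: abs_mult)
  qed
  have AEl: "AE x in lborel. (\<lambda>k. w x * \<phi> k x) \<longlonglongrightarrow> w x * indicator C x"
    using lim by (intro AE_I2 tendsto_intros) 
  have m1: "(\<lambda>x. w x * indicator C x) \<in> borel_measurable lborel"
    using w Cb by simp
  have m2: "(\<lambda>x. w x * \<phi> k x) \<in> borel_measurable lborel" for k
    using w meas by simp
  have "(\<lambda>k. \<integral>x. w x * \<phi> k x \<partial>lborel) \<longlonglongrightarrow> (\<integral>x. w x * indicator C x \<partial>lborel)"
    by (rule integral_dominated_convergence[OF m1 m2 dom AEl AEb])
  moreover have "(\<integral>x. w x * \<phi> k x \<partial>lborel) = 0" for k
    using lip[of k] \<phi>01 \<phi>0 by (rule test)
  ultimately show "(\<integral>x. w x * indicator C x \<partial>lborel) = 0"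
    by (simp add: LIMSEQ_const_iff)
  show "integrable lborel (\<lambda>x. w x * indicator C x)"
    by (rule integrable_dominated_convergence[OF m1 m2 dom AEl AEb])
qed

text \<open>By inner regularity, a closed \<open>T\<close> exhausts the bounded set
  \<open>S m\<close>, on which \<open>w\<close> is positive, up to measure \<open>e\<close>. A
  vanishing integral of \<open>w\<close> over the compact set \<open>T\<close> forces
  \<open>T\<close> to be null, so \<open>S m\<close> has measure at most \<open>e\<close>.\<close>

lemma AE_nonpos_of_compact_integrals:
  fixes w :: "'a::euclidean_space \<Rightarrow> real"
  assumes w: "w \<in> borel_measurable borel"
    and int: "\<And>C. compact C \<Longrightarrow> integrable lborel (\<lambda>x. w x * indicator C x)"
    and zero: "\<And>C. compact C \<Longrightarrow> (\<integral>x. w x * indicator C x \<partial>lborel) = 0"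
  shows "AE x in lborel. w x \<le> 0"
proof -
  define S where "S m = {x. 0 < w x} \<inter> ball 0 (real m)" for m
  have Sb: "S m \<in> sets borel" for m
    unfolding S_def using w by measurable
  have "emeasure lborel (S m) \<le> 0 + ennreal e" if "e > 0" for m and e :: real
  proof -
    have "S m \<in> sets lebesgue" using Sb by simp
    then obtain T where T: "closed T" "T \<subseteq> S m" "S m - T \<in> lmeasurable" "emeasure lebesgue (S m - T) < ennreal e"
      using sets_lebesgue_inner_closed \<open>e > 0\<close> by blast
    have "compact T"
      using T(1,2) by (auto simp: S_def compact_eq_bounded_closed intro: bounded_subset[OF bounded_ball])
    have Tb: "T \<in> sets borel" using T by auto
    have "AE x in lborel. 0 \<le> w x * indicator T x"
      using T(2) by (intro AE_I2) (auto simp: S_def indicator_def)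
    then have "AE x in lborel. w x * indicator T x = 0"
      using integral_nonneg_eq_0_iff_AE[OF int[OF \<open>compact T\<close>]] zero[OF \<open>compact T\<close>] by simp
    then have "AE x in lborel. x \<notin> T"
    proof (rule AE_mp, intro AE_I2 impI)
      fix x assume "w x * indicator T x = 0"
      then show "x \<notin> T" using T(2) by (auto simp: S_def)
    qed
    then have "T \<in> null_sets lborel" using Tb by (simp add: AE_iff_null_sets)
    then have "emeasure lborel (S m) = emeasure lborel (S m - T)"
      using Sb by (simp add: emeasure_Diff_null_set)
    also have "\<dots> \<le> ennreal e" using less_imp_le[OF T(4)] Sb Tb by simp
    finally show ?thesis by simp
  qed
  then have "emeasure lborel (S m) \<le> 0" for m by (rule ennreal_le_epsilon)
  then have "(\<Union>m. S m) \<in> null_sets lborel"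
    using Sb by (intro null_sets_UN) (auto simp: null_sets_def)
  then have "AE x in lborel. x \<notin> (\<Union>m. S m)" by (rule AE_not_in)
  then show ?thesis
  proof (rule AE_mp, intro AE_I2 impI)
    fix x assume "x \<notin> (\<Union>m. S m)"
    moreover obtain m where "norm x < real m" using reals_Archimedean2 by blast
    moreover from calculation(1) have "x \<notin> S m" by blast
    ultimately show "w x \<le> 0" by (simp add: S_def not_less)
  qed
qed

lemma AE_zero_of_Lipschitz_tests:
  fixes w :: "'a::euclidean_space \<Rightarrow> real"
  assumes w: "w \<in> borel_measurable borel" and bound: "AE x in lborel. \<bar>w x\<bar> \<le> M"
    and test: "\<And>\<phi> L R. L-lipschitz_on UNIV \<phi> \<Longrightarrow> (\<And>x. 0 \<le> \<phi> x \<and> \<phi> x \<le> 1) \<Longrightarrow>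
      (\<And>x. R < norm x \<Longrightarrow> \<phi> x = 0) \<Longrightarrow> (\<integral>x. w x * \<phi> x \<partial>lborel) = 0"
  shows "AE x in lborel. w x = 0"
proof -
  have C1: "(\<integral>x. w x * indicator K x \<partial>lborel) = 0" if "compact K" for K
  proof (rule set_integral_zero_of_tests(1)[OF w bound _ that])
    fix \<phi> :: "'a \<Rightarrow> real" and L R
    assume \<phi>: "L-lipschitz_on UNIV \<phi>" "\<And>x. 0 \<le> \<phi> x \<and> \<phi> x \<le> 1" "\<And>x. R < norm x \<Longrightarrow> \<phi> x = 0"
    show "(\<integral>x. w x * \<phi> x \<partial>lborel) = 0"
      by (rule test[OF \<phi>])
  qed
  have C2: "integrable lborel (\<lambda>x. w x * indicator K x)" if "compact K" for K
  proof (rule set_integral_zero_of_tests(2)[OF w bound _ that])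
    fix \<phi> :: "'a \<Rightarrow> real" and L R
    assume \<phi>: "L-lipschitz_on UNIV \<phi>" "\<And>x. 0 \<le> \<phi> x \<and> \<phi> x \<le> 1" "\<And>x. R < norm x \<Longrightarrow> \<phi> x = 0"
    show "(\<integral>x. w x * \<phi> x \<partial>lborel) = 0"
      by (rule test[OF \<phi>])
  qed
  have "AE x in lborel. w x \<le> 0"
    by (rule AE_nonpos_of_compact_integrals[OF w C2 C1])
  moreover have "AE x in lborel. - w x \<le> 0"
  proof (rule AE_nonpos_of_compact_integrals)
    show "(\<lambda>x. - w x) \<in> borel_measurable borel" using w by simp
    show "integrable lborel (\<lambda>x. - w x * indicator K x)" if "compact K" for K
      using C2[OF that] by simp
    show "(\<integral>x. - w x * indicator K x \<partial>lborel) = 0" if "compact K" for K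
      using C1[OF that] by simp
  qed
  ultimately show ?thesis by eventually_elim auto
qed

text \<open>A limit along the sequence \<open>1 / (n + 1)\<close>, so that it is a Borel function of \<open>x\<close>, with a junk value where
  the limit does not exist.\<close>
definition dirderiv :: "('a::euclidean_space \<Rightarrow> real) \<Rightarrow> 'a \<Rightarrow> 'a \<Rightarrow> real" where
  "dirderiv f v x = lim (\<lambda>n. real (Suc n) * (f (x + (1 / real (Suc n)) *\<^sub>R v) - f x))"

lemma inverse_Suc_at_0: "filterlim (\<lambda>n. 1 / real (Suc n)) (at 0) sequentially"
  using LIMSEQ_inverse_real_of_nat
  by (auto simp: filterlim_at inverse_eq_divide)

lemma directional_quotient_tendsto:
  fixes f :: "'a::real_normed_vector \<Rightarrow> real"
  assumes "((\<lambda>t. f (x + t *\<^sub>R v)) has_real_derivative D) (at 0)"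
  shows "(\<lambda>n. real (Suc n) * (f (x + (1 / real (Suc n)) *\<^sub>R v) - f x)) \<longlonglongrightarrow> D"
proof -
  have "((\<lambda>h. (f (x + h *\<^sub>R v) - f x) / h) \<longlongrightarrow> D) (at 0)"
    using assms unfolding DERIV_def by simp
  from filterlim_compose[OF this inverse_Suc_at_0] show ?thesis
    by (simp add: mult.commute)
qed

lemma dirderiv_eq:
  fixes f :: "'a::euclidean_space \<Rightarrow> real"
  assumes "((\<lambda>t. f (x + t *\<^sub>R v)) has_real_derivative D) (at 0)"
  shows "dirderiv f v x = D"
  unfolding dirderiv_def using directional_quotient_tendsto[OF assms] by (rule limI)

lemma borel_measurable_dirderiv:
  fixes f :: "'a::euclidean_space \<Rightarrow> real"
  assumes "continuous_on UNIV f"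
  shows "dirderiv f v \<in> borel_measurable borel"
proof -
  have "continuous_on UNIV (\<lambda>x. f (x + s *\<^sub>R v))" for s
    by (rule continuous_on_compose2[OF assms]) (auto intro!: continuous_intros)
  then have "(\<lambda>x. f (x + s *\<^sub>R v)) \<in> borel_measurable borel" for s
    by (rule borel_measurable_continuous_onI)
  moreover have "f \<in> borel_measurable borel"
    using assms by (rule borel_measurable_continuous_onI)
  ultimately show ?thesis
    unfolding dirderiv_def[abs_def]
    by (intro borel_measurable_lim_metric borel_measurable_times borel_measurable_diff) auto
qed

lemma AE_has_dirderiv:
  fixes f :: "'a::euclidean_space \<Rightarrow> real"
  assumes f: "L-lipschitz_on UNIV f"
  shows "AE x in lborel. ((\<lambda>t. f (x + t *\<^sub>R v)) has_real_derivative dirderiv f v x) (at 0)"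
  using AE_directional_derivative[OF f, of v]
  by eventually_elim (metis dirderiv_eq)

lemma integral_lborel_translate:
  fixes g :: "'a::euclidean_space \<Rightarrow> real"
  assumes "g \<in> borel_measurable borel"
  shows "(\<integral>x. g (x + c) \<partial>lborel) = (\<integral>x. g x \<partial>lborel)"
  using assms
  by (subst (2) lborel_distr_plus[of c, symmetric]) (simp add: integral_distr add.commute)

text \<open>Moving the second-order difference of \<open>f\<close> onto \<open>\<phi>\<close> makes it a product of two first-order differences,
  hence quadratically small.\<close>
lemma AE_dirderiv_add:
  fixes f :: "'a::euclidean_space \<Rightarrow> real"
  assumes f: "L-lipschitz_on UNIV f"
  shows "AE x in lborel. dirderiv f (u + v) x = dirderiv f u x + dirderiv f v x"
proof -
  have cont: "continuous_on UNIV f" using f lipschitz_on_continuous_on by blast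
  have L: "0 \<le> L" using f lipschitz_on_nonneg by blast
  have fd: "\<bar>f (x + s *\<^sub>R v) - f x\<bar> \<le> L * (\<bar>s\<bar> * norm v)" for x s
    using lipschitz_onD[OF f, of "x + s *\<^sub>R v" x] by (simp add: dist_norm)
  have fm: "(\<lambda>x. f (x + c)) \<in> borel_measurable borel" for c
    by (intro borel_measurable_continuous_onI continuous_on_compose2[OF cont] continuous_intros) auto
  define w where "w x = dirderiv f (u + v) x - dirderiv f u x - dirderiv f v x" for x
  define s where "s n = 1 / real (Suc n)" for n
  have s: "0 < s n" "real (Suc n) * s n = 1" for n by (auto simp: s_def)
  \<comment> \<open>The mixed second difference of \<open>f\<close> in the directions
    \<open>u\<close> and \<open>v\<close>, divided by only one power of the step. Regrouped, it is
    the quotient along \<open>u + v\<close> minus those along \<open>u\<close> and \<open>v\<close>,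
    so it tends to \<open>w\<close> almost everywhere.\<close>
  define g where "g n x = real (Suc n) * ((f (x + s n *\<^sub>R u + s n *\<^sub>R v) - f (x + s n *\<^sub>R u)) - (f (x + s n *\<^sub>R v) - f x))" for n x
  have g_bound: "\<bar>g n x\<bar> \<le> 2 * L * norm v" for n x
  proof -
    have "\<bar>g n x\<bar> \<le> real (Suc n) * (L * (\<bar>s n\<bar> * norm v) + L * (\<bar>s n\<bar> * norm v))"
      unfolding g_def abs_mult
      by (intro mult_mono order_trans[OF abs_triangle_ineq4 add_mono[OF fd fd]]) auto
    also have "\<dots> = 2 * L * norm v * (real (Suc n) * s n)" using s(1)[of n] by (simp add: algebra_simps)
    finally show ?thesis unfolding s(2) by simp
  qed
  have wm: "w \<in> borel_measurable borel"
    unfolding w_def using cont by (intro borel_measurable_diff borel_measurable_dirderiv)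
  have gm: "g n \<in> borel_measurable borel" for n
    unfolding g_def using fm[of "s n *\<^sub>R u + s n *\<^sub>R v"] fm[of "s n *\<^sub>R u"] fm[of "s n *\<^sub>R v"] fm[of 0]
    by (intro borel_measurable_times borel_measurable_diff) (auto simp: add.assoc)
  have lim: "AE x in lborel. (\<lambda>n. g n x) \<longlonglongrightarrow> w x"
    using AE_has_dirderiv[OF f, of "u + v"] AE_has_dirderiv[OF f, of u] AE_has_dirderiv[OF f, of v]
  proof eventually_elim
    case (elim x)
    from this[THEN directional_quotient_tendsto]
    have "(\<lambda>n. real (Suc n) * (f (x + s n *\<^sub>R (u + v)) - f x) - real (Suc n) * (f (x + s n *\<^sub>R u) - f x)
        - real (Suc n) * (f (x + s n *\<^sub>R v) - f x)) \<longlonglongrightarrow> w x"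
      unfolding w_def s_def by (intro tendsto_diff)
    also have "(\<lambda>n. real (Suc n) * (f (x + s n *\<^sub>R (u + v)) - f x) - real (Suc n) * (f (x + s n *\<^sub>R u) - f x)
        - real (Suc n) * (f (x + s n *\<^sub>R v) - f x)) = (\<lambda>n. g n x)"
      unfolding g_def by (simp add: scaleR_add_right add.assoc right_diff_distrib)
    finally show ?case .
  qed
  have "AE x in lborel. \<bar>w x\<bar> \<le> 2 * L * norm v"
    using lim
  proof eventually_elim
    case (elim x)
    then have "(\<lambda>n. \<bar>g n x\<bar>) \<longlonglongrightarrow> \<bar>w x\<bar>" by (rule tendsto_rabs)
    then show ?case by (rule LIMSEQ_le_const2) (use g_bound in auto)
  qed
  with wm have "AE x in lborel. w x = 0"
  proof (rule AE_zero_of_Lipschitz_tests)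
    fix \<phi> :: "'a \<Rightarrow> real" and L' R
    assume \<phi>: "L'-lipschitz_on UNIV \<phi>" and \<phi>01: "\<And>x. 0 \<le> \<phi> x \<and> \<phi> x \<le> 1"
      and \<phi>0: "\<And>x. R < norm x \<Longrightarrow> \<phi> x = 0"
    have \<phi>c: "continuous_on UNIV \<phi>" using \<phi> lipschitz_on_continuous_on by blast
    have L': "0 \<le> L'" using \<phi> lipschitz_on_nonneg by blast
    have \<phi>m: "(\<lambda>x. \<phi> (x + c)) \<in> borel_measurable borel" for c
      by (intro borel_measurable_continuous_onI continuous_on_compose2[OF \<phi>c] continuous_intros) auto
    have \<phi>m0: "\<phi> \<in> borel_measurable borel" using \<phi>m[of 0] by simp
    have ind: "\<phi> x \<le> indicator (cball 0 R) x" for x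
      using \<phi>0[of x] \<phi>01[of x] by (auto simp: indicator_def)
    \<comment> \<open>Shifts by \<open>s n *\<^sub>R u\<close> have length at most
      \<open>norm u\<close>, so this radius contains the supports of all the shifted test
      functions.\<close>
    define R' where "R' = R + norm u"
    have ind': "\<phi> (x + (- s n) *\<^sub>R u) \<le> indicator (cball 0 R') x" for x n
    proof -
      have "norm (s n *\<^sub>R u) \<le> norm u" by (simp add: s_def divide_simps mult_le_cancel_left1)
      then have "norm x \<le> norm (x - s n *\<^sub>R u) + norm u"
        using norm_triangle_ineq[of "x - s n *\<^sub>R u" "s n *\<^sub>R u"] by simp
      then show ?thesis using \<phi>0[of "x - s n *\<^sub>R u"] \<phi>01[of "x - s n *\<^sub>R u"]
        by (auto simp: indicator_def R'_def)
    qed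
    have fin: "emeasure lborel (cball (0::'a) r) < \<infinity>" for r
      by (intro emeasure_bounded_finite) auto
    have fin_int: "integrable lborel (\<lambda>x::'a. c * indicator (cball 0 r) x)" for c r :: real
      using fin by (intro integrable_mult_right integrable_real_indicator) auto
    have conv: "(\<lambda>n. \<integral>x. g n x * \<phi> x \<partial>lborel) \<longlonglongrightarrow> (\<integral>x. w x * \<phi> x \<partial>lborel)"
    proof (rule integral_dominated_convergence[where w="\<lambda>x. 2 * L * norm v * indicator (cball 0 R) x"])
      show "AE x in lborel. (\<lambda>n. g n x * \<phi> x) \<longlonglongrightarrow> w x * \<phi> x"
        using lim by eventually_elim (intro tendsto_intros)
      show "AE x in lborel. norm (g n x * \<phi> x) \<le> 2 * L * norm v * indicator (cball 0 R) x" for n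
      proof (intro AE_I2)
        fix x
        have "\<bar>g n x\<bar> * \<phi> x \<le> 2 * L * norm v * indicator (cball 0 R) x"
          using g_bound ind \<phi>01 L by (intro mult_mono) auto
        then show "norm (g n x * \<phi> x) \<le> 2 * L * norm v * indicator (cball 0 R) x"
          using \<phi>01[of x] by (simp add: abs_mult)
      qed
    qed (use wm gm \<phi>m0 fin_int in auto)
    define K where "K = L * norm v * (L' * norm u)"
    have small: "\<bar>\<integral>x. g n x * \<phi> x \<partial>lborel\<bar> \<le> s n * (K * measure lborel (cball (0::'a) R') + K * measure lborel (cball (0::'a) R))" for n
    proof -
      \<comment> \<open>With this first-order quotient,
        \<open>g n x = d (x + s n *\<^sub>R u) - d x\<close>. Translating the first term back leaves
        \<open>d\<close>, bounded by \<open>L * norm v\<close>, against a difference of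
        \<open>\<phi>\<close> of size at most \<open>s n * (L' * norm u)\<close>. The product of the
        two bounds is \<open>s n * K\<close>.\<close>
      define d where "d x = real (Suc n) * (f (x + s n *\<^sub>R v) - f x)" for x
      have dm: "(\<lambda>x. d (x + c)) \<in> borel_measurable borel" for c
        unfolding d_def using fm[of "c + s n *\<^sub>R v"] fm[of c]
        by (intro borel_measurable_times borel_measurable_diff) (auto simp: add.assoc)
      have dm0: "d \<in> borel_measurable borel" using dm[of 0] by simp
      have d_bound: "\<bar>d x\<bar> \<le> L * norm v" for x
      proof -
        have "\<bar>d x\<bar> \<le> real (Suc n) * (L * (\<bar>s n\<bar> * norm v))"
          unfolding d_def abs_mult using fd[of x "s n"] by (intro mult_mono) auto
        also have "\<dots> = L * norm v * (real (Suc n) * s n)" using s(1)[of n] by (simp add: algebra_simps)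
        finally show ?thesis unfolding s(2) by simp
      qed
      have i1: "integrable lborel (\<lambda>x. d (x + s n *\<^sub>R u) * \<phi> x)"
        and i3: "integrable lborel (\<lambda>x. d x * \<phi> x)"
      proof -
        have b: "\<bar>d y * \<phi> x\<bar> \<le> (L * norm v) * indicator (cball 0 R) x" for x y
          unfolding abs_mult using d_bound ind \<phi>01 L by (intro mult_mono) auto
        show "integrable lborel (\<lambda>x. d (x + s n *\<^sub>R u) * \<phi> x)"
          by (rule integrable_if_bounded_support[OF borel_measurable_times[OF dm \<phi>m0] b])
        show "integrable lborel (\<lambda>x. d x * \<phi> x)"
          by (rule integrable_if_bounded_support[OF borel_measurable_times[OF dm0 \<phi>m0] b])
      qed
      have i2: "integrable lborel (\<lambda>x. d x * \<phi> (x + (- s n) *\<^sub>R u))"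
      proof (rule integrable_if_bounded_support)
        show "(\<lambda>x. d x * \<phi> (x + (- s n) *\<^sub>R u)) \<in> borel_measurable borel"
          using dm0 \<phi>m by (intro borel_measurable_times)
        show "\<bar>d x * \<phi> (x + (- s n) *\<^sub>R u)\<bar> \<le> L * norm v * indicator (cball 0 R') x" for x
          unfolding abs_mult using d_bound ind'[of x n] \<phi>01 L by (intro mult_mono) auto
      qed
      have "(\<integral>x. g n x * \<phi> x \<partial>lborel) = (\<integral>x. d (x + s n *\<^sub>R u) * \<phi> x - d x * \<phi> x \<partial>lborel)"
        by (intro Bochner_Integration.integral_cong) (auto simp: g_def d_def left_diff_distrib right_diff_distrib)
      also have "\<dots> = (\<integral>x. d (x + s n *\<^sub>R u) * \<phi> x \<partial>lborel) - (\<integral>x. d x * \<phi> x \<partial>lborel)"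
        using i1 i3 by simp
      also have "(\<integral>x. d (x + s n *\<^sub>R u) * \<phi> x \<partial>lborel) = (\<integral>x. d x * \<phi> (x + (- s n) *\<^sub>R u) \<partial>lborel)"
        using dm0 \<phi>m[of "- s n *\<^sub>R u"]
          integral_lborel_translate[of "\<lambda>x. d x * \<phi> (x + (- s n) *\<^sub>R u)" "s n *\<^sub>R u"]
        by simp
      also have "\<dots> - (\<integral>x. d x * \<phi> x \<partial>lborel) = (\<integral>x. d x * \<phi> (x + (- s n) *\<^sub>R u) - d x * \<phi> x \<partial>lborel)"
        using i2 i3 by simp
      finally have eq: "(\<integral>x. g n x * \<phi> x \<partial>lborel) = (\<integral>x. d x * \<phi> (x + (- s n) *\<^sub>R u) - d x * \<phi> x \<partial>lborel)" .
      have "\<bar>\<integral>x. g n x * \<phi> x \<partial>lborel\<bar> \<le> (\<integral>x. s n * K * indicator (cball 0 R') x + s n * K * indicator (cball 0 R) x \<partial>(lborel :: 'a measure))"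
        unfolding eq
      proof (rule order_trans[OF integral_abs_bound integral_mono])
        show "integrable lborel (\<lambda>x. \<bar>d x * \<phi> (x + (- s n) *\<^sub>R u) - d x * \<phi> x\<bar>)"
          using i2 i3 by (intro integrable_abs Bochner_Integration.integrable_diff)
        show "integrable lborel (\<lambda>x::'a. s n * K * indicator (cball 0 R') x + s n * K * indicator (cball 0 R) x)"
          using fin_int by (intro Bochner_Integration.integrable_add)
        fix x
        have K0: "0 \<le> s n * K" using s(1)[of n] L L' by (simp add: K_def)
        have "\<bar>d x * \<phi> (x + (- s n) *\<^sub>R u) - d x * \<phi> x\<bar> = \<bar>d x\<bar> * \<bar>\<phi> (x + (- s n) *\<^sub>R u) - \<phi> x\<bar>"
          by (simp add: abs_mult flip: right_diff_distrib)
        also have "\<dots> \<le> (L * norm v) * (L' * (s n * norm u))"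
          using lipschitz_onD[OF \<phi>, of "x + (- s n) *\<^sub>R u" x] d_bound s(1)[of n] L
          by (intro mult_mono) (auto simp: dist_norm)
        also have "\<dots> = s n * K" by (simp add: K_def)
        finally have b: "\<bar>d x * \<phi> (x + (- s n) *\<^sub>R u) - d x * \<phi> x\<bar> \<le> s n * K" .
        show "\<bar>d x * \<phi> (x + (- s n) *\<^sub>R u) - d x * \<phi> x\<bar> \<le> s n * K * indicator (cball 0 R') x + s n * K * indicator (cball 0 R) x"
        proof (cases "x \<in> cball 0 R' \<or> x \<in> cball 0 R")
          case True
          then show ?thesis using b K0 by (auto simp: indicator_def mult.commute[of K "s n"])
        next
          case False
          then have "\<phi> (x + (- s n) *\<^sub>R u) = 0" "\<phi> x = 0"
            using ind[of x] ind'[of x n] \<phi>01[of x] \<phi>01[of "x + (- s n) *\<^sub>R u"] by (auto simp: indicator_def)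
          then show ?thesis using K0 by simp
        qed
      qed
      also have "\<dots> = s n * (K * measure lborel (cball (0::'a) R') + K * measure lborel (cball (0::'a) R))"
        using fin_int[of "s n * K" R] fin_int[of "s n * K" R'] fin by (simp add: algebra_simps)
      finally show ?thesis .
    qed
    have "(\<lambda>n. \<integral>x. g n x * \<phi> x \<partial>lborel) \<longlonglongrightarrow> 0"
    proof (rule Lim_null_comparison)
      show "\<forall>\<^sub>F n in sequentially. norm (\<integral>x. g n x * \<phi> x \<partial>lborel) \<le>
          s n * (K * measure lborel (cball (0::'a) R') + K * measure lborel (cball (0::'a) R))"
        using small by simp
      have "s \<longlonglongrightarrow> 0" unfolding s_def using LIMSEQ_inverse_real_of_nat by (simp add: inverse_eq_divide)
      then show "(\<lambda>n. s n * (K * measure lborel (cball (0::'a) R') + K * measure lborel (cball (0::'a) R))) \<longlonglongrightarrow> 0"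
        by (rule tendsto_mult_left_zero)
    qed
    then show "(\<integral>x. w x * \<phi> x \<partial>lborel) = 0" using conv LIMSEQ_unique by blast
  qed
  then show ?thesis by eventually_elim (simp add: w_def)
qed

lemma AE_dirderiv_scale:
  fixes f :: "'a::euclidean_space \<Rightarrow> real"
  assumes f: "L-lipschitz_on UNIV f"
  shows "AE x in lborel. dirderiv f (c *\<^sub>R v) x = c * dirderiv f v x"
  using AE_has_dirderiv[OF f, of v]
proof eventually_elim
  case (elim x)
  have "((\<lambda>t. c * t) has_real_derivative c) (at 0)"
    by (auto intro!: derivative_eq_intros)
  then have "((\<lambda>t. f (x + (c * t) *\<^sub>R v)) has_real_derivative dirderiv f v x * c) (at 0)"
    using DERIV_chain2[of "\<lambda>t. f (x + t *\<^sub>R v)" "dirderiv f v x" "\<lambda>t. c * t" 0 c UNIV] elim by simp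
  then have "((\<lambda>t. f (x + t *\<^sub>R (c *\<^sub>R v))) has_real_derivative c * dirderiv f v x) (at 0)"
    by (simp add: mult.commute)
  then show ?case by (rule dirderiv_eq)
qed

lemma AE_dirderiv_basis:
  fixes f :: "'a::euclidean_space \<Rightarrow> real"
  assumes f: "L-lipschitz_on UNIV f"
  shows "AE x in lborel. dirderiv f v x = (\<Sum>i\<in>Basis. (v \<bullet> i) * dirderiv f i x)"
proof -
  have "AE x in lborel. dirderiv f (\<Sum>i\<in>S. (v \<bullet> i) *\<^sub>R i) x = (\<Sum>i\<in>S. (v \<bullet> i) * dirderiv f i x)"
    if "finite S" for S :: "'a set"
    using that
  proof (induction S rule: finite_induct)
    case empty
    have "dirderiv f 0 x = 0" for x by (rule dirderiv_eq) auto
    then show ?case by simp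
  next
    case (insert j S)
    show ?case
      using insert.IH AE_dirderiv_scale[OF f, of "v \<bullet> j" j]
        AE_dirderiv_add[OF f, of "(v \<bullet> j) *\<^sub>R j" "\<Sum>i\<in>S. (v \<bullet> i) *\<^sub>R i"]
      by eventually_elim (use insert in simp)
  qed
  from this[of Basis] show ?thesis by (simp add: euclidean_representation)
qed

text \<open>Finitely many directions from \<open>D\<close> form a net of the unit sphere, so
  convergence along them is uniform. The Lipschitz bound on \<open>f\<close> and the boundedness of
  \<open>T\<close> carry the estimate from the net to every direction.\<close>

lemma has_derivative_of_dense_directions:
  fixes f :: "'a::euclidean_space \<Rightarrow> real"
  assumes f: "L-lipschitz_on UNIV f" and T: "bounded_linear T"
    and D: "\<And>U. open U \<Longrightarrow> U \<noteq> {} \<Longrightarrow> \<exists>q\<in>D. q \<in> U"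
    and dir: "\<And>q. q \<in> D \<Longrightarrow> ((\<lambda>t. f (x + t *\<^sub>R q)) has_real_derivative T q) (at 0)"
  shows "(f has_derivative T) (at x)"
proof -
  interpret T: bounded_linear T by fact
  obtain B where B: "0 < B" "\<And>v. norm (T v) \<le> norm v * B" using T.pos_bounded by blast
  have L: "0 \<le> L" using f lipschitz_on_nonneg by blast
  have "\<exists>d>0. \<forall>y. norm (y - x) < d \<longrightarrow> norm (f y - f x - T (y - x)) \<le> e * norm (y - x)" if "e > 0" for e
  proof -
    \<comment> \<open>Replacing a unit direction by a net point costs \<open>L * \<eta>\<close> for
      \<open>f\<close> and \<open>B * \<eta>\<close> for \<open>T\<close>, together
      \<open>e / 2\<close>; the other half is left for the quotients along the net.\<close>
    define \<eta> where "\<eta> = e / (2 * (L + B))"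
    have "0 < L + B" using L B by simp
    then have \<eta>: "0 < \<eta>" "(L + B) * \<eta> = e / 2" using that by (auto simp: \<eta>_def simp del: distrib_left_numeral)
    have "sphere (0::'a) 1 \<subseteq> (\<Union>q\<in>D. ball q \<eta>)"
    proof
      fix y :: 'a
      obtain q where "q \<in> D" "q \<in> ball y \<eta>" using D[of "ball y \<eta>"] \<eta> by auto
      then show "y \<in> (\<Union>q\<in>D. ball q \<eta>)" by (auto simp: dist_commute)
    qed
    then obtain F where F: "F \<subseteq> D" "finite F" "sphere 0 1 \<subseteq> (\<Union>q\<in>F. ball q \<eta>)"
      using compactE_image[OF compact_sphere[of "0::'a" 1], of D "\<lambda>q. ball q \<eta>"] by auto
    have "\<forall>\<^sub>F t in at_right 0. \<bar>f (x + t *\<^sub>R q) - f x - t * T q\<bar> \<le> e / 2 * t" if "q \<in> F" for q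
    proof -
      have "((\<lambda>t. (f (x + t *\<^sub>R q) - f x) / t) \<longlongrightarrow> T q) (at_right 0)"
        using dir[of q] F that by (auto simp: DERIV_def intro: filterlim_at_split[THEN iffD1, THEN conjunct2])
      then have "\<forall>\<^sub>F t in at_right 0. dist ((f (x + t *\<^sub>R q) - f x) / t) (T q) < e / 2"
        using \<open>e > 0\<close> by (intro tendstoD) auto
      then show ?thesis
        using eventually_at_right_less[of 0]
      proof eventually_elim
        case (elim t)
        have "\<bar>f (x + t *\<^sub>R q) - f x - t * T q\<bar> = t * dist ((f (x + t *\<^sub>R q) - f x) / t) (T q)"
        proof -
          have "t * dist ((f (x + t *\<^sub>R q) - f x) / t) (T q) = \<bar>t * ((f (x + t *\<^sub>R q) - f x) / t - T q)\<bar>"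
            using elim(2) unfolding dist_real_def abs_mult by simp
          also have "t * (a / t - b) = a - t * b" for a b
            using elim(2) by (simp add: field_simps)
          finally show ?thesis by simp
        qed
        also have "\<dots> \<le> t * (e / 2)" using elim by (intro mult_left_mono) auto
        finally show ?case by (simp add: mult.commute)
      qed
    qed
    then have "\<forall>\<^sub>F t in at_right 0. \<forall>q\<in>F. \<bar>f (x + t *\<^sub>R q) - f x - t * T q\<bar> \<le> e / 2 * t"
      using F(2) by (simp add: eventually_ball_finite_distrib)
    then obtain d where d: "d > 0" "\<And>t q. 0 < t \<Longrightarrow> t < d \<Longrightarrow> q \<in> F \<Longrightarrow> \<bar>f (x + t *\<^sub>R q) - f x - t * T q\<bar> \<le> e / 2 * t"
      by (auto simp: eventually_at_right_field)
    show ?thesis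
    proof (intro exI conjI allI impI)
      fix y assume y: "norm (y - x) < d"
      show "norm (f y - f x - T (y - x)) \<le> e * norm (y - x)"
      proof (cases "y = x")
        case True
        then show ?thesis by (simp add: T.zero)
      next
        case False
        define t where "t = norm (y - x)"
        define \<omega> where "\<omega> = (1 / t) *\<^sub>R (y - x)"
        have t: "0 < t" "t < d" using False y by (auto simp: t_def)
        have "norm \<omega> = 1" unfolding \<omega>_def t_def using False by simp
        then obtain q where q: "q \<in> F" "dist q \<omega> < \<eta>" using F(3) by (auto simp: subset_iff)
        have yx: "y = x + t *\<^sub>R \<omega>" using t by (simp add: \<omega>_def)
        have \<omega>q: "norm (\<omega> - q) \<le> \<eta>" using q(2) by (simp add: dist_norm norm_minus_commute)
        have "\<bar>f (x + t *\<^sub>R \<omega>) - f (x + t *\<^sub>R q)\<bar> \<le> L * norm (t *\<^sub>R (\<omega> - q))"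
          using lipschitz_onD[OF f, of "x + t *\<^sub>R \<omega>" "x + t *\<^sub>R q"] by (simp add: dist_norm algebra_simps)
        also have "\<dots> \<le> L * (t * \<eta>)" using t L \<omega>q by (intro mult_left_mono) (auto intro!: mult_left_mono)
        finally have 1: "\<bar>f (x + t *\<^sub>R \<omega>) - f (x + t *\<^sub>R q)\<bar> \<le> L * (t * \<eta>)" .
        have "\<bar>T (\<omega> - q)\<bar> \<le> \<eta> * B" using B(2)[of "\<omega> - q"] \<omega>q B(1)
          by (auto intro: order_trans mult_right_mono)
        then have "t * \<bar>T (\<omega> - q)\<bar> \<le> t * (\<eta> * B)" using t by (intro mult_left_mono) auto
        then have 2: "\<bar>t * T q - t * T \<omega>\<bar> \<le> t * (\<eta> * B)"
          using t by (simp add: T.diff abs_mult abs_minus_commute flip: right_diff_distrib)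
        have 3: "\<bar>f (x + t *\<^sub>R q) - f x - t * T q\<bar> \<le> e / 2 * t" using d(2) t q by blast
        have "\<bar>f (x + t *\<^sub>R \<omega>) - f x - t * T \<omega>\<bar> \<le> L * (t * \<eta>) + t * (\<eta> * B) + e / 2 * t"
          using 1 2 3 by linarith
        also have "\<dots> = ((L + B) * \<eta>) * t + e / 2 * t" by (simp add: algebra_simps)
        also have "\<dots> = e * t" by (simp add: \<eta>)
        finally have "\<bar>f (x + t *\<^sub>R \<omega>) - f x - T (t *\<^sub>R \<omega>)\<bar> \<le> e * t" by (simp add: T.scaleR)
        then show ?thesis using t by (simp add: yx abs_of_pos \<open>norm \<omega> = 1\<close>)
      qed
    qed (use d in auto)
  qed
  then show ?thesis using T by (simp add: has_derivative_at_alt)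
qed

text \<open>Countability of the dense set \<open>D\<close> is decisive: a single null set then
  serves for the existence of all derivatives along \<open>D\<close> and for their being the values
  of one linear map, built from the partial derivatives.\<close>

theorem Rademacher:
  fixes f :: "'a::euclidean_space \<Rightarrow> real"
  assumes f: "L-lipschitz_on UNIV f"
  shows "AE x in lborel. f differentiable (at x)"
proof -
  obtain D :: "'a set" where D: "countable D" "\<And>U. open U \<Longrightarrow> U \<noteq> {} \<Longrightarrow> \<exists>q\<in>D. q \<in> U"
    using countable_dense_setE by blast
  have "AE x in lborel. \<forall>q\<in>D. ((\<lambda>t. f (x + t *\<^sub>R q)) has_real_derivative dirderiv f q x) (at 0)"
    using D(1) AE_has_dirderiv[OF f] by (simp add: AE_ball_countable)
  moreover have "AE x in lborel. \<forall>q\<in>D. dirderiv f q x = (\<Sum>i\<in>Basis. (q \<bullet> i) * dirderiv f i x)"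
    using D(1) AE_dirderiv_basis[OF f] by (simp add: AE_ball_countable)
  ultimately show ?thesis
  proof eventually_elim
    case (elim x)
    have "bounded_linear (\<lambda>v. \<Sum>i\<in>Basis. (v \<bullet> i) * dirderiv f i x)"
      by (intro bounded_linear_sum bounded_linear_mult_left[THEN bounded_linear_compose] bounded_linear_inner_left)
    then have "(f has_derivative (\<lambda>v. \<Sum>i\<in>Basis. (v \<bullet> i) * dirderiv f i x)) (at x)"
      using elim by (intro has_derivative_of_dense_directions[OF f _ D(2)]) auto
    then show ?case by (auto simp: differentiable_def)
  qed
qed

section \<open>The divergence below a Lipschitz graph\<close>

lemma abs_directional_derivative_le:
  fixes f :: "'a::euclidean_space \<Rightarrow> real"
  assumes f: "L-lipschitz_on UNIV f"
    and D: "((\<lambda>t. f (x + t *\<^sub>R v)) has_real_derivative D) (at 0)"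
  shows "\<bar>D\<bar> \<le> L * norm v"
proof (rule LIMSEQ_le_const2[OF tendsto_rabs[OF directional_quotient_tendsto[OF D]]], intro exI allI impI)
  fix n
  have "\<bar>f (x + (1 / real (Suc n)) *\<^sub>R v) - f x\<bar> \<le> L * (1 / real (Suc n) * norm v)"
    using lipschitz_onD[OF f, of "x + (1 / real (Suc n)) *\<^sub>R v" x] by (simp add: dist_norm)
  then have "real (Suc n) * \<bar>f (x + (1 / real (Suc n)) *\<^sub>R v) - f x\<bar> \<le> real (Suc n) * (L * (1 / real (Suc n) * norm v))"
    by (rule mult_left_mono) simp
  then show "\<bar>real (Suc n) * (f (x + (1 / real (Suc n)) *\<^sub>R v) - f x)\<bar> \<le> L * norm v"
    by (simp add: abs_mult)
qed

lemma has_real_derivative_on_line: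
  fixes f :: "'a::euclidean_space \<Rightarrow> real"
  assumes "(f has_derivative T) (at x)"
  shows "((\<lambda>t. f (x + t *\<^sub>R v)) has_real_derivative T v) (at 0)"
proof -
  have "((\<lambda>t. f (x + t *\<^sub>R v)) has_derivative (\<lambda>t. T (t *\<^sub>R v))) (at 0)"
    by (rule has_derivative_compose[of "\<lambda>t. x + t *\<^sub>R v" "\<lambda>t. t *\<^sub>R v"]) (use assms in \<open>auto intro!: derivative_eq_intros\<close>)
  then show ?thesis
    using bounded_linear.linear[OF has_derivative_bounded_linear[OF assms]]
    by (simp add: has_field_derivative_def linear_cmul mult_commute_abs)
qed

text \<open>The identity is exact for difference quotients: translation invariance turns the
  quotient of \<open>f\<close> along \<open>v\<close> into that of \<open>\<phi>\<close> along
  \<open>- v\<close>. Lipschitz bounds and the compact support of \<open>\<phi>\<close> dominate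
  both sides in the limit.\<close>

lemma integral_dirderiv_by_parts:
  fixes f \<phi> :: "'a::euclidean_space \<Rightarrow> real"
  assumes f: "L-lipschitz_on UNIV f" and \<phi>: "L'-lipschitz_on UNIV \<phi>"
    and supp: "\<And>x. R < norm x \<Longrightarrow> \<phi> x = 0"
  shows "integrable lborel (\<lambda>x. f x * dirderiv \<phi> v x)" "integrable lborel (\<lambda>x. dirderiv f v x * \<phi> x)"
    "(\<integral>x. f x * dirderiv \<phi> v x \<partial>lborel) = - (\<integral>x. dirderiv f v x * \<phi> x \<partial>lborel)"
proof -
  have fc: "continuous_on UNIV f" and \<phi>c: "continuous_on UNIV \<phi>"
    using f \<phi> lipschitz_on_continuous_on by blast+
  have L: "0 \<le> L" "0 \<le> L'" using f \<phi> lipschitz_on_nonneg by blast+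
  have m: "(\<lambda>x. k (x + c)) \<in> borel_measurable borel" if "continuous_on UNIV k" for k :: "'a \<Rightarrow> real" and c
    by (intro borel_measurable_continuous_onI continuous_on_compose2[OF that] continuous_intros) auto
  have m0: "f \<in> borel_measurable borel" "\<phi> \<in> borel_measurable borel"
    using m[OF fc, of 0] m[OF \<phi>c, of 0] by simp_all
  define R' where "R' = R + norm v"
  have "compact (f ` cball 0 R')" "compact (\<phi> ` cball 0 R')"
    by (intro compact_continuous_image continuous_on_subset[OF fc] continuous_on_subset[OF \<phi>c]; simp)+
  then obtain M M' where "\<And>x. x \<in> cball 0 R' \<Longrightarrow> \<bar>f x\<bar> \<le> M" "\<And>x. x \<in> cball 0 R' \<Longrightarrow> \<bar>\<phi> x\<bar> \<le> M'"
    by (fastforce dest!: compact_imp_bounded simp: bounded_iff)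
  then have M: "\<bar>f x\<bar> \<le> max M 0" "\<bar>\<phi> x\<bar> \<le> max M' 0" if "x \<in> cball 0 R'" for x
    using that by (meson max.coboundedI1)+
  have M0: "0 \<le> max M 0" "0 \<le> max M' 0" by auto
  define s where "s n = 1 / real (Suc n)" for n
  have s: "0 < s n" "s n \<le> 1" "real (Suc n) * s n = 1" for n by (auto simp: s_def)
  define q where "q k w n x = real (Suc n) * (k (x + s n *\<^sub>R w) - k x)" for k :: "'a \<Rightarrow> real" and w n x
  have qb: "\<bar>q k w n x\<bar> \<le> K * norm w" if "K-lipschitz_on UNIV k" for K k w n x
  proof -
    have "\<bar>k (x + s n *\<^sub>R w) - k x\<bar> \<le> K * (s n * norm w)"
      using lipschitz_onD[OF that, of "x + s n *\<^sub>R w" x] s(1)[of n] by (simp add: dist_norm)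
    then have "real (Suc n) * \<bar>k (x + s n *\<^sub>R w) - k x\<bar> \<le> real (Suc n) * (K * (s n * norm w))"
      by (rule mult_left_mono) simp
    also have "\<dots> = K * norm w * (real (Suc n) * s n)" by (simp only: ac_simps)
    finally show ?thesis unfolding s(3) by (simp add: q_def abs_mult)
  qed
  have qm: "q k w n \<in> borel_measurable borel" if "continuous_on UNIV k" for k w n
    unfolding q_def using m[OF that, of "s n *\<^sub>R w"] m[OF that, of 0]
    by (intro borel_measurable_times borel_measurable_diff) auto
  have \<phi>0: "\<phi> x = 0" "\<phi> (x + s n *\<^sub>R (- v)) = 0" "q \<phi> (- v) n x = 0" if "x \<notin> cball 0 R'" for x n
  proof -
    have "R < norm x" using that norm_ge_zero[of v] unfolding R'_def mem_cball_0 by linarith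
    then show 1: "\<phi> x = 0" by (rule supp)
    have "s n * norm v \<le> norm v" using s[of n] by (intro mult_left_le_one_le) auto
    then have "norm x \<le> norm (x + s n *\<^sub>R (- v)) + norm v"
      using norm_triangle_ineq[of "x + s n *\<^sub>R (- v)" "s n *\<^sub>R v"] s(1)[of n] by simp
    then have "R < norm (x + s n *\<^sub>R (- v))" using that by (simp add: R'_def)
    then show 2: "\<phi> (x + s n *\<^sub>R (- v)) = 0" by (rule supp)
    show "q \<phi> (- v) n x = 0" using 1 2 by (simp add: q_def)
  qed
  have fin: "integrable lborel (\<lambda>x::'a. c * indicator (cball 0 R') x)" for c :: real
    using emeasure_bounded_finite[of "cball (0::'a) R'"]
    by (intro integrable_mult_right integrable_real_indicator) auto
  have b1: "\<bar>q f v n x * \<phi> x\<bar> \<le> (L * norm v * max M' 0) * indicator (cball 0 R') x" for n x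
  proof (cases "x \<in> cball 0 R'")
    case True
    then show ?thesis
      unfolding abs_mult using qb[OF f, of v n x] M(2)[of x] L by (simp add: mult_mono)
  qed (simp add: \<phi>0)
  have b2: "\<bar>f x * q \<phi> (- v) n x\<bar> \<le> (max M 0 * (L' * norm v)) * indicator (cball 0 R') x" for n x
  proof (cases "x \<in> cball 0 R'")
    case True
    then show ?thesis
      unfolding abs_mult using qb[OF \<phi>, of "- v" n x] M(1)[of x] L by (simp add: mult_mono)
  qed (simp add: \<phi>0)
  have m1: "(\<lambda>x. dirderiv f v x * \<phi> x) \<in> borel_measurable lborel"
    using borel_measurable_dirderiv[OF fc, of v] m0 by simp
  have m2: "(\<lambda>x. - (f x * dirderiv \<phi> v x)) \<in> borel_measurable lborel"
    using borel_measurable_dirderiv[OF \<phi>c, of v] m0 by simp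
  have m3: "(\<lambda>x. q f v n x * \<phi> x) \<in> borel_measurable lborel" for n
    using qm[OF fc, of v n] m0 by simp
  have m4: "(\<lambda>x. f x * q \<phi> (- v) n x) \<in> borel_measurable lborel" for n
    using qm[OF \<phi>c, of "- v" n] m0 by simp
  have l1: "AE x in lborel. (\<lambda>n. q f v n x * \<phi> x) \<longlonglongrightarrow> dirderiv f v x * \<phi> x"
    using AE_has_dirderiv[OF f, of v]
    by eventually_elim (unfold q_def s_def, intro tendsto_mult tendsto_const directional_quotient_tendsto)
  have l2: "AE x in lborel. (\<lambda>n. f x * q \<phi> (- v) n x) \<longlonglongrightarrow> - (f x * dirderiv \<phi> v x)"
    using AE_has_dirderiv[OF \<phi>, of "- v"] AE_dirderiv_scale[OF \<phi>, of "- 1" v]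
  proof eventually_elim
    case (elim x)
    have "(\<lambda>n. f x * q \<phi> (- v) n x) \<longlonglongrightarrow> f x * dirderiv \<phi> (- v) x"
      unfolding q_def s_def by (intro tendsto_mult tendsto_const directional_quotient_tendsto elim(1))
    then show ?case using elim(2) by simp
  qed
  note bb1 = AE_I2[of lborel, OF b1[folded real_norm_def]] and bb2 = AE_I2[of lborel, OF b2[folded real_norm_def]]
  have c1: "(\<lambda>n. \<integral>x. q f v n x * \<phi> x \<partial>lborel) \<longlonglongrightarrow> (\<integral>x. dirderiv f v x * \<phi> x \<partial>lborel)"
    by (rule integral_dominated_convergence[OF m1 m3 fin l1 bb1])
  have c2: "(\<lambda>n. \<integral>x. f x * q \<phi> (- v) n x \<partial>lborel) \<longlonglongrightarrow> (\<integral>x. - (f x * dirderiv \<phi> v x) \<partial>lborel)"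
    by (rule integral_dominated_convergence[OF m2 m4 fin l2 bb2])
  show "integrable lborel (\<lambda>x. dirderiv f v x * \<phi> x)"
    by (rule integrable_dominated_convergence[OF m1 m3 fin l1 bb1])
  have "integrable lborel (\<lambda>x. - (f x * dirderiv \<phi> v x))"
    by (rule integrable_dominated_convergence[OF m2 m4 fin l2 bb2])
  then show "integrable lborel (\<lambda>x. f x * dirderiv \<phi> v x)" by simp
  have "(\<integral>x. q f v n x * \<phi> x \<partial>lborel) = (\<integral>x. f x * q \<phi> (- v) n x \<partial>lborel)" for n
  proof -
    have \<phi>b: "\<bar>\<phi> x\<bar> \<le> max M' 0" for x
      using M(2)[of x] \<phi>0(1)[of x] by (cases "x \<in> cball 0 R'") auto
    have i1: "integrable lborel (\<lambda>x. f x * \<phi> x)"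
    proof (rule integrable_if_bounded_support)
      show "(\<lambda>x. f x * \<phi> x) \<in> borel_measurable borel" using m0 by (rule borel_measurable_times)
      show "\<bar>f x * \<phi> x\<bar> \<le> (max M 0 * max M' 0) * indicator (cball 0 R') x" for x
        using M[of x] M0 \<phi>0(1)[of x] by (cases "x \<in> cball 0 R'") (auto simp: abs_mult intro!: mult_mono)
    qed
    have i2: "integrable lborel (\<lambda>x. f x * \<phi> (x + s n *\<^sub>R (- v)))"
    proof (rule integrable_if_bounded_support)
      show "(\<lambda>x. f x * \<phi> (x + s n *\<^sub>R (- v))) \<in> borel_measurable borel"
        using m0(1) m[OF \<phi>c] by (rule borel_measurable_times)
      show "\<bar>f x * \<phi> (x + s n *\<^sub>R (- v))\<bar> \<le> (max M 0 * max M' 0) * indicator (cball 0 R') x" for x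
      proof (cases "x \<in> cball 0 R'")
        case True
        then show ?thesis
          unfolding abs_mult using M(1)[of x] M0 \<phi>b[of "x + s n *\<^sub>R (- v)"] by (simp add: mult_mono)
      qed (use \<phi>0 in simp)
    qed
    \<comment> \<open>\<open>M\<close> bounds \<open>f\<close> only on \<open>cball 0 R'\<close>,
      and the shift may leave that ball. The product is therefore recovered from the globally
      bounded quotient and the unshifted product.\<close>
    have i3: "integrable lborel (\<lambda>x. f (x + s n *\<^sub>R v) * \<phi> x)"
    proof -
      have "integrable lborel (\<lambda>x. q f v n x * \<phi> x)"
        by (rule integrable_if_bounded_support[OF _ b1]) (use m3 in simp)
      then have "integrable lborel (\<lambda>x. s n * (q f v n x * \<phi> x) + f x * \<phi> x)"
        using i1 by simp
      also have "(\<lambda>x. s n * (q f v n x * \<phi> x) + f x * \<phi> x) = (\<lambda>x. f (x + s n *\<^sub>R v) * \<phi> x)"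
      proof
        fix x
        have "s n * (q f v n x * \<phi> x) = (real (Suc n) * s n) * ((f (x + s n *\<^sub>R v) - f x) * \<phi> x)"
          unfolding q_def by (simp only: ac_simps)
        then show "s n * (q f v n x * \<phi> x) + f x * \<phi> x = f (x + s n *\<^sub>R v) * \<phi> x"
          unfolding s(3) by (simp add: algebra_simps)
      qed
      finally show ?thesis .
    qed
    have "(\<integral>x. q f v n x * \<phi> x \<partial>lborel) = (\<integral>x. real (Suc n) * (f (x + s n *\<^sub>R v) * \<phi> x - f x * \<phi> x) \<partial>lborel)"
      unfolding q_def left_diff_distrib mult.assoc ..
    also have "\<dots> = real (Suc n) * ((\<integral>x. f (x + s n *\<^sub>R v) * \<phi> x \<partial>lborel) - (\<integral>x. f x * \<phi> x \<partial>lborel))"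
      using i1 i3 by simp
    also have "(\<integral>x. f (x + s n *\<^sub>R v) * \<phi> x \<partial>lborel) = (\<integral>x. f x * \<phi> (x + s n *\<^sub>R (- v)) \<partial>lborel)"
      using borel_measurable_times[OF m0(1) m[OF \<phi>c, of "s n *\<^sub>R (- v)"]]
        integral_lborel_translate[of "\<lambda>x. f x * \<phi> (x + s n *\<^sub>R (- v))" "s n *\<^sub>R v"]
      by simp
    also have "real (Suc n) * ((\<integral>x. f x * \<phi> (x + s n *\<^sub>R (- v)) \<partial>lborel) - (\<integral>x. f x * \<phi> x \<partial>lborel)) =
        (\<integral>x. real (Suc n) * (f x * \<phi> (x + s n *\<^sub>R (- v)) - f x * \<phi> x) \<partial>lborel)"
      using i1 i2 by simp
    also have "\<dots> = (\<integral>x. f x * q \<phi> (- v) n x \<partial>lborel)"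
      unfolding q_def right_diff_distrib by (simp only: ac_simps)
    finally show ?thesis .
  qed
  then have "(\<integral>x. dirderiv f v x * \<phi> x \<partial>lborel) = (\<integral>x. - (f x * dirderiv \<phi> v x) \<partial>lborel)"
    using c1 c2 LIMSEQ_unique by simp
  then show "(\<integral>x. f x * dirderiv \<phi> v x \<partial>lborel) = - (\<integral>x. dirderiv f v x * \<phi> x \<partial>lborel)"
    by simp
qed

lemma dirderiv_of_has_derivative:
  fixes f :: "'a::euclidean_space \<Rightarrow> real"
  assumes "(f has_derivative T) (at x)"
  shows "dirderiv f v x = T v"
  by (intro dirderiv_eq has_real_derivative_on_line assms)

text \<open>Componentwise integration by parts. As \<open>f\<close> is only Lipschitz, its almost
  everywhere defined directional derivatives stand in for the gradient; this admits
  \<open>arctan (N h)\<close> as a multiplier.\<close>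

lemma integral_times_divergence:
  fixes f :: "'a::euclidean_space \<Rightarrow> real" and G :: "'a \<Rightarrow> 'a"
  assumes f: "L-lipschitz_on UNIV f" and G: "\<And>x. (G has_derivative G' x) (at x)"
    and lip: "B-lipschitz_on UNIV G" and supp: "\<And>x. R < norm x \<Longrightarrow> G x = 0"
  shows "integrable lborel (\<lambda>x. f x * (\<Sum>b\<in>Basis. G' x b \<bullet> b))"
    "(\<integral>x. f x * (\<Sum>b\<in>Basis. G' x b \<bullet> b) \<partial>lborel) = - (\<integral>x. (\<Sum>b\<in>Basis. dirderiv f b x * (G x \<bullet> b)) \<partial>lborel)"
proof -
  have comp: "B-lipschitz_on UNIV (\<lambda>x. G x \<bullet> b)" if "b \<in> Basis" for b
  proof (rule lipschitz_onI)
    fix x y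
    have "dist (G x \<bullet> b) (G y \<bullet> b) \<le> dist (G x) (G y)"
      using Basis_le_norm[OF that, of "G x - G y"] by (simp add: dist_norm inner_diff_left)
    also have "\<dots> \<le> B * dist x y" using lipschitz_onD[OF lip] by blast
    finally show "dist (G x \<bullet> b) (G y \<bullet> b) \<le> B * dist x y" .
  qed (use lipschitz_on_nonneg[OF lip] in auto)
  have dd: "dirderiv (\<lambda>x. G x \<bullet> b) b x = G' x b \<bullet> b" for x b
    by (rule dirderiv_of_has_derivative) (intro derivative_intros G)
  have supp': "R < norm x \<Longrightarrow> G x \<bullet> b = 0" for x b using supp by simp
  have parts: "integrable lborel (\<lambda>x. f x * (G' x b \<bullet> b))" "integrable lborel (\<lambda>x. dirderiv f b x * (G x \<bullet> b))"
    "(\<integral>x. f x * (G' x b \<bullet> b) \<partial>lborel) = - (\<integral>x. dirderiv f b x * (G x \<bullet> b) \<partial>lborel)" if "b \<in> Basis" for b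
    using integral_dirderiv_by_parts[OF f comp[OF that] supp', where v = b] unfolding dd by auto
  have eq: "f x * (\<Sum>b\<in>Basis. G' x b \<bullet> b) = (\<Sum>b\<in>Basis. f x * (G' x b \<bullet> b))" for x
    by (rule sum_distrib_left)
  show "integrable lborel (\<lambda>x. f x * (\<Sum>b\<in>Basis. G' x b \<bullet> b))"
    unfolding eq by (rule Bochner_Integration.integrable_sum) (rule parts(1))
  show "(\<integral>x. f x * (\<Sum>b\<in>Basis. G' x b \<bullet> b) \<partial>lborel) = - (\<integral>x. (\<Sum>b\<in>Basis. dirderiv f b x * (G x \<bullet> b)) \<partial>lborel)"
    unfolding eq using parts by (simp add: Bochner_Integration.integral_sum sum_negf)
qed

text \<open>Integration by parts against the constant 1.\<close>

lemma integral_divergence_compact_support: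
  fixes G :: "'a::euclidean_space \<Rightarrow> 'a"
  assumes G: "\<And>x. (G has_derivative G' x) (at x)"
    and lip: "B-lipschitz_on UNIV G" and supp: "\<And>x. R < norm x \<Longrightarrow> G x = 0"
  shows "integrable lborel (\<lambda>x. \<Sum>b\<in>Basis. G' x b \<bullet> b)"
    "(\<integral>x. (\<Sum>b\<in>Basis. G' x b \<bullet> b) \<partial>lborel) = 0"
proof -
  have f: "0-lipschitz_on UNIV (\<lambda>_::'a. 1::real)" by (rule lipschitz_onI) auto
  have "dirderiv (\<lambda>_::'a. 1::real) b x = 0" for b x
    by (rule dirderiv_of_has_derivative) simp
  then show "integrable lborel (\<lambda>x. \<Sum>b\<in>Basis. G' x b \<bullet> b)"
    "(\<integral>x. (\<Sum>b\<in>Basis. G' x b \<bullet> b) \<partial>lborel) = 0"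
    using integral_times_divergence[OF f G lip supp] by simp_all
qed

text \<open>Test the divergence against \<open>arctan (N h)\<close>, where \<open>h\<close> is the signed height above the graph.
  Since \<open>G\<close> is tangent to the graph where \<open>h\<close> is differentiable, \<open>Dh(G) = O(h)\<close>, so the boundary layer
  contributes \<open>N h / (1 + N\<^sup>2 h\<^sup>2)\<close>, which is bounded and tends to \<open>0\<close>.\<close>
lemma integral_divergence_below_graph:
  fixes G :: "'a::euclidean_space \<Rightarrow> 'a" and g :: "'a \<Rightarrow> real" and e :: 'a
  defines "h \<equiv> \<lambda>y. y \<bullet> e - g y"
  assumes g: "L-lipschitz_on UNIV g" and inv: "\<And>y. g y = g (y - (y \<bullet> e) *\<^sub>R e)" and e: "norm e = 1"
    and G: "\<And>x. (G has_derivative G' x) (at x)"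
    and lip: "B-lipschitz_on UNIV G" and supp: "\<And>x. R < norm x \<Longrightarrow> G x = 0"
    and tangent: "\<And>z T. h z = 0 \<Longrightarrow> (h has_derivative T) (at z) \<Longrightarrow> T (G z) = 0"
  shows "(\<integral>x. indicator {y. h y < 0} x * (\<Sum>b\<in>Basis. G' x b \<bullet> b) \<partial>lborel) = 0"
    "integrable lborel (\<lambda>x. indicator {y. h y < 0} x * (\<Sum>b\<in>Basis. G' x b \<bullet> b))"
proof -
  have L: "0 \<le> L" "0 \<le> B" using g lip lipschitz_on_nonneg by blast+
  have ee: "e \<bullet> e = 1" using e by (simp add: dot_square_norm)
  have ginv: "g (y + t *\<^sub>R e) = g y" for y t
    using inv[of "y + t *\<^sub>R e"] inv[of y] by (simp add: inner_add_left ee algebra_simps)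
  have hshift: "h (y + t *\<^sub>R e) = h y + t" for y t
    by (simp add: h_def ginv inner_add_left ee)
  have hlip: "(1 + L)-lipschitz_on UNIV h"
  proof (rule lipschitz_onI)
    fix x y :: 'a
    have "\<bar>x \<bullet> e - y \<bullet> e\<bar> \<le> dist x y"
      using Cauchy_Schwarz_ineq2[of "x - y" e] e by (simp add: dist_norm inner_diff_left)
    moreover have "\<bar>g x - g y\<bar> \<le> L * dist x y"
      using lipschitz_onD[OF g, of x y] by (simp add: dist_real_def)
    ultimately show "dist (h x) (h y) \<le> (1 + L) * dist x y"
      by (simp add: h_def dist_real_def distrib_right)
  qed (use L in auto)
  have hc: "continuous_on UNIV h" using hlip lipschitz_on_continuous_on by blast
  have hm: "h \<in> borel_measurable borel" using hc by (rule borel_measurable_continuous_onI)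
  have Gc: "continuous_on UNIV G" using lip lipschitz_on_continuous_on by blast
  have Gm: "G \<in> borel_measurable borel" using Gc by (rule borel_measurable_continuous_onI)
  \<comment> \<open>The derivative of \<open>h\<close> along \<open>G\<close>, expressed by
    \<open>dirderiv\<close> so that it is Borel on the whole space; where \<open>h\<close> is
    differentiable it is the true derivative applied to \<open>G x\<close>.\<close>
  define D where "D x = (\<Sum>b\<in>Basis. dirderiv h b x * (G x \<bullet> b))" for x
  have Dm: "D \<in> borel_measurable borel"
    unfolding D_def using borel_measurable_dirderiv[OF hc] Gm
    by (intro borel_measurable_sum borel_measurable_times borel_measurable_inner) auto
  have D_eq: "D x = T (G x)" if "(h has_derivative T) (at x)" for x T
  proof -
    interpret T: bounded_linear T using that by (rule has_derivative_bounded_linear)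
    have "D x = (\<Sum>b\<in>Basis. T ((G x \<bullet> b) *\<^sub>R b))"
      unfolding D_def by (intro sum.cong) (auto simp: dirderiv_of_has_derivative[OF that] T.scaleR)
    also have "\<dots> = T (G x)" unfolding T.sum[symmetric] euclidean_representation ..
    finally show ?thesis .
  qed
  have rad: "AE x in lborel. h differentiable (at x)" using hlip by (rule Rademacher)
  have Dbound: "AE x in lborel. \<bar>D x\<bar> \<le> (1 + L) * B * \<bar>h x\<bar>"
    using rad
  proof eventually_elim
    case (elim x)
    then obtain T where T: "(h has_derivative T) (at x)" by (auto simp: differentiable_def)
    interpret T: bounded_linear T using T by (rule has_derivative_bounded_linear)
    \<comment> \<open>The foot of \<open>x\<close> on the graph. Translation along \<open>e\<close>
      changes \<open>h\<close> only by a constant, so \<open>T\<close> is the derivative at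
      \<open>z\<close> too, and tangency gives \<open>T (G z) = 0\<close>. The distance from
      \<open>x\<close> to \<open>z\<close> is \<open>\<bar>h x\<bar>\<close>, which is where the
      factor in \<open>Dbound\<close> comes from.\<close>
    define z where "z = x + (- h x) *\<^sub>R e"
    have "((\<lambda>y. h (y + h x *\<^sub>R e) - h x) has_derivative T) (at z)"
    proof -
      have "((\<lambda>y. y + h x *\<^sub>R e) has_derivative (\<lambda>v. v)) (at z)"
        by (auto intro!: derivative_eq_intros)
      moreover have "(h has_derivative T) (at (z + h x *\<^sub>R e))" using T by (simp add: z_def)
      ultimately have "((\<lambda>y. h (y + h x *\<^sub>R e)) has_derivative (\<lambda>v. T v)) (at z)"
        by (rule has_derivative_compose)
      from has_derivative_diff[OF this has_derivative_const[of "h x"]] show ?thesis by simp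
    qed
    then have "(h has_derivative T) (at z)" by (simp add: hshift)
    moreover have "h z = 0" unfolding z_def hshift by simp
    ultimately have "T (G z) = 0" by (rule tangent[rotated])
    have "\<bar>T (G x - G z)\<bar> \<le> (1 + L) * norm (G x - G z)"
      by (rule abs_directional_derivative_le[OF hlip has_real_derivative_on_line[OF T]])
    also have "\<dots> \<le> (1 + L) * (B * \<bar>h x\<bar>)"
      using lipschitz_onD[OF lip, of x z] L e by (intro mult_left_mono) (auto simp: dist_norm z_def)
    finally show ?case using D_eq[OF T] \<open>T (G z) = 0\<close> by (simp add: T.diff)
  qed
  define dv where "dv x = (\<Sum>b\<in>Basis. G' x b \<bullet> b)" for x
  define N where "N n = real (Suc n)" for n
  have N: "0 < N n" for n by (simp add: N_def)
  define F where "F n x = arctan (N n * h x)" for n x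
  have at_lip: "1-lipschitz_on UNIV arctan"
  proof (rule lipschitz_onI)
    fix x y :: real
    have "\<bar>arctan x - arctan y\<bar> \<le> 1 * \<bar>x - y\<bar>"
    proof (rule differentiable_bound[of UNIV arctan "\<lambda>z d. inverse (1 + z\<^sup>2) * d", simplified])
      fix z :: real
      show "(arctan has_derivative (*) (inverse (1 + z\<^sup>2))) (at z)"
        using DERIV_arctan by (simp add: has_field_derivative_def)
      show "onorm ((*) (inverse (1 + z\<^sup>2))) \<le> 1"
        by (rule onorm_le) (simp add: abs_mult mult_left_le_one_le inverse_le_1_iff add_pos_nonneg)
    qed
    then show "dist (arctan x) (arctan y) \<le> 1 * dist x y" by (simp add: dist_real_def)
  qed simp
  have Flip: "(1 * (N n * (1 + L)))-lipschitz_on UNIV (F n)" for n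
  proof -
    have "(N n * (1 + L))-lipschitz_on UNIV (\<lambda>x. N n * h x)"
      using lipschitz_on_cmult_real[OF hlip, of "N n"] N[of n] by simp
    from lipschitz_on_compose2[OF this lipschitz_on_subset[OF at_lip]] show ?thesis
      unfolding F_def by simp
  qed
  note F_parts = integral_times_divergence[OF Flip G lip supp, folded dv_def]
  have F_der: "AE x in lborel. (\<Sum>b\<in>Basis. dirderiv (F n) b x * (G x \<bullet> b)) = N n / (1 + (N n * h x)\<^sup>2) * D x" for n
    using rad
  proof eventually_elim
    case (elim x)
    then obtain T where T: "(h has_derivative T) (at x)" by (auto simp: differentiable_def)
    have "(F n has_derivative (\<lambda>v. (N n * T v) * inverse (1 + (N n * h x)\<^sup>2))) (at x)"
      unfolding F_def using T by (auto intro!: derivative_eq_intros)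
    from dirderiv_of_has_derivative[OF this]
    have "(\<Sum>b\<in>Basis. dirderiv (F n) b x * (G x \<bullet> b)) = (\<Sum>b\<in>Basis. N n / (1 + (N n * h x)\<^sup>2) * (T b * (G x \<bullet> b)))"
      by (simp add: divide_inverse ac_simps)
    also have "\<dots> = N n / (1 + (N n * h x)\<^sup>2) * D x"
      unfolding D_def by (simp add: sum_distrib_left dirderiv_of_has_derivative[OF T])
    finally show ?case .
  qed
  \<comment> \<open>Expanding the nonnegative square of \<open>1 - N n * \<bar>a\<bar>\<close>
    bounds \<open>N n * \<bar>a\<bar>\<close> by the denominator.\<close>
  have kern: "N n / (1 + (N n * a)\<^sup>2) * \<bar>a\<bar> \<le> 1" for n a
  proof -
    have "N n * \<bar>a\<bar> \<le> 1 + (N n * a)\<^sup>2"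
    proof -
      have "0 \<le> (1 - N n * \<bar>a\<bar>)\<^sup>2" "0 \<le> N n * \<bar>a\<bar>" using N[of n] by auto
      moreover have "(N n * \<bar>a\<bar>)\<^sup>2 = (N n * a)\<^sup>2" by (simp add: power_mult_distrib)
      ultimately show ?thesis by (simp add: power2_diff)
    qed
    then show ?thesis by (simp add: add_pos_nonneg)
  qed
  have inN: "filterlim N at_top sequentially"
    unfolding N_def by (rule filterlim_compose[OF filterlim_real_sequentially filterlim_Suc])
  have D_supp: "D x = 0" if "x \<notin> cball 0 R" for x
    using that supp[of x] by (simp add: D_def)
  have fin: "integrable lborel (\<lambda>x::'a. c * indicator (cball 0 R) x)" for c :: real
    using emeasure_bounded_finite[of "cball (0::'a) R"]
    by (intro integrable_mult_right integrable_real_indicator) auto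
  have lim1: "(\<lambda>n. \<integral>x. N n / (1 + (N n * h x)\<^sup>2) * D x \<partial>lborel) \<longlonglongrightarrow> (\<integral>x. 0 \<partial>(lborel :: 'a measure))"
  proof (rule integral_dominated_convergence[OF _ _ fin[of "(1 + L) * B"]])
    show "(\<lambda>x. N n / (1 + (N n * h x)\<^sup>2) * D x) \<in> borel_measurable lborel" for n
      using hm Dm by simp
    show "AE x in lborel. (\<lambda>n. N n / (1 + (N n * h x)\<^sup>2) * D x) \<longlonglongrightarrow> 0"
      using Dbound
    proof eventually_elim
      case (elim x)
      show ?case
      proof (cases "h x = 0")
        case True
        then show ?thesis using elim by simp
      next
        case False
        have "((\<lambda>t. t / (1 + (t * h x)\<^sup>2)) \<longlongrightarrow> 0) at_top"
          using False by real_asymp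
        from filterlim_compose[OF this inN] show ?thesis by (rule tendsto_mult_left_zero)
      qed
    qed
    show "AE x in lborel. norm (N n / (1 + (N n * h x)\<^sup>2) * D x) \<le> (1 + L) * B * indicator (cball 0 R) x" for n
      using Dbound
    proof eventually_elim
      case (elim x)
      have k0: "0 \<le> N n / (1 + (N n * h x)\<^sup>2)" using N[of n] by simp
      have "\<bar>N n / (1 + (N n * h x)\<^sup>2) * D x\<bar> \<le> N n / (1 + (N n * h x)\<^sup>2) * ((1 + L) * B * \<bar>h x\<bar>)"
        unfolding abs_mult abs_of_nonneg[OF k0] using elim k0 by (intro mult_left_mono)
      also have "\<dots> = (1 + L) * B * (N n / (1 + (N n * h x)\<^sup>2) * \<bar>h x\<bar>)" by (simp only: ac_simps)
      also have "\<dots> \<le> (1 + L) * B" using mult_left_mono[OF kern[of n "h x"], of "(1 + L) * B"] L by simp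
      finally show ?case using D_supp[of x] by (cases "x \<in> cball 0 R") auto
    qed
  qed simp
  have dvI: "integrable lborel dv" and dv0: "(\<integral>x. dv x \<partial>lborel) = 0"
    unfolding dv_def using integral_divergence_compact_support[OF G lip supp] by auto
  have dvm: "dv \<in> borel_measurable borel" using dvI by simp
  have lim2: "(\<lambda>n. \<integral>x. F n x * dv x \<partial>lborel) \<longlonglongrightarrow> (\<integral>x. pi / 2 * sgn (h x) * dv x \<partial>lborel)"
  proof (rule integral_dominated_convergence[where w="\<lambda>x. 2 * \<bar>dv x\<bar>"])
    show "(\<lambda>x. F n x * dv x) \<in> borel_measurable lborel" for n
      using borel_measurable_integrable[OF F_parts(1)] .
    show "(\<lambda>x. pi / 2 * sgn (h x) * dv x) \<in> borel_measurable lborel"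
      using hm dvm by simp
    show "AE x in lborel. (\<lambda>n. F n x * dv x) \<longlonglongrightarrow> pi / 2 * sgn (h x) * dv x"
    proof (intro AE_I2 tendsto_mult tendsto_const)
      fix x
      have "((\<lambda>t. arctan (t * h x)) \<longlongrightarrow> pi / 2 * sgn (h x)) at_top"
      proof (cases "h x" "0::real" rule: linorder_cases)
        case less
        then show ?thesis by (simp add: sgn_real_def) real_asymp
      next
        case greater
        then show ?thesis by (simp add: sgn_real_def) real_asymp
      qed simp
      from filterlim_compose[OF this inN] show "(\<lambda>n. F n x) \<longlonglongrightarrow> pi / 2 * sgn (h x)"
        unfolding F_def .
    qed
    show "AE x in lborel. norm (F n x * dv x) \<le> 2 * \<bar>dv x\<bar>" for n
    proof (intro AE_I2)
      fix x
      have "\<bar>F n x\<bar> \<le> 2"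
        unfolding F_def using arctan_bounded[of "N n * h x"] pi_less_4 by (simp add: abs_le_iff)
      then show "norm (F n x * dv x) \<le> 2 * \<bar>dv x\<bar>" by (simp add: abs_mult mult_right_mono)
    qed
  qed (use dvI in simp)
  have "(\<integral>x. F n x * dv x \<partial>lborel) = - (\<integral>x. N n / (1 + (N n * h x)\<^sup>2) * D x \<partial>lborel)" for n
  proof -
    have "(\<integral>x. (\<Sum>b\<in>Basis. dirderiv (F n) b x * (G x \<bullet> b)) \<partial>lborel) = (\<integral>x. N n / (1 + (N n * h x)\<^sup>2) * D x \<partial>lborel)"
    proof (rule integral_cong_AE[OF _ _ F_der])
      have "(\<lambda>x. \<Sum>b\<in>Basis. dirderiv (F n) b x * (G x \<bullet> b)) \<in> borel_measurable borel"
        using borel_measurable_dirderiv[OF lipschitz_on_continuous_on[OF Flip]] Gm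
        by (intro borel_measurable_sum borel_measurable_times borel_measurable_inner) auto
      then show "(\<lambda>x. \<Sum>b\<in>Basis. dirderiv (F n) b x * (G x \<bullet> b)) \<in> borel_measurable lborel"
        by simp
      show "(\<lambda>x. N n / (1 + (N n * h x)\<^sup>2) * D x) \<in> borel_measurable lborel"
        using hm Dm by simp
    qed
    then show ?thesis using F_parts(2) by simp
  qed
  then have "(\<lambda>n. \<integral>x. F n x * dv x \<partial>lborel) \<longlonglongrightarrow> 0"
    using tendsto_minus[OF lim1] by simp
  with lim2 have "(\<integral>x. pi / 2 * sgn (h x) * dv x \<partial>lborel) = 0" by (rule LIMSEQ_unique)
  then have sgn0: "(\<integral>x. sgn (h x) * dv x \<partial>lborel) = 0" by (simp add: mult.assoc)
  have sgnI: "integrable lborel (\<lambda>x. sgn (h x) * dv x)"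
    by (rule Bochner_Integration.integrable_bound[OF dvI]) (use hm dvm in \<open>auto simp: abs_mult abs_sgn_eq\<close>)
  \<comment> \<open>Each line along \<open>e\<close> meets the graph in a single point. Off the
    graph the indicator of \<open>h < 0\<close> is half of \<open>1 - sgn h\<close>.\<close>
  have "{x. h x = 0} \<in> null_sets lborel"
  proof (rule null_set_if_null_on_lines)
    show "{x. h x = 0} \<in> sets borel"
      using hm by measurable
    fix x
    have "{t. x + t *\<^sub>R e \<in> {x. h x = 0}} = {- h x}" by (auto simp: hshift)
    then show "{t. x + t *\<^sub>R e \<in> {x. h x = 0}} \<in> null_sets lborel"
      by (simp add: finite_imp_null_set_lborel)
  qed
  then have "AE x in lborel. h x \<noteq> 0" using AE_not_in by fastforce
  then have ae: "AE x in lborel. indicator {y. h y < 0} x * dv x = (1/2) * (dv x - sgn (h x) * dv x)"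
    by eventually_elim (auto simp: indicator_def sgn_real_def)
  have im: "(\<lambda>x. indicator {y. h y < 0} x * dv x) \<in> borel_measurable lborel"
    using hm dvm by measurable
  have rhs: "integrable lborel (\<lambda>x. (1/2) * (dv x - sgn (h x) * dv x))" using dvI sgnI by simp
  have "(\<integral>x. indicator {y. h y < 0} x * dv x \<partial>lborel) = (\<integral>x. (1/2) * (dv x - sgn (h x) * dv x) \<partial>lborel)"
    using ae im borel_measurable_integrable[OF rhs] by (intro integral_cong_AE)
  also have "\<dots> = 0" using dvI sgnI dv0 sgn0 by simp
  finally show "(\<integral>x. indicator {y. h y < 0} x * (\<Sum>b\<in>Basis. G' x b \<bullet> b) \<partial>lborel) = 0"
    unfolding dv_def .
  have "integrable lborel (\<lambda>x. indicator {y. h y < 0} x * dv x)"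
    using rhs im ae by (subst integrable_cong_AE[OF _ _ ae]) (auto intro: borel_measurable_integrable)
  then show "integrable lborel (\<lambda>x. indicator {y. h y < 0} x * (\<Sum>b\<in>Basis. G' x b \<bullet> b))"
    unfolding dv_def .
qed

section \<open>The divergence theorem for tangential fields\<close>

text \<open>Continuity of the derivative is demanded direction by direction; in finite dimensions
  this is the usual notion, and it avoids a topology on linear maps.\<close>

definition C1_on :: "'a::euclidean_space set \<Rightarrow> ('a \<Rightarrow> 'b::real_normed_vector) \<Rightarrow> bool" where
  "C1_on V f \<longleftrightarrow> (\<forall>x\<in>V. f differentiable (at x)) \<and>
     (\<forall>v. continuous_on V (\<lambda>x. frechet_derivative f (at x) v))"

lemma C1_onI:
  assumes "\<And>x. x \<in> V \<Longrightarrow> (f has_derivative f' x) (at x)" "\<And>v. continuous_on V (\<lambda>x. f' x v)"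
  shows "C1_on V f"
proof -
  have "frechet_derivative f (at x) = f' x" if "x \<in> V" for x
    using frechet_derivative_at[OF assms(1)[OF that]] by simp
  then have "continuous_on V (\<lambda>x. frechet_derivative f (at x) v)" for v
    using assms(2)[of v] by (simp cong: continuous_on_cong)
  then show ?thesis using assms(1) by (auto simp: C1_on_def differentiable_def)
qed

lemma C1_onD:
  assumes "C1_on V f"
  shows "x \<in> V \<Longrightarrow> (f has_derivative frechet_derivative f (at x)) (at x)"
    "continuous_on V (\<lambda>x. frechet_derivative f (at x) v)" "continuous_on V f"
proof -
  show d: "x \<in> V \<Longrightarrow> (f has_derivative frechet_derivative f (at x)) (at x)" for x
    using assms by (auto simp: C1_on_def frechet_derivative_works)
  show "continuous_on V (\<lambda>x. frechet_derivative f (at x) v)"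
    using assms by (auto simp: C1_on_def)
  show "continuous_on V f"
    using d by (auto intro!: continuous_at_imp_continuous_on has_derivative_continuous)
qed

lemma C1_on_subset: "C1_on V f \<Longrightarrow> U \<subseteq> V \<Longrightarrow> C1_on U f"
  unfolding C1_on_def using continuous_on_subset by blast

lemma frechet_derivative_cong_open:
  assumes "open V" "x \<in> V" "\<And>y. y \<in> V \<Longrightarrow> f y = g y"
  shows "frechet_derivative f (at x) = frechet_derivative g (at x)"
proof -
  have "(f has_derivative D) (at x) \<longleftrightarrow> (g has_derivative D) (at x)" for D
    using assms has_derivative_transform_within_open[of f D x UNIV V g]
      has_derivative_transform_within_open[of g D x UNIV V f] by auto
  then show ?thesis unfolding frechet_derivative_def by simp
qed

lemma C1_on_cong_open:
  assumes "C1_on V f" "open V" "\<And>y. y \<in> V \<Longrightarrow> f y = g y"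
  shows "C1_on V g"
proof (rule C1_onI)
  show "(g has_derivative frechet_derivative f (at x)) (at x)" if "x \<in> V" for x
    using has_derivative_transform_within_open[OF C1_onD(1)[OF assms(1) that] assms(2) that] assms(3) by simp
qed (rule C1_onD(2)[OF assms(1)])

lemma C1_on_Un:
  assumes "C1_on U f" "C1_on V f" "open U" "open V"
  shows "C1_on (U \<union> V) f"
  using assms by (auto simp: C1_on_def intro: continuous_on_open_Un)

lemma C1_on_const: "C1_on V (\<lambda>_. c)"
  by (rule C1_onI) (auto intro!: derivative_eq_intros)

lemma C1_on_add:
  assumes "C1_on V f" "C1_on V g"
  shows "C1_on V (\<lambda>x. f x + g x)"
  by (rule C1_onI[OF has_derivative_add[OF C1_onD(1)[OF assms(1)] C1_onD(1)[OF assms(2)]]])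
    (assumption | intro continuous_on_add C1_onD(2) assms)+

lemma C1_on_diff:
  assumes "C1_on V f" "C1_on V g"
  shows "C1_on V (\<lambda>x. f x - g x)"
  by (rule C1_onI[OF has_derivative_diff[OF C1_onD(1)[OF assms(1)] C1_onD(1)[OF assms(2)]]])
    (assumption | intro continuous_on_diff C1_onD(2) assms)+

lemma C1_on_sum: "(\<And>i. i \<in> I \<Longrightarrow> C1_on V (f i)) \<Longrightarrow> C1_on V (\<lambda>x. \<Sum>i\<in>I. f i x)"
  by (induction I rule: infinite_finite_induct) (auto intro: C1_on_const C1_on_add)

lemma C1_on_bilinear:
  assumes "bounded_bilinear B" "C1_on V f" "C1_on V g"
  shows "C1_on V (\<lambda>x. B (f x) (g x))"
  by (rule C1_onI[OF bounded_bilinear.FDERIV[OF assms(1) C1_onD(1)[OF assms(2)] C1_onD(1)[OF assms(3)]]])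
    (assumption | intro continuous_on_add bounded_bilinear.continuous_on[OF assms(1)] C1_onD assms)+

lemmas C1_on_mult = C1_on_bilinear[OF bounded_bilinear_mult]
  and C1_on_scaleR = C1_on_bilinear[OF bounded_bilinear_scaleR]

lemma C1_on_linear_compose:
  assumes T: "bounded_linear T" and f: "C1_on V f"
  shows "C1_on V (\<lambda>x. T (f x))"
  by (rule C1_onI[OF bounded_linear.has_derivative[OF T C1_onD(1)[OF f]]])
    (assumption | intro bounded_linear.continuous_on[OF T] C1_onD(2)[OF f])+

lemma C1_on_real_compose:
  fixes f :: "'a::euclidean_space \<Rightarrow> real"
  assumes k: "\<And>s. s \<in> S \<Longrightarrow> (k has_real_derivative k' s) (at s)" "continuous_on S k'"
    and f: "C1_on V f" "f ` V \<subseteq> S"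
  shows "C1_on V (\<lambda>x. k (f x))"
proof (rule C1_onI)
  show "((\<lambda>x. k (f x)) has_derivative (\<lambda>v. k' (f x) * frechet_derivative f (at x) v)) (at x)" if "x \<in> V" for x
    using has_derivative_compose[OF C1_onD(1)[OF f(1) that], of k "(*) (k' (f x))"] k(1)[of "f x"] that f(2)
    by (auto simp: has_field_derivative_def)
  show "continuous_on V (\<lambda>x. k' (f x) * frechet_derivative f (at x) v)" for v
    by (intro continuous_on_mult continuous_on_compose2[OF k(2) C1_onD(3)[OF f(1)] f(2)] C1_onD(2)[OF f(1)])
qed

lemma C1_on_inverse:
  fixes f :: "'a::euclidean_space \<Rightarrow> real"
  assumes "C1_on V f" "\<And>x. x \<in> V \<Longrightarrow> f x \<noteq> 0"
  shows "C1_on V (\<lambda>x. inverse (f x))"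
proof (rule C1_on_real_compose[where k=inverse and S="- {0}" and k'="\<lambda>s. - (inverse s ^ 2)"])
  show "(inverse has_real_derivative - (inverse s ^ 2)) (at s)" if "s \<in> - {0}" for s :: real
    using DERIV_inverse[of s UNIV] that by (simp add: numeral_2_eq_2)
qed (use assms in \<open>auto intro!: continuous_intros\<close>)

text \<open>Each partial derivative is continuous and vanishes far out, hence is bounded. The sum of
  these bounds controls the operator norm, and the mean value inequality applies on the convex whole
  space.\<close>

lemma C1_compact_support_Lipschitz:
  fixes G :: "'a::euclidean_space \<Rightarrow> 'b::real_normed_vector"
  assumes G: "C1_on UNIV G" and supp: "\<And>x. R < norm x \<Longrightarrow> G x = 0"
  obtains B where "B-lipschitz_on UNIV G"
proof -
  let ?D = "\<lambda>x. frechet_derivative G (at x)"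
  have "\<exists>M\<ge>0. \<forall>x. norm (?D x v) \<le> M" for v
  proof -
    have "compact ((\<lambda>x. ?D x v) ` cball 0 (R + 1))"
      by (intro compact_continuous_image continuous_on_subset[OF C1_onD(2)[OF G]]) auto
    then obtain M where M: "\<And>x. x \<in> cball 0 (R + 1) \<Longrightarrow> norm (?D x v) \<le> M"
      by (fastforce dest!: compact_imp_bounded simp: bounded_iff)
    have "norm (?D x v) \<le> max M 0" for x
    proof (cases "x \<in> cball 0 (R + 1)")
      case False
      have "?D x = frechet_derivative (\<lambda>_. 0) (at x)"
        by (rule frechet_derivative_cong_open[of "- cball 0 R"]) (use False supp in auto)
      then show ?thesis by simp
    qed (use M in \<open>auto intro: max.coboundedI1\<close>)
    then show ?thesis by (intro exI[of _ "max M 0"]) auto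
  qed
  then obtain M where M: "\<And>v. 0 \<le> M v" "\<And>v x. norm (?D x v) \<le> M v" by metis
  let ?B = "\<Sum>b\<in>Basis. M b"
  have "norm (?D x v) \<le> ?B * norm v" for x v
  proof -
    interpret D: bounded_linear "?D x"
      using C1_onD(1)[OF G, of x] has_derivative_bounded_linear by blast
    have "norm (?D x v) = norm (\<Sum>b\<in>Basis. (v \<bullet> b) *\<^sub>R ?D x b)"
      by (subst (1) euclidean_representation[of v, symmetric]) (simp add: D.sum D.scaleR)
    also have "\<dots> \<le> (\<Sum>b\<in>Basis. norm v * M b)"
      by (rule order_trans[OF norm_sum sum_mono]) (auto intro!: mult_mono Basis_le_norm M)
    also have "\<dots> = ?B * norm v" by (simp only: sum_distrib_left[symmetric] mult.commute[of "sum M Basis"])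
    finally show ?thesis .
  qed
  then have "onorm (?D x) \<le> ?B" for x by (rule onorm_le)
  then have "norm (G x - G y) \<le> ?B * norm (x - y)" for x y
    using C1_onD(1)[OF G] by (intro differentiable_bound[of UNIV G ?D]) auto
  then have "?B-lipschitz_on UNIV G"
    by (intro lipschitz_onI) (auto simp: dist_norm intro!: sum_nonneg M)
  then show thesis by (rule that)
qed

section \<open>Outward normals and the local divergence identities\<close>

lemma sum_axis_eq_sum_Basis:
  fixes f :: "real^'n \<Rightarrow> real^'n"
  shows "(\<Sum>i\<in>UNIV. f (axis i (1::real)) $ i) = (\<Sum>b\<in>Basis. f b \<bullet> b)"
proof -
  have B: "(Basis :: (real^'n) set) = (\<lambda>i. axis i 1) ` UNIV" by (auto simp: Basis_vec_def)
  have "inj_on (\<lambda>i. axis i (1::real) :: real^'n) UNIV" by (auto simp: inj_on_def axis_eq_axis)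
  then have "(\<Sum>b\<in>Basis. f b \<bullet> b) = (\<Sum>i\<in>UNIV. f (axis i 1) \<bullet> axis i 1)"
    unfolding B by (subst sum.reindex) (auto simp: o_def)
  then show ?thesis by (simp add: inner_axis)
qed

lemma divergence_eq_Basis: "divergence F x = (\<Sum>b\<in>Basis. frechet_derivative F (at x) b \<bullet> b)"
  unfolding divergence_def by (rule sum_axis_eq_sum_Basis)

lemma divergence_cong_open:
  assumes "open V" "x \<in> V" "\<And>y. y \<in> V \<Longrightarrow> F y = G y"
  shows "divergence F x = divergence G x"
  unfolding divergence_def using frechet_derivative_cong_open[OF assms] by simp

text \<open>The normal is the normalised gradient \<open>w\<close> of \<open>h\<close>, nonzero
  because \<open>T e\<close> is. Near \<open>z\<close> the error of the linearisation is at most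
  \<open>\<epsilon> * norm w * norm (y - z)\<close>, so in the two cones of
  \<open>outward_normal\<close> the sign of \<open>h\<close>, and with it membership in
  \<open>\<Omega>\<close>, is that of the linear part.\<close>

lemma outward_normal_of_defining_function:
  fixes \<Omega> :: "(real^'n) set" and h :: "real^'n \<Rightarrow> real"
  assumes h: "(h has_derivative T) (at z)" and z: "h z = 0" and B: "open B" "z \<in> B"
    and def: "\<Omega> \<inter> B = {y \<in> B. h y < 0}" and e: "T e \<noteq> 0"
  obtains w \<nu> where "outward_normal \<Omega> z \<nu>" "\<And>v. T v = w * (v \<bullet> \<nu>)"
proof -
  interpret T: bounded_linear T using h by (rule has_derivative_bounded_linear)
  define w where "w = (\<Sum>b\<in>Basis. T b *\<^sub>R b)"
  have Tw: "T v = v \<bullet> w" for v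
  proof -
    have "T v = (\<Sum>b\<in>Basis. (v \<bullet> b) *\<^sub>R T b)"
      by (subst (1) euclidean_representation[of v, symmetric]) (simp add: T.sum T.scaleR)
    then show ?thesis by (simp add: w_def inner_sum_right mult.commute)
  qed
  have "w \<noteq> 0" using e Tw by auto
  then have w0: "0 < norm w" by simp
  define \<nu> where "\<nu> = (1 / norm w) *\<^sub>R w"
  have T\<nu>: "T v = norm w * (v \<bullet> \<nu>)" for v using w0 by (simp add: Tw \<nu>_def)
  have n1: "norm \<nu> = 1" using w0 by (simp add: \<nu>_def)
  have cone: "\<exists>\<delta>>0. \<forall>y\<in>ball z \<delta>. ((y - z) \<bullet> \<nu> < - \<epsilon> * norm (y - z) \<longrightarrow> y \<in> \<Omega>) \<and>
      ((y - z) \<bullet> \<nu> > \<epsilon> * norm (y - z) \<longrightarrow> y \<notin> \<Omega>)" if "\<epsilon> > 0" for \<epsilon>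
  proof -
    have "0 < \<epsilon> * norm w" using that w0 by simp
    with h obtain d where d: "d > 0"
      "\<And>y. norm (y - z) < d \<Longrightarrow> norm (h y - h z - T (y - z)) \<le> \<epsilon> * norm w * norm (y - z)"
      unfolding has_derivative_at_alt by blast
    obtain d' where d': "d' > 0" "ball z d' \<subseteq> B" using B openE by blast
    show ?thesis
    proof (intro exI conjI ballI impI)
      show "0 < min d d'" using d d' by simp
      fix y assume y: "y \<in> ball z (min d d')"
      have yB: "y \<in> B" using y d' by auto
      have est: "\<bar>h y - norm w * ((y - z) \<bullet> \<nu>)\<bar> \<le> norm w * (\<epsilon> * norm (y - z))"
        using d(2)[of y] y z by (simp add: T\<nu> dist_norm norm_minus_commute ac_simps)
      show "y \<in> \<Omega>" if "(y - z) \<bullet> \<nu> < - \<epsilon> * norm (y - z)"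
      proof -
        have "norm w * ((y - z) \<bullet> \<nu>) < norm w * (- \<epsilon> * norm (y - z))"
          using that w0 by (rule mult_strict_left_mono)
        then have "h y < 0" using est by (simp add: abs_le_iff)
        then show ?thesis using def yB by blast
      qed
      show "y \<notin> \<Omega>" if "(y - z) \<bullet> \<nu> > \<epsilon> * norm (y - z)"
      proof -
        have "norm w * (\<epsilon> * norm (y - z)) < norm w * ((y - z) \<bullet> \<nu>)"
          using that w0 by (rule mult_strict_left_mono)
        then have "0 < h y" using est by (simp add: abs_le_iff)
        then show ?thesis using def yB by force
      qed
    qed
  qed
  have "z \<notin> \<Omega>" using def z B by force
  moreover have "z \<in> closure \<Omega>"
    unfolding closure_approachable
  proof (intro allI impI)
    fix r :: real assume "0 < r"
    obtain \<delta> where \<delta>: "\<delta> > 0" "\<And>y. y \<in> ball z \<delta> \<Longrightarrow> (y - z) \<bullet> \<nu> < - (1/2) * norm (y - z) \<Longrightarrow> y \<in> \<Omega>"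
      using cone[of "1/2"] by auto
    \<comment> \<open>Going backwards along the normal enters the interior cone at once, so
      \<open>z\<close> is a limit of points of \<open>\<Omega>\<close>.\<close>
    define t where "t = min \<delta> r / 2"
    have t: "0 < t" "t < \<delta>" "t < r" using \<open>0 < r\<close> \<delta> by (auto simp: t_def)
    have "z - t *\<^sub>R \<nu> \<in> \<Omega>"
      using t n1 by (intro \<delta>(2)) (auto simp: dist_norm dot_square_norm)
    then show "\<exists>y\<in>\<Omega>. dist y z < r"
      using t n1 by (intro bexI[of _ "z - t *\<^sub>R \<nu>"]) (auto simp: dist_norm)
  qed
  ultimately have "z \<in> frontier \<Omega>"
    unfolding frontier_def using interior_subset by blast
  then have "outward_normal \<Omega> z \<nu>"
    unfolding outward_normal_def using n1 cone by blast
  then show thesis using T\<nu> by (rule that)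
qed

text \<open>The body of the existential in \<open>lipschitz_domain\<close>, named so that a chart
  can be handed over as one fact.\<close>

definition subgraph_at :: "(real^'n) set \<Rightarrow> real^'n \<Rightarrow> real^'n \<Rightarrow> real \<Rightarrow> real \<Rightarrow> (real^'n \<Rightarrow> real) \<Rightarrow> bool" where
  "subgraph_at \<Omega> x e \<rho> L g \<longleftrightarrow> norm e = 1 \<and> \<rho> > 0 \<and> L-lipschitz_on UNIV g \<and>
     (\<forall>y. g y = g (y - (y \<bullet> e) *\<^sub>R e)) \<and>
     \<Omega> \<inter> ball x \<rho> = {y \<in> ball x \<rho>. y \<bullet> e < g (y - (y \<bullet> e) *\<^sub>R e)}"

lemma lipschitz_domainD: 
  assumes "lipschitz_domain \<Omega>" "x \<in> frontier \<Omega>"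
  obtains e \<rho> L g where "subgraph_at \<Omega> x e \<rho> L g"
  using assms unfolding lipschitz_domain_def subgraph_at_def[symmetric] by blast

text \<open>The field vanishes outside the chart, so \<open>\<Omega>\<close> may be exchanged for
  the entire region below the graph. In the chart, any derivative of \<open>h\<close> at a graph
  point is a multiple of the inner product with an outward normal, so tangency to
  \<open>\<Omega>\<close> is tangency to the graph.\<close>

lemma local_divergence_boundary:
  fixes \<Omega> :: "(real^'n) set" and G :: "real^'n \<Rightarrow> real^'n"
  assumes graph: "subgraph_at \<Omega> x e \<rho> L g" and r: "r < \<rho>" and G: "C1_on UNIV G" and supp: "\<And>y. y \<notin> ball x r \<Longrightarrow> G y = 0"
    and tangent: "\<And>y \<nu>. outward_normal \<Omega> y \<nu> \<Longrightarrow> G y \<bullet> \<nu> = 0"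
  shows "integrable lborel (\<lambda>y. indicator \<Omega> y * divergence G y)"
    "(\<integral>y. indicator \<Omega> y * divergence G y \<partial>lborel) = 0"
proof -
  note gr = graph[unfolded subgraph_at_def]
  have e: "norm e = 1" and g: "L-lipschitz_on UNIV g"
    and inv: "g y = g (y - (y \<bullet> e) *\<^sub>R e)"
    and \<Omega>: "\<Omega> \<inter> ball x \<rho> = {y \<in> ball x \<rho>. y \<bullet> e < g (y - (y \<bullet> e) *\<^sub>R e)}" for y
    by (rule gr[THEN conjunct1] gr[THEN conjunct2, THEN conjunct2, THEN conjunct1]
        gr[THEN conjunct2, THEN conjunct2, THEN conjunct2, THEN conjunct1, THEN spec]
        gr[THEN conjunct2, THEN conjunct2, THEN conjunct2, THEN conjunct2])+
  define h where "h y = y \<bullet> e - g y" for y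
  have ee: "e \<bullet> e = 1" using e by (simp add: dot_square_norm)
  have ginv: "g (y + t *\<^sub>R e) = g y" for y t
    using inv[of "y + t *\<^sub>R e"] inv[of y] by (simp add: inner_add_left ee algebra_simps)
  have supp': "G y = 0" if "norm x + r < norm y" for y
  proof (rule supp)
    have "norm y \<le> norm x + dist x y" using norm_triangle_sub[of y x] by (simp add: dist_norm norm_minus_commute)
    then show "y \<notin> ball x r" using that by simp
  qed
  obtain B where B: "B-lipschitz_on UNIV G" using C1_compact_support_Lipschitz[OF G supp'] by blast
  have tan: "T (G z) = 0" if hz: "h z = 0" and hT: "(h has_derivative T) (at z)" for z T
  proof (cases "z \<in> ball x r")
    case True
    then have zB: "z \<in> ball x \<rho>" using r by auto
    \<comment> \<open>Along \<open>e\<close> the height \<open>h\<close> grows at unit speed, so its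
      gradient cannot vanish.\<close>
    have "T e = 1"
    proof -
      have "((\<lambda>t. h (z + t *\<^sub>R e)) has_real_derivative T e) (at 0)"
        by (rule has_real_derivative_on_line[OF hT])
      moreover have "(\<lambda>t. h (z + t *\<^sub>R e)) = (\<lambda>t. h z + t)"
        by (auto simp: h_def ginv inner_add_left ee)
      moreover have "((\<lambda>t. h z + t) has_real_derivative 1) (at 0)"
        by (auto intro!: derivative_eq_intros)
      ultimately show ?thesis using DERIV_unique by metis
    qed
    then have Te: "T e \<noteq> 0" by simp
    have "\<Omega> \<inter> ball x \<rho> = {y \<in> ball x \<rho>. h y < 0}"
      unfolding \<Omega> h_def inv[symmetric] by auto
    from outward_normal_of_defining_function[OF hT hz open_ball zB this Te]
    obtain w \<nu> where "outward_normal \<Omega> z \<nu>" "\<And>v. T v = w * (v \<bullet> \<nu>)"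
      by blast
    then show ?thesis using tangent by simp
  next
    case False
    then show ?thesis
      using supp bounded_linear.linear[OF has_derivative_bounded_linear[OF hT]] by (simp add: linear_0)
  qed
  have b1: "(\<integral>x. indicator {y. y \<bullet> e - g y < 0} x * (\<Sum>b\<in>Basis. frechet_derivative G (at x) b \<bullet> b) \<partial>lborel) = 0"
  proof (rule integral_divergence_below_graph(1)[where R="norm x + r" and g=g and e=e, OF g inv e C1_onD(1)[OF G UNIV_I] B])
    show "G y = 0" if "norm x + r < norm y" for y using that by (rule supp')
    show "T (G z) = 0" if "z \<bullet> e - g z = 0" "((\<lambda>y. y \<bullet> e - g y) has_derivative T) (at z)" for z T
      using tan[of z T] that by (simp add: h_def[abs_def])
  qed
  have b2: "integrable lborel (\<lambda>x. indicator {y. y \<bullet> e - g y < 0} x * (\<Sum>b\<in>Basis. frechet_derivative G (at x) b \<bullet> b))"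
  proof (rule integral_divergence_below_graph(2)[where R="norm x + r" and g=g and e=e, OF g inv e C1_onD(1)[OF G UNIV_I] B])
    show "G y = 0" if "norm x + r < norm y" for y using that by (rule supp')
    show "T (G z) = 0" if "z \<bullet> e - g z = 0" "((\<lambda>y. y \<bullet> e - g y) has_derivative T) (at z)" for z T
      using tan[of z T] that by (simp add: h_def[abs_def])
  qed
  note below = b1[folded h_def divergence_eq_Basis] b2[folded h_def divergence_eq_Basis]
  have eq: "indicator \<Omega> y * divergence G y = indicator {y. h y < 0} y * divergence G y" for y :: "real^'n"
  proof (cases "y \<in> ball x \<rho>")
    case True
    then have "y \<in> \<Omega> \<longleftrightarrow> y \<bullet> e < g (y - (y \<bullet> e) *\<^sub>R e)" using \<Omega> by blast
    then have "y \<in> \<Omega> \<longleftrightarrow> h y < 0" unfolding inv[of y, symmetric] by (simp add: h_def)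
    then show ?thesis by (simp add: indicator_def)
  next
    case False
    \<comment> \<open>As \<open>r < \<rho>\<close>, the point lies in the open complement of
      \<open>cball x r\<close>, where \<open>G\<close> is identically zero; the two regions may
      differ only there.\<close>
    have "divergence G y = divergence (\<lambda>_. 0) y"
      by (rule divergence_cong_open[of "- cball x r"]) (use False r supp in auto)
    then show ?thesis by (simp add: divergence_def)
  qed
  then have feq: "(\<lambda>y. indicator \<Omega> y * divergence G y) = (\<lambda>y. indicator {y. h y < 0} y * divergence G y)"
    by (intro ext)
  show "integrable lborel (\<lambda>y. indicator \<Omega> y * divergence G y)"
    by (subst feq) (rule below(2))
  show "(\<integral>y. indicator \<Omega> y * divergence G y \<partial>lborel) = 0"
    by (subst feq) (rule below(1))
qed

lemma local_divergence_interior: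
  fixes \<Omega> :: "(real^'n) set" and G :: "real^'n \<Rightarrow> real^'n"
  assumes \<Omega>: "cball x r \<subseteq> \<Omega>" and G: "C1_on UNIV G" and supp: "\<And>y. y \<notin> ball x r \<Longrightarrow> G y = 0"
  shows "integrable lborel (\<lambda>y. indicator \<Omega> y * divergence G y)"
    "(\<integral>y. indicator \<Omega> y * divergence G y \<partial>lborel) = 0"
proof -
  have supp': "G y = 0" if "norm x + r < norm y" for y
  proof (rule supp)
    have "norm y \<le> norm x + dist x y" using norm_triangle_sub[of y x] by (simp add: dist_norm norm_minus_commute)
    then show "y \<notin> ball x r" using that by simp
  qed
  obtain B where B: "B-lipschitz_on UNIV G" using C1_compact_support_Lipschitz[OF G supp'] by blast
  have eq: "indicator \<Omega> y * divergence G y = divergence G y" for y :: "real^'n"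
  proof (cases "y \<in> \<Omega>")
    case False
    have "divergence G y = divergence (\<lambda>_. 0) y"
      by (rule divergence_cong_open[of "- cball x r"]) (use False \<Omega> supp in auto)
    then show ?thesis by (simp add: divergence_def)
  qed simp
  then have feq: "(\<lambda>y. indicator \<Omega> y * divergence G y) = (\<lambda>y. divergence G y)"
    by (intro ext)
  have "integrable lborel (\<lambda>y. divergence G y)" "(\<integral>y. divergence G y \<partial>lborel) = 0"
    unfolding divergence_eq_Basis
    using integral_divergence_compact_support[OF C1_onD(1)[OF G UNIV_I] B, of "norm x + r"] supp' by blast+
  then show "integrable lborel (\<lambda>y. indicator \<Omega> y * divergence G y)"
    "(\<integral>y. indicator \<Omega> y * divergence G y \<partial>lborel) = 0"
    unfolding feq by blast+
qed

section \<open>A continuously differentiable partition of unity\<close>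

lemma has_real_derivative_pos_part_square:
  "((\<lambda>s. (max 0 s)\<^sup>2) has_real_derivative 2 * max 0 s) (at s)" for s :: real
proof (cases "s" "0::real" rule: linorder_cases)
  case less
  have "((\<lambda>_. 0) has_real_derivative 2 * max 0 s) (at s)" using less by simp
  then show ?thesis
    by (rule has_field_derivative_transform_within_open[of _ _ _ "{..<0}"]) (use less in auto)
next
  case greater
  have "((\<lambda>s. s\<^sup>2) has_real_derivative 2 * max 0 s) (at s)"
    using greater by (auto intro!: derivative_eq_intros)
  then show ?thesis
    by (rule has_field_derivative_transform_within_open[of _ _ _ "{0<..}"]) (use greater in auto)
next
  case equal
  have "((\<lambda>h. (max 0 h)\<^sup>2 / h) \<longlongrightarrow> 0) (at (0::real))"
  proof (rule Lim_null_comparison)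
    show "\<forall>\<^sub>F h in at 0. norm ((max 0 h)\<^sup>2 / h) \<le> \<bar>h\<bar>"
      by (rule always_eventually) (auto simp: max_def power2_eq_square)
    show "((\<lambda>h::real. \<bar>h\<bar>) \<longlongrightarrow> 0) (at 0)"
      using tendsto_rabs[OF tendsto_ident_at, of "0::real" UNIV] by simp
  qed
  then show ?thesis using equal by (simp add: DERIV_def)
qed

text \<open>Squaring removes the kink of the positive part. Bumps of this kind suffice because the
  localised fields need only be continuously differentiable once.\<close>

lemma C1_on_pos_part_square: "C1_on V f \<Longrightarrow> C1_on V (\<lambda>x. (max 0 (f x :: real))\<^sup>2)"
  by (rule C1_on_real_compose[OF has_real_derivative_pos_part_square])
    (auto intro!: continuous_intros)

lemma C1_on_ball_defining: "C1_on V (\<lambda>y. \<rho>\<^sup>2 - (norm (y - c))\<^sup>2)"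
proof (rule C1_onI[where f'="\<lambda>y v. - (2 * ((y - c) \<bullet> v))"])
  show "((\<lambda>y. \<rho>\<^sup>2 - (norm (y - c))\<^sup>2) has_derivative (\<lambda>v. - (2 * ((y - c) \<bullet> v)))) (at y)" for y
    unfolding power2_norm_eq_inner by (auto intro!: derivative_eq_intros simp: inner_commute)
qed (intro continuous_intros)

text \<open>\<open>s + max(0, m - s)\<^sup>2 / m\<close> is a positive \<open>C\<^sup>1\<close> function of \<open>s\<close> that agrees with \<open>s\<close> for \<open>s \<ge> m\<close>;
  it replaces the sum of the bumps in the denominators of the partition of unity, so that
  these are \<open>C\<^sup>1\<close> on the whole space.\<close>
lemma C1_partition_of_unity:
  fixes K :: "'a::euclidean_space set"
  assumes K: "compact K" and \<rho>: "\<And>x. x \<in> K \<Longrightarrow> 0 < \<rho> x"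
  obtains I \<phi> where "finite I" "I \<subseteq> K" "\<And>c. c \<in> I \<Longrightarrow> C1_on UNIV (\<phi> c :: 'a \<Rightarrow> real)"
    "\<And>c y. c \<in> I \<Longrightarrow> y \<notin> ball c (\<rho> c) \<Longrightarrow> \<phi> c y = 0" "\<And>y. y \<in> K \<Longrightarrow> (\<Sum>c\<in>I. \<phi> c y) = 1"
proof (cases "K = {}")
  case True
  then show thesis using that[of "{}"] by simp
next
  case False
  have "K \<subseteq> (\<Union>c\<in>K. ball c (\<rho> c))" using \<rho> by force
  then obtain I where I: "I \<subseteq> K" "finite I" "K \<subseteq> (\<Union>c\<in>I. ball c (\<rho> c))"
    using compactE_image[OF K, of K "\<lambda>c. ball c (\<rho> c)"] by auto
  define b where "b c y = (max 0 ((\<rho> c)\<^sup>2 - (norm (y - c))\<^sup>2))\<^sup>2" for c y :: 'a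
  have bC1: "C1_on UNIV (b c)" for c
    unfolding b_def[abs_def] by (intro C1_on_pos_part_square C1_on_ball_defining)
  have b_pos: "0 < b c y" if "y \<in> ball c (\<rho> c)" for c y
  proof -
    have "norm (y - c) < \<rho> c" using that by (simp add: dist_norm norm_minus_commute)
    then have "(norm (y - c))\<^sup>2 < (\<rho> c)\<^sup>2" by (intro power_strict_mono) auto
    then show ?thesis by (simp add: b_def)
  qed
  define S where "S y = (\<Sum>c\<in>I. b c y)" for y
  have SC1: "C1_on UNIV S" unfolding S_def[abs_def] by (intro C1_on_sum bC1)
  have S_pos: "0 < S y" if "y \<in> K" for y
  proof -
    have "\<exists>c\<in>I. y \<in> ball c (\<rho> c)" using I(3) that by blast
    then obtain c where "c \<in> I" "y \<in> ball c (\<rho> c)" by blast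
    then show ?thesis
      unfolding S_def using I(2) b_pos by (intro sum_pos2[of I c]) (auto simp: b_def)
  qed
  obtain y0 where y0: "y0 \<in> K" "\<And>y. y \<in> K \<Longrightarrow> S y0 \<le> S y"
    using continuous_attains_inf[OF K False continuous_on_subset[OF C1_onD(3)[OF SC1]]] by auto
  define m where "m = S y0"
  have m: "0 < m" "\<And>y. y \<in> K \<Longrightarrow> m \<le> S y" using y0 S_pos by (auto simp: m_def)
  define T where "T y = S y + (max 0 (m - S y))\<^sup>2 * inverse m" for y
  have TC1: "C1_on UNIV T"
    unfolding T_def[abs_def]
    by (intro C1_on_add C1_on_mult C1_on_pos_part_square C1_on_diff C1_on_const SC1)
  have T_pos: "0 < T y" for y
  proof (cases "m \<le> S y")
    case True
    then show ?thesis using m by (simp add: T_def)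
  next
    case False
    \<comment> \<open>Below \<open>m\<close>, the numerator of \<open>T y\<close> over
      \<open>m\<close> is \<open>S y * m + (m - S y)\<^sup>2\<close>; completing the square shows
      that it is positive.\<close>
    have "0 < (S y - m / 2)\<^sup>2 + 3 / 4 * m\<^sup>2" using m by (intro add_nonneg_pos) auto
    also have "\<dots> = S y * m + (m - S y)\<^sup>2" by (simp add: power2_eq_square algebra_simps)
    finally have "0 < (S y * m + (m - S y)\<^sup>2) * inverse m" using m by simp
    also have "\<dots> = T y" using False m by (simp add: T_def field_simps)
    finally show ?thesis .
  qed
  define \<phi> where "\<phi> c y = b c y * inverse (T y)" for c y
  show thesis
  proof (rule that[of I \<phi>])
    show "C1_on UNIV (\<phi> c)" for c
      unfolding \<phi>_def[abs_def] using T_pos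
      by (intro C1_on_mult C1_on_inverse bC1 TC1) (auto simp: less_imp_neq[symmetric])
    show "\<phi> c y = 0" if "c \<in> I" "y \<notin> ball c (\<rho> c)" for c y
    proof -
      have "0 < \<rho> c" using I(1) \<rho> that by blast
      then have "(\<rho> c)\<^sup>2 \<le> (norm (y - c))\<^sup>2"
        using that by (intro power_mono) (auto simp: dist_norm norm_minus_commute)
      then show ?thesis by (simp add: \<phi>_def b_def)
    qed
    show "(\<Sum>c\<in>I. \<phi> c y) = 1" if "y \<in> K" for y
    proof -
      have "T y = S y" using m(2)[OF that] by (simp add: T_def)
      then show ?thesis
        unfolding \<phi>_def sum_distrib_right[symmetric] S_def[symmetric] using T_pos[of y] by simp
    qed
  qed (use I in auto)
qed

text \<open>Multiplying by a scalar cutoff preserves tangency, so each localised piece again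
  satisfies the hypothesis of a local identity, and on \<open>\<Omega>\<close> the pieces add up to
  \<open>F\<close>.\<close>

theorem divergence_theorem_tangential_field:
  fixes \<Omega> :: "(real^'n) set" and F :: "real^'n \<Rightarrow> real^'n"
  assumes dom: "lipschitz_domain \<Omega>" and V: "open V" "closure \<Omega> \<subseteq> V" and F: "C1_on V F"
    and tangent: "\<And>x \<nu>. outward_normal \<Omega> x \<nu> \<Longrightarrow> F x \<bullet> \<nu> = 0"
  shows "(divergence F has_integral 0) \<Omega>"
proof -
  have \<Omega>: "open \<Omega>" "bounded \<Omega>" using dom by (auto simp: lipschitz_domain_def)
  have K: "compact (closure \<Omega>)" using \<Omega> by (simp add: compact_closure)
  \<comment> \<open>The radius is fixed for all fields at once, since the partition of unity that
    determines the pieces is built from these radii.\<close>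
  have "\<exists>r>0. cball x r \<subseteq> V \<and> (\<forall>G. C1_on UNIV G \<longrightarrow> (\<forall>y. y \<notin> ball x r \<longrightarrow> G y = 0) \<longrightarrow>
      (\<forall>y \<nu>. outward_normal \<Omega> y \<nu> \<longrightarrow> G y \<bullet> \<nu> = 0) \<longrightarrow>
      integrable lborel (\<lambda>y. indicator \<Omega> y * divergence G y) \<and>
      (\<integral>y. indicator \<Omega> y * divergence G y \<partial>lborel) = 0)" (is "\<exists>r>0. ?P x r")
    if x: "x \<in> closure \<Omega>" for x
  proof (cases "x \<in> \<Omega>")
    case True
    then obtain r where "r > 0" "cball x r \<subseteq> \<Omega>" using \<Omega>(1) open_contains_cball by blast
    moreover have "cball x r \<subseteq> V" using calculation V closure_subset by blast
    ultimately show ?thesis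
      by (intro exI[of _ r] conjI allI impI local_divergence_interior[of x r]) simp_all
  next
    case False
    then have "x \<in> frontier \<Omega>" using x \<Omega>(1) by (simp add: frontier_def interior_open)
    with dom obtain e \<rho> L g where graph: "subgraph_at \<Omega> x e \<rho> L g" by (rule lipschitz_domainD)
    then have "\<rho> > 0" unfolding subgraph_at_def by (elim conjE)
    have "x \<in> V" using V(2) x by blast
    then obtain r' where r': "r' > 0" "cball x r' \<subseteq> V" using V(1) open_contains_cball by blast
    define r where "r = min r' (\<rho> / 2)"
    have r: "0 < r" "r < \<rho>" "cball x r \<subseteq> V" using r' \<open>\<rho> > 0\<close> by (auto simp: r_def)
    then show ?thesis
      by (intro exI[of _ r] conjI allI impI local_divergence_boundary[OF graph r(2)]) simp_all
  qed
  then have "\<forall>x\<in>closure \<Omega>. \<exists>r. r > 0 \<and> ?P x r" by blast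
  then obtain \<rho> where "\<forall>x\<in>closure \<Omega>. \<rho> x > 0 \<and> ?P x (\<rho> x)"
    by (rule bchoice[THEN exE])
  then have \<rho>: "\<And>x. x \<in> closure \<Omega> \<Longrightarrow> 0 < \<rho> x"
    and \<rho>V: "\<And>x. x \<in> closure \<Omega> \<Longrightarrow> cball x (\<rho> x) \<subseteq> V"
    and loc: "\<And>x G. x \<in> closure \<Omega> \<Longrightarrow> C1_on UNIV G \<Longrightarrow> \<forall>y. y \<notin> ball x (\<rho> x) \<longrightarrow> G y = 0 \<Longrightarrow>
      \<forall>y \<nu>. outward_normal \<Omega> y \<nu> \<longrightarrow> G y \<bullet> \<nu> = 0 \<Longrightarrow>
      integrable lborel (\<lambda>y. indicator \<Omega> y * divergence G y) \<and>
      (\<integral>y. indicator \<Omega> y * divergence G y \<partial>lborel) = 0"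
    by blast+
  obtain I \<phi> where I: "finite I" "I \<subseteq> closure \<Omega>" and \<phi>: "\<And>c. c \<in> I \<Longrightarrow> C1_on UNIV (\<phi> c :: _ \<Rightarrow> real)"
    "\<And>c y. c \<in> I \<Longrightarrow> y \<notin> ball c (\<rho> c) \<Longrightarrow> \<phi> c y = 0" "\<And>y. y \<in> closure \<Omega> \<Longrightarrow> (\<Sum>c\<in>I. \<phi> c y) = 1"
    by (rule C1_partition_of_unity[OF K, of \<rho>]) (erule \<rho>, rule that)
  \<comment> \<open>\<open>F\<close> is controlled only on \<open>V\<close>. Extension by zero is
    harmless: the cutoff vanishes outside a ball whose closed version lies in \<open>V\<close>, so
    \<open>V\<close> and the complement of that closed ball are two open sets covering the space,
    and \<open>G c\<close> is regular on each.\<close>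
  define G where "G c y = (if y \<in> V then \<phi> c y *\<^sub>R F y else 0)" for c y
  have GC1: "C1_on UNIV (G c)" if "c \<in> I" for c
  proof -
    have "C1_on V (\<lambda>y. \<phi> c y *\<^sub>R F y)"
      by (intro C1_on_scaleR C1_on_subset[OF \<phi>(1)[OF that]] F) auto
    then have "C1_on V (G c)" by (rule C1_on_cong_open) (use V in \<open>auto simp: G_def\<close>)
    moreover have "C1_on (- cball c (\<rho> c)) (G c)"
      by (rule C1_on_cong_open[OF C1_on_const[of _ 0]]) (use \<phi>(2)[OF that] in \<open>auto simp: G_def\<close>)
    ultimately have "C1_on (V \<union> - cball c (\<rho> c)) (G c)"
      using V by (intro C1_on_Un) auto
    moreover have "V \<union> - cball c (\<rho> c) = UNIV" using \<rho>V[of c] I that by blast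
    ultimately show ?thesis by simp
  qed
  have G_loc: "integrable lborel (\<lambda>y. indicator \<Omega> y * divergence (G c) y) \<and>
      (\<integral>y. indicator \<Omega> y * divergence (G c) y \<partial>lborel) = 0" if "c \<in> I" for c
    using that I(2) by (intro loc[of c] GC1) (auto simp: G_def \<phi>(2) tangent)
  have "indicator \<Omega> y * divergence F y = (\<Sum>c\<in>I. indicator \<Omega> y * divergence (G c) y)" for y
  proof (cases "y \<in> \<Omega>")
    case True
    have "F z = (\<Sum>c\<in>I. G c z)" if "z \<in> \<Omega>" for z
    proof -
      have "z \<in> closure \<Omega>" using that closure_subset by blast
      then show ?thesis using V \<phi>(3)[of z] by (auto simp: G_def simp flip: scaleR_sum_left)
    qed
    then have "divergence F y = divergence (\<lambda>z. \<Sum>c\<in>I. G c z) y"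
      by (rule divergence_cong_open[OF \<Omega>(1) True])
    also have "\<dots> = (\<Sum>c\<in>I. divergence (G c) y)"
    proof -
      have "((\<lambda>z. \<Sum>c\<in>I. G c z) has_derivative (\<lambda>v. \<Sum>c\<in>I. frechet_derivative (G c) (at y) v)) (at y)"
        by (intro has_derivative_sum C1_onD(1)[OF GC1]) auto
      from frechet_derivative_at[OF this, symmetric] show ?thesis
        unfolding divergence_def by (simp add: sum.swap[of _ I])
    qed
    finally show ?thesis by (simp add: sum_distrib_left)
  qed simp
  then have "integrable lborel (\<lambda>y. indicator \<Omega> y * divergence F y)"
    "(\<integral>y. indicator \<Omega> y * divergence F y \<partial>lborel) = 0"
    using G_loc by (simp_all add: Bochner_Integration.integral_sum)
  then have "set_integrable lborel \<Omega> (divergence F)" "(LINT y:\<Omega>|lborel. divergence F y) = 0"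
    by (simp_all add: set_integrable_def set_lebesgue_integral_def)
  then show ?thesis
    using set_borel_integral_eq_integral[of \<Omega> "divergence F"] by (metis has_integral_integral)
qed

section \<open>The entropy identity\<close>

lemma Ck_on_imp_continuous_on: "Ck_on k U f \<Longrightarrow> continuous_on U f"
  by (cases k) (auto intro!: continuous_at_imp_continuous_on differentiable_imp_continuous_within)

text \<open>\<open>Ck_on\<close> speaks only of partial derivatives along \<open>Basis\<close>;
  linearity of the derivative expands any other direction in them.\<close>

lemma Ck_on_Suc_imp_C1:
  assumes "Ck_on (Suc k) U f"
  shows "C1_on U f"
proof (rule C1_onI)
  show d: "(f has_derivative frechet_derivative f (at x)) (at x)" if "x \<in> U" for x
    using assms that by (auto simp: frechet_derivative_works)
  show "continuous_on U (\<lambda>x. frechet_derivative f (at x) v)" for v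
  proof (rule continuous_on_eq[where f="\<lambda>x. \<Sum>i\<in>Basis. (v \<bullet> i) *\<^sub>R frechet_derivative f (at x) i"])
    show "continuous_on U (\<lambda>x. \<Sum>i\<in>Basis. (v \<bullet> i) *\<^sub>R frechet_derivative f (at x) i)"
      using assms by (intro continuous_on_sum continuous_on_scaleR continuous_on_const)
        (auto intro: Ck_on_imp_continuous_on)
    fix x assume "x \<in> U"
    interpret D: bounded_linear "frechet_derivative f (at x)"
      using d[OF \<open>x \<in> U\<close>] by (rule has_derivative_bounded_linear)
    show "(\<Sum>i\<in>Basis. (v \<bullet> i) *\<^sub>R frechet_derivative f (at x) i) = frechet_derivative f (at x) v"
      unfolding D.scaleR[symmetric] D.sum[symmetric] euclidean_representation ..
  qed
qed

lemma Ck_on_partial_C1: "Ck_on (Suc (Suc k)) U f \<Longrightarrow> i \<in> Basis \<Longrightarrow> C1_on U (\<lambda>x. frechet_derivative f (at x) i)"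
  by (rule Ck_on_Suc_imp_C1[of k]) simp

section \<open>Slices in time and space, gradients, and divergences of products\<close>

lemma has_derivative_slice:
  fixes f :: "'a::euclidean_space \<times> 'b::euclidean_space \<Rightarrow> 'c::real_normed_vector"
  assumes "(f has_derivative D) (at (t, x))"
  shows "((\<lambda>x. f (t, x)) has_derivative (\<lambda>v. D (0, v))) (at x)"
    "((\<lambda>t. f (t, x)) has_derivative (\<lambda>v. D (v, 0))) (at t)"
proof -
  show "((\<lambda>x. f (t, x)) has_derivative (\<lambda>v. D (0, v))) (at x)"
    by (rule has_derivative_compose[of "\<lambda>x. (t, x)" "\<lambda>v. (0, v)" x UNIV f D])
      (use assms in \<open>auto intro!: derivative_eq_intros\<close>)
  show "((\<lambda>t. f (t, x)) has_derivative (\<lambda>v. D (v, 0))) (at t)"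
    by (rule has_derivative_compose[of "\<lambda>t. (t, x)" "\<lambda>v. (v, 0)" t UNIV f D])
      (use assms in \<open>auto intro!: derivative_eq_intros\<close>)
qed

lemma C1_on_slice:
  fixes f :: "'a::euclidean_space \<times> 'b::euclidean_space \<Rightarrow> 'c::real_normed_vector"
  assumes "C1_on U f"
  shows "C1_on {x. (t, x) \<in> U} (\<lambda>x. f (t, x))"
proof (rule C1_onI)
  show "((\<lambda>x. f (t, x)) has_derivative (\<lambda>v. frechet_derivative f (at (t, x)) (0, v))) (at x)"
    if "x \<in> {x. (t, x) \<in> U}" for x
    using that by (intro has_derivative_slice(1) C1_onD(1)[OF assms]) auto
  show "continuous_on {x. (t, x) \<in> U} (\<lambda>x. frechet_derivative f (at (t, x)) (0, v))" for v
    by (rule continuous_on_compose2[OF C1_onD(2)[OF assms]]) (auto intro!: continuous_intros)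
qed

lemma open_slice:
  fixes U :: "('a::euclidean_space \<times> 'b::euclidean_space) set"
  shows "open U \<Longrightarrow> open {x. (t, x) \<in> U}"
  using continuous_open_vimage[of U "\<lambda>x. (t, x)"] by (auto simp: vimage_def intro!: continuous_intros)

lemma grad_inner:
  assumes "(f has_derivative D) (at x)"
  shows "grad f x \<bullet> v = D v"
proof -
  interpret D: bounded_linear D using assms by (rule has_derivative_bounded_linear)
  have "frechet_derivative f (at x) = D" using frechet_derivative_at[OF assms] by simp
  then have "grad f x \<bullet> v = (\<Sum>i\<in>UNIV. v $ i * D (axis i 1))"
    by (simp add: grad_def inner_vec_def mult.commute)
  also have "\<dots> = D (\<Sum>i\<in>UNIV. v $ i *\<^sub>R axis i 1)"
    by (simp add: D.sum D.scaleR)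
  also have "(\<Sum>i\<in>UNIV. v $ i *\<^sub>R axis i 1) = v"
    using basis_expansion[of v] by (simp add: scalar_mult_eq_scaleR)
  finally show ?thesis .
qed

lemma grad_eqI:
  assumes "(f has_derivative (\<lambda>v. g \<bullet> v)) (at x)"
  shows "grad f x = g"
  using grad_inner[OF assms] by (metis vector_eq_rdot)

lemma has_derivative_grad:
  assumes "C1_on V f" "x \<in> V"
  shows "(f has_derivative (\<lambda>v. grad f x \<bullet> v)) (at x)"
  using C1_onD(1)[OF assms] grad_inner[OF C1_onD(1)[OF assms]] by simp

lemma C1_on_vecI:
  fixes F :: "'a::euclidean_space \<Rightarrow> real^'n"
  assumes "\<And>i. C1_on V (\<lambda>x. F x $ i)"
  shows "C1_on V F"
proof -
  have "F x = (\<Sum>i\<in>UNIV. (F x $ i) *\<^sub>R axis i 1)" for x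
    using basis_expansion[of "F x"] by (simp add: scalar_mult_eq_scaleR)
  then have "F = (\<lambda>x. \<Sum>i\<in>UNIV. (F x $ i) *\<^sub>R axis i 1)" by (rule ext)
  moreover have "C1_on V (\<lambda>x. \<Sum>i\<in>UNIV. (F x $ i) *\<^sub>R (axis i 1 :: real^'n))"
    by (intro C1_on_sum C1_on_scaleR C1_on_const assms)
  ultimately show ?thesis by simp
qed

lemma C1_on_matrix_vector_mult:
  fixes A :: "'a::euclidean_space \<Rightarrow> real^'n^'m"
  assumes "\<And>i j. C1_on V (\<lambda>x. A x $ i $ j)" "\<And>j. C1_on V (\<lambda>x. P x $ j)"
  shows "C1_on V (\<lambda>x. A x *v P x)"
  by (rule C1_on_vecI) (auto simp: matrix_vector_mult_def intro!: C1_on_sum C1_on_mult assms)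

lemma divergence_has_derivative:
  assumes "(F has_derivative D) (at x)"
  shows "divergence F x = (\<Sum>i\<in>UNIV. D (axis i 1) $ i)"
  using frechet_derivative_at[OF assms] by (simp add: divergence_def)

lemma divergence_scaleR:
  assumes \<phi>: "(\<phi> has_derivative (\<lambda>v. g \<bullet> v)) (at x)" and P: "(P has_derivative D) (at x)"
  shows "divergence (\<lambda>x. \<phi> x *\<^sub>R P x) x = g \<bullet> P x + \<phi> x * divergence P x"
proof -
  have "((\<lambda>x. \<phi> x *\<^sub>R P x) has_derivative (\<lambda>v. \<phi> x *\<^sub>R D v + (g \<bullet> v) *\<^sub>R P x)) (at x)"
    using \<phi> P by (rule has_derivative_scaleR)
  from divergence_has_derivative[OF this] show ?thesis
    by (simp add: divergence_has_derivative[OF P] sum.distrib sum_distrib_left inner_axis inner_vec_def[of g])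
qed

lemma divergence_diff:
  assumes P: "(P has_derivative D) (at x)" and Q: "(Q has_derivative E) (at x)"
  shows "divergence (\<lambda>x. P x - Q x) x = divergence P x - divergence Q x"
  using divergence_has_derivative[OF has_derivative_diff[OF P Q]]
  by (simp add: divergence_has_derivative[OF P] divergence_has_derivative[OF Q] sum_subtractf)

lemma grad_quotient:
  assumes v: "(v has_derivative (\<lambda>e. g \<bullet> e)) (at x)" and b: "(b has_derivative (\<lambda>e. h \<bullet> e)) (at x)"
    and "b x \<noteq> 0"
  shows "((\<lambda>y. v y / b y) has_derivative (\<lambda>e. ((1 / (b x)\<^sup>2) *\<^sub>R (b x *\<^sub>R g - v x *\<^sub>R h)) \<bullet> e)) (at x)"
  using has_derivative_divide'[OF v b \<open>b x \<noteq> 0\<close>]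
  by (rule has_derivative_eq_rhs) (auto simp: fun_eq_iff inner_diff_left power2_eq_square field_simps)

lemma symmetric_matrix_inner:
  fixes M :: "real^'n^'n"
  assumes "transpose M = M"
  shows "x \<bullet> (M *v y) = y \<bullet> (M *v x)"
  using dot_lmul_matrix[of x M y] assms by (metis inner_commute transpose_matrix_vector)

text \<open>The key identity: \<open>b A\<nabla>v - v A\<nabla>b = b\<^sup>2 A\<nabla>(v/b)\<close>, and by symmetry of \<open>A\<close> the first-order terms
  \<open>\<nabla>b \<bullet> A\<nabla>v\<close> and \<open>\<nabla>v \<bullet> A\<nabla>b\<close> cancel in its divergence.\<close>
lemma divergence_relative_flux:
  fixes A :: "real^'n \<Rightarrow> real^'n^'n"
  assumes v: "C1_on V v" and b: "C1_on V b"
    and P: "C1_on V (\<lambda>y. A y *v grad v y)" and Q: "C1_on V (\<lambda>y. A y *v grad b y)"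
    and x: "x \<in> V" and sym: "transpose (A x) = A x" and b0: "b x \<noteq> 0"
    and k: "(k has_real_derivative k') (at (v x / b x))"
  shows "divergence (\<lambda>y. k (v y / b y) *\<^sub>R (b y *\<^sub>R (A y *v grad v y) - v y *\<^sub>R (A y *v grad b y))) x =
      (b x)\<^sup>2 * k' * (grad (\<lambda>y. v y / b y) x \<bullet> (A x *v grad (\<lambda>y. v y / b y) x)) +
      k (v x / b x) * (b x * divergence (\<lambda>y. A y *v grad v y) x - v x * divergence (\<lambda>y. A y *v grad b y) x)"
proof -
  note dv = has_derivative_grad[OF v x] and db = has_derivative_grad[OF b x]
  note dP = C1_onD(1)[OF P x] and dQ = C1_onD(1)[OF Q x]
  define w where "w y = v y / b y" for y
  define p where "p y = A y *v grad v y" for y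
  define q where "q y = A y *v grad b y" for y
  have dw: "(w has_derivative (\<lambda>e. ((1 / (b x)\<^sup>2) *\<^sub>R (b x *\<^sub>R grad v x - v x *\<^sub>R grad b x)) \<bullet> e)) (at x)"
    unfolding w_def[abs_def] by (rule grad_quotient[OF dv db b0])
  then have gw: "grad w x = (1 / (b x)\<^sup>2) *\<^sub>R (b x *\<^sub>R grad v x - v x *\<^sub>R grad b x)"
    by (rule grad_eqI)
  have flux: "b x *\<^sub>R p x - v x *\<^sub>R q x = (b x)\<^sup>2 *\<^sub>R (A x *v grad w x)"
    using b0 by (simp add: gw p_def q_def matrix_vector_mult_diff_distrib matrix_vector_mult_scaleR)
  have dk: "((\<lambda>y. k (w y)) has_derivative (\<lambda>e. (k' *\<^sub>R grad w x) \<bullet> e)) (at x)"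
    using has_derivative_compose[OF dw, of k "(*) k'"] k
    by (simp add: has_field_derivative_def w_def gw)
  have dbp: "((\<lambda>y. b y *\<^sub>R p y) has_derivative (\<lambda>e. b x *\<^sub>R frechet_derivative p (at x) e + (grad b x \<bullet> e) *\<^sub>R p x)) (at x)"
    using has_derivative_scaleR[OF db dP[folded p_def[abs_def]]] by simp
  have dvq: "((\<lambda>y. v y *\<^sub>R q y) has_derivative (\<lambda>e. v x *\<^sub>R frechet_derivative q (at x) e + (grad v x \<bullet> e) *\<^sub>R q x)) (at x)"
    using has_derivative_scaleR[OF dv dQ[folded q_def[abs_def]]] by simp
  have "divergence (\<lambda>y. k (w y) *\<^sub>R (b y *\<^sub>R p y - v y *\<^sub>R q y)) x =
      (k' *\<^sub>R grad w x) \<bullet> (b x *\<^sub>R p x - v x *\<^sub>R q x) + k (w x) * divergence (\<lambda>y. b y *\<^sub>R p y - v y *\<^sub>R q y) x"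
    by (rule divergence_scaleR[OF dk has_derivative_diff[OF dbp dvq]])
  also have "divergence (\<lambda>y. b y *\<^sub>R p y - v y *\<^sub>R q y) x = divergence (\<lambda>y. b y *\<^sub>R p y) x - divergence (\<lambda>y. v y *\<^sub>R q y) x"
    by (rule divergence_diff[OF dbp dvq])
  also have "divergence (\<lambda>y. b y *\<^sub>R p y) x = grad b x \<bullet> p x + b x * divergence p x"
    by (rule divergence_scaleR[OF db dP[folded p_def[abs_def]]])
  also have "divergence (\<lambda>y. v y *\<^sub>R q y) x = grad v x \<bullet> q x + v x * divergence q x"
    by (rule divergence_scaleR[OF dv dQ[folded q_def[abs_def]]])
  also have "grad b x \<bullet> p x = grad v x \<bullet> q x"
    unfolding p_def q_def by (rule symmetric_matrix_inner[OF sym])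
  finally show ?thesis
    by (simp add: flux w_def[symmetric] p_def[symmetric] q_def[symmetric] algebra_simps)
qed

section \<open>Integrals over the domain and their time derivatives\<close>

lemma continuous_on_closure_integrable:
  fixes f :: "'a::euclidean_space \<Rightarrow> real"
  assumes \<Omega>: "open \<Omega>" "bounded \<Omega>" and f: "continuous_on (closure \<Omega>) f"
  shows "f integrable_on \<Omega>"
proof -
  have lm: "\<Omega> \<in> lmeasurable" using \<Omega> by (simp add: lmeasurable_open)
  have "compact (f ` closure \<Omega>)" using \<Omega> f by (intro compact_continuous_image) (auto simp: compact_closure)
  then obtain M where "\<And>x. x \<in> closure \<Omega> \<Longrightarrow> norm (f x) \<le> M"
    by (fastforce dest!: compact_imp_bounded simp: bounded_iff)
  then have M: "\<And>x. x \<in> \<Omega> \<Longrightarrow> norm (f x) \<le> M" using closure_subset by blast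
  have "f \<in> borel_measurable (lebesgue_on \<Omega>)"
    using continuous_on_subset[OF f closure_subset] lm
    by (intro continuous_imp_measurable_on_sets_lebesgue) auto
  moreover have "(\<lambda>_. M) integrable_on \<Omega>" using lm by (rule integrable_on_const)
  ultimately have "f absolutely_integrable_on \<Omega>"
    using M lm by (intro measurable_bounded_by_integrable_imp_absolutely_integrable) auto
  then show ?thesis using absolutely_integrable_on_def by blast
qed

text \<open>By the mean value inequality the bound on the time derivative also bounds the difference
  quotients, and a constant is integrable over a set of finite measure.\<close>

lemma has_real_derivative_integral:
  fixes f :: "real \<Rightarrow> 'a::euclidean_space \<Rightarrow> real"
  assumes \<delta>: "0 < \<delta>" and \<Omega>: "\<Omega> \<in> lmeasurable"
    and der: "\<And>s x. s \<in> cball t \<delta> \<Longrightarrow> x \<in> \<Omega> \<Longrightarrow> ((\<lambda>s. f s x) has_real_derivative f' s x) (at s)"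
    and int: "\<And>s. s \<in> cball t \<delta> \<Longrightarrow> f s integrable_on \<Omega>"
    and bound: "\<And>s x. s \<in> cball t \<delta> \<Longrightarrow> x \<in> \<Omega> \<Longrightarrow> \<bar>f' s x\<bar> \<le> M"
  shows "((\<lambda>s. integral \<Omega> (f s)) has_real_derivative integral \<Omega> (f' t)) (at t)"
proof -
  define g where "g h x = (f (t + h) x - f t x) / h" for h x
  have gb: "norm (g h x) \<le> M" if "h \<noteq> 0" "\<bar>h\<bar> < \<delta>" "x \<in> \<Omega>" for h x
  proof -
    have "norm (f (t + h) x - f t x) \<le> M * norm (t + h - t)"
    proof (rule field_differentiable_bound[of "cball t \<delta>" "\<lambda>s. f s x" "\<lambda>s. f' s x"])
      show "((\<lambda>s. f s x) has_field_derivative f' s x) (at s within cball t \<delta>)" if "s \<in> cball t \<delta>" for s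
        using der[OF that \<open>x \<in> \<Omega>\<close>] by (rule has_field_derivative_at_within)
      show "norm (f' s x) \<le> M" if "s \<in> cball t \<delta>" for s
        using bound[OF that \<open>x \<in> \<Omega>\<close>] by simp
    qed (use that \<delta> in \<open>auto simp: dist_real_def\<close>)
    then show ?thesis using that by (simp add: g_def divide_simps abs_mult)
  qed
  have eq: "(integral \<Omega> (f (t + h)) - integral \<Omega> (f t)) / h = integral \<Omega> (g h)" and gi: "g h integrable_on \<Omega>"
    if "\<bar>h\<bar> < \<delta>" for h
  proof -
    have i: "f (t + h) integrable_on \<Omega>" "f t integrable_on \<Omega>"
      using that \<delta> by (auto intro!: int simp: dist_real_def)
    show "g h integrable_on \<Omega>"
      unfolding g_def[abs_def] by (intro integrable_on_divide integrable_diff i)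
    show "(integral \<Omega> (f (t + h)) - integral \<Omega> (f t)) / h = integral \<Omega> (g h)"
      unfolding g_def[abs_def] using i by (simp add: integral_diff)
  qed
  have "((\<lambda>h. (integral \<Omega> (f (t + h)) - integral \<Omega> (f t)) / h) \<longlongrightarrow> integral \<Omega> (f' t)) (at 0)"
    unfolding tendsto_at_iff_sequentially comp_def
  proof (intro allI impI)
    fix X :: "nat \<Rightarrow> real" assume X: "\<forall>i. X i \<in> UNIV - {0}" "X \<longlonglongrightarrow> 0"
    obtain N where N: "\<And>n. n \<ge> N \<Longrightarrow> \<bar>X n\<bar> < \<delta>"
      using LIMSEQ_D[OF X(2) \<delta>] by auto
    \<comment> \<open>Domination must hold for every index, so the initial terms, whose steps may
      exceed \<open>\<delta>\<close>, are cut off.\<close>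
    define Y where "Y n = X (n + N)" for n
    have Y: "Y n \<noteq> 0" "\<bar>Y n\<bar> < \<delta>" for n using X(1) N by (auto simp: Y_def)
    have "Y \<longlonglongrightarrow> 0" unfolding Y_def using X(2) by (rule LIMSEQ_ignore_initial_segment)
    then have Y0: "filterlim Y (at 0) sequentially" using Y(1) by (simp add: filterlim_at)
    have "(\<lambda>n. integral \<Omega> (g (Y n))) \<longlonglongrightarrow> integral \<Omega> (f' t)"
    proof (rule dominated_convergence(2)[where h="\<lambda>_. M"])
      show "g (Y n) integrable_on \<Omega>" for n using Y by (intro gi)
      show "(\<lambda>_. M) integrable_on \<Omega>" using \<Omega> by (rule integrable_on_const)
      show "norm (g (Y n) x) \<le> M" if "x \<in> \<Omega>" for n x using gb Y that by blast
      show "(\<lambda>n. g (Y n) x) \<longlonglongrightarrow> f' t x" if "x \<in> \<Omega>" for x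
      proof -
        have "((\<lambda>h. g h x) \<longlongrightarrow> f' t x) (at 0)"
          using der[of t x] that \<delta> by (simp add: DERIV_def g_def)
        from filterlim_compose[OF this Y0] show ?thesis .
      qed
    qed
    then have "(\<lambda>n. (integral \<Omega> (f (t + X (n + N))) - integral \<Omega> (f t)) / X (n + N)) \<longlonglongrightarrow> integral \<Omega> (f' t)"
      using eq[OF Y(2)] by (simp add: Y_def)
    then show "(\<lambda>n. (integral \<Omega> (f (t + X n)) - integral \<Omega> (f t)) / X n) \<longlonglongrightarrow> integral \<Omega> (f' t)"
      by (rule LIMSEQ_offset)
  qed
  then show ?thesis by (simp add: DERIV_def)
qed

text \<open>On the real line the only basis vector is 1, so the iterated partial derivatives in
  \<open>Ck_on\<close> become iterated \<open>deriv\<close>.\<close>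

lemma Ck_on_2_real:
  fixes H :: "real \<Rightarrow> real"
  assumes "Ck_on 2 UNIV H"
  shows "(H has_real_derivative deriv H s) (at s)"
    "(deriv H has_real_derivative deriv (deriv H) s) (at s)"
    "continuous_on UNIV (deriv (deriv H))"
proof -
  have fr: "frechet_derivative f (at s) 1 = deriv f s" "(f has_real_derivative deriv f s) (at s)"
    if d: "f differentiable (at s)" for f :: "real \<Rightarrow> real" and s
  proof -
    obtain D where D: "(f has_real_derivative D) (at s)"
      using d real_differentiable_def by blast
    then show 1: "(f has_real_derivative deriv f s) (at s)" using DERIV_imp_deriv by blast
    then have "(*) (deriv f s) = frechet_derivative f (at s)"
      unfolding has_field_derivative_def by (rule frechet_derivative_at)
    from fun_cong[OF this, of 1] show "frechet_derivative f (at s) 1 = deriv f s" by simp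
  qed
  have C: "Ck_on (Suc (Suc 0)) UNIV H" using assms by (simp only: numeral_2_eq_2)
  then have d1: "H differentiable (at s)" for s by simp
  have e1: "(\<lambda>x. frechet_derivative H (at x) 1) = deriv H" using fr(1)[OF d1] by (intro ext)
  have C1: "Ck_on (Suc 0) UNIV (deriv H)"
    using C by (simp del: Ck_on.simps add: Ck_on.simps(2)[of "Suc 0"] e1)
  then have d2: "deriv H differentiable (at s)" for s by simp
  have e2: "(\<lambda>x. frechet_derivative (deriv H) (at x) 1) = deriv (deriv H)" using fr(1)[OF d2] by (intro ext)
  show "(H has_real_derivative deriv H s) (at s)" by (rule fr(2)[OF d1])
  show "(deriv H has_real_derivative deriv (deriv H) s) (at s)" by (rule fr(2)[OF d2])
  show "continuous_on UNIV (deriv (deriv H))" using C1 by (simp add: e2)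
qed

text \<open>The boundary conditions are stated for the conormal flux
  \<open>A x *v grad (u t) x\<close>, which is the form that makes the flux field tangential. The
  symmetry contained in \<open>unif_elliptic_field\<close> cancels the mixed gradient terms.\<close>

theorem theorem2p1:
  fixes \<Omega> :: "(real^'n) set"
    and A :: "real^'n \<Rightarrow> real^'n^'n"
    and r :: "real^'n \<Rightarrow> real"
    and K :: "real^'n \<Rightarrow> real^'n \<Rightarrow> real"
    and p :: real
    and H :: "real \<Rightarrow> real"
    and u :: "real \<Rightarrow> real^'n \<Rightarrow> real"
    and ub :: "real^'n \<Rightarrow> real"
  assumes dom: "lipschitz_domain \<Omega>"
    and A: "unif_elliptic_field \<Omega> A"
    and r: "\<exists>L. L-lipschitz_on (closure \<Omega>) r"
    and K: "\<exists>L. L-lipschitz_on (closure \<Omega> \<times> closure \<Omega>) (\<lambda>(x, y). K x y)"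
    and p: "p \<ge> 1"
    and H: "Ck_on 2 UNIV H"
    and u_smooth: "smooth_on_set ({0<..} \<times> closure \<Omega>) (\<lambda>(t, x). u t x)"
    and u_eq: "\<forall>t>0. \<forall>x\<in>\<Omega>.
        deriv (\<lambda>s. u s x) t =
          u t x * (r x - Psi \<Omega> K p x (u t)) + divergence (\<lambda>y. A y *v grad (u t) y) x"
    and u_bc: "\<forall>t>0. \<forall>x \<nu>. outward_normal \<Omega> x \<nu> \<longrightarrow> (A x *v grad (u t) x) \<bullet> \<nu> = 0"
    and ub_smooth: "smooth_on_set (closure \<Omega>) ub"
    and ub_pos: "\<forall>x\<in>closure \<Omega>. ub x > 0"
    and ub_eq: "\<forall>x\<in>\<Omega>. ub x * (r x - Psi \<Omega> K p x ub) + divergence (\<lambda>y. A y *v grad ub y) x = 0"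
    and ub_bc: "\<forall>x \<nu>. outward_normal \<Omega> x \<nu> \<longrightarrow> (A x *v grad ub x) \<bullet> \<nu> = 0"
  shows "\<forall>t>0.
    ((\<lambda>s. integral \<Omega> (\<lambda>x. (ub x)\<^sup>2 * H (u s x / ub x))) has_real_derivative
       (- integral \<Omega> (\<lambda>x. (ub x)\<^sup>2 * deriv (deriv H) (u t x / ub x) *
              (grad (\<lambda>y. u t y / ub y) x \<bullet> (A x *v grad (\<lambda>y. u t y / ub y) x)))
        + integral \<Omega> (\<lambda>x. ub x * deriv H (u t x / ub x) *
              (Psi \<Omega> K p x ub - Psi \<Omega> K p x (u t)) * u t x))) (at t)"
proof (intro allI impI)
  fix t :: real assume t: "t > 0"
  have \<Omega>: "open \<Omega>" "bounded \<Omega>" using dom by (auto simp: lipschitz_domain_def)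
  have cl: "x \<in> closure \<Omega>" if "x \<in> \<Omega>" for x using that closure_subset by blast
  note H' = Ck_on_2_real[OF H]
  have H'c: "continuous_on UNIV (deriv H)" "continuous_on UNIV H"
    using H'(1,2) by (auto intro!: continuous_at_imp_continuous_on DERIV_isCont)
  define U where "U z = u (fst z) (snd z)" for z
  have U_eq: "(\<lambda>(t, x). u t x) = U" by (auto simp: U_def)
  obtain S where S: "open S" "{0<..} \<times> closure \<Omega> \<subseteq> S" "\<And>k. Ck_on k S U"
    using u_smooth unfolding smooth_on_set_def U_eq by blast
  obtain B where B: "open B" "closure \<Omega> \<subseteq> B" "\<And>k. Ck_on k B ub"
    using ub_smooth unfolding smooth_on_set_def by blast
  obtain W where W: "open W" "closure \<Omega> \<subseteq> W" "\<And>k. Ck_on k W A"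
    and sym: "\<And>x. x \<in> closure \<Omega> \<Longrightarrow> transpose (A x) = A x"
    using A unfolding unif_elliptic_field_def smooth_on_set_def by blast
  have UC1: "C1_on S U" by (rule Ck_on_Suc_imp_C1[OF S(3)])
  \<comment> \<open>An open neighbourhood of the closure on which \<open>u t\<close>,
    \<open>ub\<close> and \<open>A\<close> are all regular and \<open>ub\<close> stays positive, so
    that the quotient and the flux are defined and continuously differentiable beyond the
    boundary.\<close>
  define V where "V = {x. (t, x) \<in> S} \<inter> (B \<inter> ub -` {0<..}) \<inter> W"
  have V_open: "open V"
    unfolding V_def
    by (intro open_Int open_slice S W continuous_open_preimage[OF Ck_on_imp_continuous_on[OF B(3)]] B) auto
  have V_cl: "closure \<Omega> \<subseteq> V" using S(2) B(2) W(2) ub_pos t by (auto simp: V_def)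
  have V_pos: "ub x > 0" if "x \<in> V" for x using that by (simp add: V_def)
  have uC1: "C1_on V (u t)"
    using C1_on_subset[OF C1_on_slice[OF UC1, of t], of V] by (auto simp: U_def V_def)
  have bC1: "C1_on V ub"
    using C1_on_subset[OF Ck_on_Suc_imp_C1[OF B(3)], of V] by (auto simp: V_def)
  \<comment> \<open>Smoothness is given jointly in time and space, so a spatial partial derivative
    of the slice is read as a derivative of \<open>U\<close> in the direction
    \<open>(0, axis i 1)\<close>.\<close>
  have gu: "C1_on V (\<lambda>x. grad (u t) x $ i)" for i
  proof (rule C1_on_cong_open[OF _ V_open])
    show "C1_on V (\<lambda>x. frechet_derivative U (at (t, x)) (0, axis i 1))"
    proof (rule C1_on_subset[OF C1_on_slice])
      show "C1_on S (\<lambda>z. frechet_derivative U (at z) (0, axis i 1))"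
        by (rule Ck_on_partial_C1[OF S(3)]) (auto simp: Basis_prod_def Basis_vec_def)
    qed (auto simp: V_def)
    fix x assume "x \<in> V"
    then have "(U has_derivative frechet_derivative U (at (t, x))) (at (t, x))"
      by (intro C1_onD(1)[OF UC1]) (simp add: V_def)
    from has_derivative_slice(1)[OF this]
    have "frechet_derivative (\<lambda>x. U (t, x)) (at x) = (\<lambda>v. frechet_derivative U (at (t, x)) (0, v))"
      by (rule frechet_derivative_at[symmetric])
    then show "frechet_derivative U (at (t, x)) (0, axis i 1) = grad (u t) x $ i"
      by (simp add: grad_def U_def)
  qed
  have gb: "C1_on V (\<lambda>x. grad ub x $ i)" for i
  proof -
    have "C1_on B (\<lambda>x. frechet_derivative ub (at x) (axis i 1))"
      by (rule Ck_on_partial_C1[OF B(3)]) (auto simp: Basis_vec_def)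
    then have "C1_on V (\<lambda>x. frechet_derivative ub (at x) (axis i 1))"
      by (rule C1_on_subset) (auto simp: V_def)
    then show ?thesis by (simp add: grad_def)
  qed
  have AC1: "C1_on V (\<lambda>x. A x $ i $ j)" for i j
    by (intro C1_on_linear_compose[OF bounded_linear_vec_nth] C1_on_subset[OF Ck_on_Suc_imp_C1[OF W(3)]])
      (auto simp: V_def)
  have PC1: "C1_on V (\<lambda>y. A y *v grad (u t) y)" and QC1: "C1_on V (\<lambda>y. A y *v grad ub y)"
    by (intro C1_on_matrix_vector_mult AC1 gu gb)+
  define w where "w y = u t y / ub y" for y
  have wC1: "C1_on V w"
    unfolding w_def divide_inverse using V_pos
    by (intro C1_on_mult uC1 C1_on_inverse bC1) (auto simp: less_imp_neq[symmetric])
  have kC1: "C1_on V (\<lambda>y. deriv H (w y))"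
    by (rule C1_on_real_compose[OF H'(2) H'(3) wC1]) auto
  define F where "F y = deriv H (w y) *\<^sub>R (ub y *\<^sub>R (A y *v grad (u t) y) - u t y *\<^sub>R (A y *v grad ub y))" for y
  have FC1: "C1_on V F"
    unfolding F_def[abs_def] by (intro C1_on_scaleR C1_on_diff kC1 bC1 PC1 uC1 QC1)
  have div0: "(divergence F has_integral 0) \<Omega>"
  proof (rule divergence_theorem_tangential_field[OF dom V_open V_cl FC1])
    fix x \<nu> assume "outward_normal \<Omega> x \<nu>"
    then have "(A x *v grad (u t) x) \<bullet> \<nu> = 0" "(A x *v grad ub x) \<bullet> \<nu> = 0"
      using u_bc ub_bc t by blast+
    then show "F x \<bullet> \<nu> = 0" by (simp add: F_def inner_diff_left)
  qed
  define D where "D x = (ub x)\<^sup>2 * deriv (deriv H) (w x) * (grad w x \<bullet> (A x *v grad w x))" for x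
  \<comment> \<open>The time derivative of the integrand of the entropy: one factor
    \<open>ub x\<close> of the square cancels against the derivative of
    \<open>u / ub\<close>.\<close>
  define E where "E s x = ub x * deriv H (u s x / ub x) * frechet_derivative U (at (s, x)) (1, 0)" for s x
  define I where "I x = ub x * deriv H (w x) * (Psi \<Omega> K p x ub - Psi \<Omega> K p x (u t)) * u t x" for x
  have pos: "ub x > 0" if "x \<in> closure \<Omega>" for x using ub_pos that by blast
  have ne: "\<forall>x\<in>closure \<Omega>. ub x \<noteq> 0" using ub_pos by force
  have bc: "continuous_on (closure \<Omega>) ub"
    using continuous_on_subset[OF Ck_on_imp_continuous_on[OF B(3)] B(2)] .
  have Uder: "((\<lambda>s. u s x) has_real_derivative frechet_derivative U (at (s, x)) (1, 0)) (at s)"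
    if "s > 0" "x \<in> closure \<Omega>" for s x
  proof -
    have "(U has_derivative frechet_derivative U (at (s, x))) (at (s, x))"
      using S(2) that by (intro C1_onD(1)[OF UC1]) auto
    note D = has_derivative_slice(2)[OF this] and lin = has_derivative_linear[OF this]
    have "(\<lambda>v. frechet_derivative U (at (s, x)) (v, 0)) = (*) (frechet_derivative U (at (s, x)) (1, 0))"
    proof
      fix v
      show "frechet_derivative U (at (s, x)) (v, 0) = frechet_derivative U (at (s, x)) (1, 0) * v"
        using linear_cmul[OF lin, of v "(1, 0)"] by simp
    qed
    then show ?thesis using D unfolding has_field_derivative_def U_def fst_conv snd_conv by (simp only:)
  qed
  have dH: "((\<lambda>s. integral \<Omega> (\<lambda>x. (ub x)\<^sup>2 * H (u s x / ub x))) has_real_derivative integral \<Omega> (E t)) (at t)"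
  proof -
    \<comment> \<open>The radius \<open>t / 2\<close> keeps all times positive, and compactness of
      \<open>J\<close> provides the uniform bound on \<open>E\<close>.\<close>
    define J where "J = cball t (t / 2) \<times> closure \<Omega>"
    have J_pos: "s > 0" if "s \<in> cball t (t / 2)" for s
      using that t by (auto simp: dist_real_def abs_if split: if_splits)
    have JS: "J \<subseteq> S" using S(2) J_pos by (auto simp: J_def)
    have "compact J" unfolding J_def using \<Omega> by (intro compact_Times) (auto simp: compact_closure)
    have bJ: "continuous_on J (\<lambda>z. ub (snd z))"
      by (rule continuous_on_compose2[OF bc]) (auto simp: J_def intro!: continuous_intros)
    have uJ: "continuous_on J (\<lambda>z. u (fst z) (snd z))"
      using continuous_on_subset[OF C1_onD(3)[OF UC1] JS] by (simp add: U_def[abs_def])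
    have neJ: "\<forall>z\<in>J. ub (snd z) \<noteq> 0" using ne by (auto simp: J_def)
    have wJ: "continuous_on J (\<lambda>z. u (fst z) (snd z) / ub (snd z))"
      using bJ uJ neJ by (intro continuous_on_divide)
    have "continuous_on J (\<lambda>z. E (fst z) (snd z))"
      unfolding E_def prod.collapse
      by (intro continuous_on_mult bJ continuous_on_compose2[OF H'c(1) wJ] continuous_on_subset[OF C1_onD(2)[OF UC1] JS]) auto
    then have "compact ((\<lambda>z. E (fst z) (snd z)) ` J)"
      using \<open>compact J\<close> by (rule compact_continuous_image)
    then obtain M where M: "\<And>z. z \<in> J \<Longrightarrow> \<bar>E (fst z) (snd z)\<bar> \<le> M"
      by (fastforce dest!: compact_imp_bounded simp: bounded_iff)
    show ?thesis
    proof (rule has_real_derivative_integral[where \<delta>="t / 2" and M=M and f'=E])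
      show "\<Omega> \<in> lmeasurable" using \<Omega> by (simp add: lmeasurable_open)
      fix s assume s: "s \<in> cball t (t / 2)"
      show "(\<lambda>x. (ub x)\<^sup>2 * H (u s x / ub x)) integrable_on \<Omega>"
      proof (rule continuous_on_closure_integrable[OF \<Omega>])
        have "continuous_on (closure \<Omega>) (\<lambda>x. u s x / ub x)"
        proof -
          have "(\<lambda>x. (s, x)) ` closure \<Omega> \<subseteq> J" using s by (auto simp: J_def)
          from continuous_on_compose2[OF wJ _ this] show ?thesis by (simp add: continuous_on_Pair)
        qed
        from continuous_on_compose2[OF H'c(2) this]
        show "continuous_on (closure \<Omega>) (\<lambda>x. (ub x)\<^sup>2 * H (u s x / ub x))"
          by (intro continuous_on_mult continuous_on_power bc) auto
      qed
      fix x assume x: "x \<in> \<Omega>"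
      show "\<bar>E s x\<bar> \<le> M" using M[of "(s, x)"] s x cl by (auto simp: J_def)
      have u': "((\<lambda>s. u s x) has_real_derivative frechet_derivative U (at (s, x)) (1, 0)) (at s)"
        by (rule Uder[OF J_pos[OF s] cl[OF x]])
      have "((\<lambda>s. H (u s x / ub x)) has_real_derivative
          deriv H (u s x / ub x) * (frechet_derivative U (at (s, x)) (1, 0) / ub x)) (at s)"
        by (rule DERIV_chain2[OF H'(1) DERIV_cdivide[OF u']])
      from DERIV_cmult[OF this, of "(ub x)\<^sup>2"]
      show "((\<lambda>s. (ub x)\<^sup>2 * H (u s x / ub x)) has_real_derivative E s x) (at s)"
        using pos[OF cl[OF x]] by (simp add: E_def power2_eq_square field_simps)
    qed (use t in auto)
  qed
  have wc: "continuous_on (closure \<Omega>) w" using continuous_on_subset[OF C1_onD(3)[OF wC1] V_cl] .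
  have Ei: "E t integrable_on \<Omega>"
  proof (rule continuous_on_closure_integrable[OF \<Omega>])
    have "continuous_on (closure \<Omega>) (\<lambda>x. frechet_derivative U (at (t, x)) (1, 0))"
      by (rule continuous_on_compose2[OF C1_onD(2)[OF UC1]]) (use S(2) t in \<open>auto intro!: continuous_intros\<close>)
    then show "continuous_on (closure \<Omega>) (E t)"
      unfolding E_def[abs_def] w_def[symmetric]
      by (intro continuous_on_mult bc continuous_on_compose2[OF H'c(1) wc]) auto
  qed
  have Di: "D integrable_on \<Omega>"
  proof (rule continuous_on_closure_integrable[OF \<Omega>])
    have gc: "continuous_on (closure \<Omega>) (\<lambda>x. grad w x $ i)" for i
      unfolding grad_def using continuous_on_subset[OF C1_onD(2)[OF wC1] V_cl] by simp
    have Ac: "continuous_on (closure \<Omega>) (\<lambda>x. A x $ i $ j)" for i j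
      using continuous_on_subset[OF C1_onD(3)[OF AC1] V_cl] .
    show "continuous_on (closure \<Omega>) D"
      unfolding D_def[abs_def] inner_vec_def inner_real_def matrix_vector_mult_def vec_lambda_beta
      by (intro continuous_on_mult continuous_on_power continuous_on_sum bc gc Ac
          continuous_on_compose2[OF H'(3) wc]) auto
  qed
  \<comment> \<open>Integrability of \<open>I\<close>, and hence any regularity of the nonlocal term
    in \<open>x\<close>, is inherited through this identity from the three terms on the
    right.\<close>
  have "I x = E t x - divergence F x + D x" if x: "x \<in> \<Omega>" for x
  proof -
    have xc: "x \<in> closure \<Omega>" using x by (rule cl)
    have xV: "x \<in> V" using xc V_cl by blast
    have "divergence F x = (ub x)\<^sup>2 * deriv (deriv H) (w x) * (grad w x \<bullet> (A x *v grad w x)) +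
      deriv H (w x) * (ub x * divergence (\<lambda>y. A y *v grad (u t) y) x - u t x * divergence (\<lambda>y. A y *v grad ub y) x)"
      unfolding F_def[abs_def] w_def[abs_def]
      by (rule divergence_relative_flux[OF uC1 bC1 PC1 QC1 xV sym[OF xc]])
        (use pos[OF xc] H'(2) in auto)
    then have 1: "divergence F x = D x +
      deriv H (w x) * (ub x * divergence (\<lambda>y. A y *v grad (u t) y) x - u t x * divergence (\<lambda>y. A y *v grad ub y) x)"
      by (simp add: D_def)
    have "frechet_derivative U (at (t, x)) (1, 0) = deriv (\<lambda>s. u s x) t"
      using DERIV_imp_deriv[OF Uder[OF t xc]] by simp
    also have "\<dots> = u t x * (r x - Psi \<Omega> K p x (u t)) + divergence (\<lambda>y. A y *v grad (u t) y) x"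
      using u_eq t x by blast
    finally have 2: "E t x = ub x * deriv H (w x) * (u t x * (r x - Psi \<Omega> K p x (u t)) + divergence (\<lambda>y. A y *v grad (u t) y) x)"
      by (simp add: E_def w_def)
    have 3: "divergence (\<lambda>y. A y *v grad ub y) x = - (ub x * (r x - Psi \<Omega> K p x ub))"
      using ub_eq x by (simp add: eq_neg_iff_add_eq_0 add.commute)
    \<comment> \<open>The divergences of \<open>A y *v grad (u t) y\<close> cancel. The stationary
      equation turns the other one into a reaction term, whose \<open>r x\<close> cancels that of
      the evolution equation and leaves the difference of the two \<open>Psi\<close> terms.\<close>
    show ?thesis unfolding 1 2 3 I_def by (simp add: algebra_simps)
  qed
  then have "integral \<Omega> I = integral \<Omega> (\<lambda>x. E t x - divergence F x + D x)"
    by (rule Henstock_Kurzweil_Integration.integral_cong)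
  also have "\<dots> = integral \<Omega> (E t) - 0 + integral \<Omega> D"
    by (rule integral_unique)
      (intro has_integral_add has_integral_diff div0 integrable_integral Ei Di)
  finally have "integral \<Omega> (E t) = - integral \<Omega> D + integral \<Omega> I" by simp
  then show "((\<lambda>s. integral \<Omega> (\<lambda>x. (ub x)\<^sup>2 * H (u s x / ub x))) has_real_derivative
       (- integral \<Omega> (\<lambda>x. (ub x)\<^sup>2 * deriv (deriv H) (u t x / ub x) *
              (grad (\<lambda>y. u t y / ub y) x \<bullet> (A x *v grad (\<lambda>y. u t y / ub y) x)))
        + integral \<Omega> (\<lambda>x. ub x * deriv H (u t x / ub x) *
              (Psi \<Omega> K p x ub - Psi \<Omega> K p x (u t)) * u t x))) (at t)"
    using dH unfolding D_def[abs_def] I_def[abs_def] w_def[abs_def] by simp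
qed

end
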